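(* Let $n\ge 6$ be an integer such that $$p=(2n-1)(2n+1),\qquad q=(2n-1)(2n+3),\qquad r=(2n+1)(2n+3)$$ are squarefree integers, and let $K=\mathbb{Q}(\sqrt p,\sqrt q)$. Let $\varepsilon_p,\varepsilon_q,\varepsilon_r$ denote the fundamental units of $\mathbb{Q}(\sqrt p),\mathbb{Q}(\sqrt q),\mathbb{Q}(\sqrt r)$ respectively, chosen such that $\varepsilon_p,\varepsilon_q,\varepsilon_r>1$. A complete set of indecomposable elements in $\mathcal{O}_K^+$ modulo totally positive units is given by \begin{align*} &1,\qquad \frac{\varepsilon_p^{-1}+\varepsilon_r}{2},\qquad \mu:=\left(n+\tfrac32\right)+\tfrac12\sqrt p+\tfrac12\sqrt q+\tfrac12\sqrt r,\\ &1+\varepsilon_p+t(\mu-1),\qquad \frac{1+\varepsilon_p\varepsilon_r}{2}+\varepsilon_p+t(\mu-1)\qquad (3\le t\le 2n-2),\\ &1+\varepsilon_q^{-1}+t(\mu-1),\qquad \frac{1+\varepsilon_r\varepsilon_p}{2}+\varepsilon_q^{-1}+t(\mu-1)\qquad (4\le t\le 2n-1),\\ &\frac{\varepsilon_r^{-1}+\varepsilon_p}{2}+t(\mu-2)\qquad (2\le t\le 2n-1), \end{align*} where $t$ runs over integers in the indicated ranges. In particular, $\iota(K)=10n-15$.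
   Context: For a totally real number field $F$ with ring of integers $\mathcal{O}_F$, $\mathcal{O}_F^+$ denotes the set of elements of $\mathcal{O}_F$ that are positive under every embedding $F\hookrightarrow\mathbb{R}$ (totally positive). An element $\alpha\in\mathcal{O}_F^+$ is indecomposable if it cannot be written as $\alpha=\beta+\gamma$ with $\beta,\gamma\in\mathcal{O}_F^+$. $\iota(F)$ denotes the (finite) number of indecomposable elements of $\mathcal{O}_F^+$ up to multiplication by totally positive units of $\mathcal{O}_F$. A complete set of indecomposable elements modulo totally positive units is a set of representatives, one for each class, of the indecomposable elements of $\mathcal{O}_F^+$ under the equivalence $\alpha\sim\eta\alpha$ with $\eta$ a totally positive unit of $\mathcal{O}_F$. All square roots are taken positive, so the elements are viewed as real numbers in $K\subset\mathbb{R}$. *)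

theory Defs
  imports
    "HOL-Algebra.Generated_Fields"
    "HOL-Algebra.Algebraic_Closure_Type"
    "HOL-Computational_Algebra.Computational_Algebra"
begin

text \<open>
  Number fields are represented as subfields \<open>F\<close> of \<open>\<real>\<close>, i.e.\ as sets of reals.
\<close>

abbreviation real_ring :: "real ring" where
  "real_ring \<equiv> ring_of_type_algebra"

abbreviation subring_of_reals :: "real set \<Rightarrow> real ring" where
  "subring_of_reals A \<equiv> real_ring\<lparr>carrier := A\<rparr>"

text \<open>The field \<open>\<rat>(S)\<close>; in characteristic 0 the subfield generated by \<open>S\<close> contains \<open>\<rat>\<close>.\<close>

definition adjoin_rat :: "real set \<Rightarrow> real set" where
  "adjoin_rat S = generate_field real_ring S"

definition ring_of_integers :: "real set \<Rightarrow> real set" where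
  "ring_of_integers F = {x \<in> F. algebraic_int x}"

definition integer_units :: "real set \<Rightarrow> real set" where
  "integer_units F = Units (subring_of_reals (ring_of_integers F))"

text \<open>
  A unital ring homomorphism on a field is injective. Values of \<open>\<sigma>\<close> outside \<open>F\<close> are
  irrelevant, so one embedding is represented by many functions on \<^typ>\<open>real\<close>.
\<close>

definition real_embeddings :: "real set \<Rightarrow> (real \<Rightarrow> real) set" where
  "real_embeddings F = ring_hom (subring_of_reals F) real_ring"

definition totally_positive_integers :: "real set \<Rightarrow> real set" where
  "totally_positive_integers F =
     {x \<in> ring_of_integers F. \<forall>\<sigma> \<in> real_embeddings F. 0 < \<sigma> x}"

definition totally_positive_units :: "real set \<Rightarrow> real set" where
  "totally_positive_units F = integer_units F \<inter> totally_positive_integers F"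

definition indecomposables :: "real set \<Rightarrow> real set" where
  "indecomposables F =
     {\<alpha> \<in> totally_positive_integers F.
        \<not> (\<exists>\<beta> \<in> totally_positive_integers F. \<exists>\<gamma> \<in> totally_positive_integers F. \<alpha> = \<beta> + \<gamma>)}"

definition indecomposable_rel :: "real set \<Rightarrow> (real \<times> real) set" where
  "indecomposable_rel F =
     {(\<alpha>, \<beta>) \<in> indecomposables F \<times> indecomposables F.
        \<exists>\<eta> \<in> totally_positive_units F. \<beta> = \<eta> * \<alpha>}"

definition iota :: "real set \<Rightarrow> nat" where
  "iota F = card (indecomposables F // indecomposable_rel F)"

definition complete_set_of_indecomposables :: "real set \<Rightarrow> real set \<Rightarrow> bool" where
  "complete_set_of_indecomposables F S \<longleftrightarrow>
     S \<subseteq> indecomposables F \<and>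
     (\<forall>\<alpha> \<in> indecomposables F. \<exists>!\<beta>. \<beta> \<in> S \<and> (\<alpha>, \<beta>) \<in> indecomposable_rel F)"

text \<open>
  For a real quadratic field \<open>F\<close>: the generator \<open>> 1\<close> of the unit group modulo \<open>\<plusminus>1\<close>.
\<close>

definition fundamental_unit :: "real set \<Rightarrow> real" where
  "fundamental_unit F =
     (THE \<epsilon>. \<epsilon> \<in> integer_units F \<and> 1 < \<epsilon> \<and>
        (\<forall>u \<in> integer_units F. \<exists>k :: int. u = \<epsilon> powi k \<or> u = - (\<epsilon> powi k)))"

end

theory Submission
  imports Defs "HOL-Library.Product_Plus"
begin

text \<open>
  Let \<open>V\<close> be the group generated by the three fundamental units, all of which are totally positive.
  Modulo \<open>V\<close>, the boundary of the convex hull of the totally positive integers of \<open>K\<close> has only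
  two facets, on which two functionals \<open>L2\<close>, \<open>L3\<close> (traces against totally positive elements of the
  codifferent) take the value 1. For totally positive \<open>x\<close> choose \<open>v \<in> V\<close> minimising the positive
  integers \<open>L2 (v x)\<close>, \<open>L3 (v x)\<close>. Comparing with the neighbouring facets shows that \<open>v x\<close> lies in
  the cone over one of the two facets. The cone of \<open>L3\<close> is simplicial of index \<open>2n - 1\<close>, which yields
  the last family. The facet of \<open>L2\<close> is a Cayley polytope of two lattice hexagons; its cone is
  generated by the 14 lattice points of the facet (unit multiples of \<open>1\<close>, \<open>\<mu>\<close> and
  \<open>(\<epsilon>\<^sub>p\<inverse> + \<epsilon>\<^sub>r) / 2\<close>) and by four progressions of points at height 2.

  Elements of height 1 are indecomposable. If an element of height 2 were a sum, both summands would
  have height 1, and by minimality these are again among the known lattice points of the facets.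

  Since 1 is indecomposable, so is every totally positive unit, and therefore it lies in \<open>V\<close> as soon
  as no other representative is a unit. The relative norms to the three quadratic subfields provide
  three logarithmic coordinates in which \<open>V\<close> acts by the translations in \<open>\<int>\<^sup>3\<close>; up to one translation
  all representatives lie in a common half-open unit box, so they are pairwise inequivalent.
\<close>

section \<open>Lattice points in the cone over a Cayley sum of two hexagons\<close>

text \<open>The unit group is unknown at the outset, so the minimisation runs over \<open>V\<close>
  alone, and the reduction to a cone is bought by finitely many comparisons. A difference such as L2
  (v x) - L2 x is an integer linear form in x. Twelve comparisons with \<open>L2\<close> or
  \<open>L3\<close> of unit multiples are, up to the factor 2n - 1, the inequalities of
  \<open>cone\<close>; four more do the same for the simplex. In coordinates with L2 = h + k a
  lattice problem with the single parameter m = 2n >= 12 remains: comparing with the multiples by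
  eps_q and its inverse gives h >= 0 and k >= 0, and the two hexagons are the slices (1, 0) and (0,
  1). A linear involution exchanges them, so one splitting argument serves both. At height (1, 1)
  the sums of their lattice points miss four progressions of m - 4 points each, whence the count 3 +
  4 (2n - 4) + (2n - 2) = 10n - 15. Elements are integer quadruples in an integral basis, so that
  products of units and functionals become polynomial identities in n; real numbers enter through
  the four embeddings.\<close>

text \<open>
  The two hexagons lie at \<open>(h, k) = (1, 0)\<close> and \<open>(h, k) = (0, 1)\<close>; the inequalities are the
  support functions of \<open>h \<cdot> hexagon + k \<cdot> thin_hexagon\<close>.
\<close>

definition cone :: "int \<Rightarrow> int \<Rightarrow> int \<Rightarrow> int \<Rightarrow> int \<Rightarrow> bool" where
  "cone m h k t j \<longleftrightarrow> 0 \<le> h \<and> 0 \<le> k \<and> \<bar>j\<bar> \<le> h + k \<and> \<bar>t\<bar> \<le> h + (m + 1) * k \<and>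
     \<bar>t + j\<bar> \<le> h + m * k \<and> \<bar>t + m * j\<bar> \<le> m * h + k \<and> \<bar>t + (m + 1) * j\<bar> \<le> (m + 1) * h + k"

definition hexagon :: "(int \<times> int) set" where
  "hexagon = {(0,0), (1,0), (-1,0), (0,1), (0,-1), (1,-1), (-1,1)}"

lemma cone_minus: "cone m h k (-t) (-j) \<longleftrightarrow> cone m h k t j"
proof -
  have "\<bar>-t + -j\<bar> = \<bar>t + j\<bar>" "\<bar>-t + m * -j\<bar> = \<bar>t + m * j\<bar>" "\<bar>-t + (m + 1) * -j\<bar> = \<bar>t + (m + 1) * j\<bar>"
    by (simp_all add: abs_if algebra_simps)
  then show ?thesis by (simp add: cone_def)
qed

text \<open>The involution (t, j) -> (t + (m + 1) j, -j) carries one hexagon onto the other. It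
  exchanges the bounds on t and t + (m + 1) j, and those on t + j and t + m j.\<close>

lemma cone_swap: "cone m k h (t + (m + 1) * j) (-j) \<longleftrightarrow> cone m h k t j"
  by (auto simp: cone_def algebra_simps)

text \<open>Removing (0, 1) lowers j, t + j, t + m j and t + (m + 1) j by exactly the drop of their
  upper bounds when h falls by 1, so it is the default for j >= 0. It fails only if t is at an
  extreme value or some lower bound is too close; then (1, 0), (-1, 0), (-1, 1) or (0, -1) is
  removed instead.\<close>

lemma cone_step_nonneg:
  assumes m: "m \<ge> 12" and c: "cone m h k t j" and h: "h \<ge> 2" and j: "j \<ge> 0"
  shows "\<exists>(a,b)\<in>hexagon. cone m (h - 1) k (t - a) (j - b)"
proof -
  have k: "0 \<le> k" using c by (simp add: cone_def)
  obtain h' where h': "h = h' + 2" "h' \<ge> 0" using h by (metis diff_add_cancel diff_ge_0_iff_ge)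
  \<comment> \<open>The products of m with h - 2, k and j get names, so that the remaining goals are
    linear; nonlinear facts enter only through \<open>xyz\<close> and \<open>mono\<close>.\<close>
  define x where "x = m * h'"
  define y where "y = m * k"
  define z where "z = m * j"
  have xyz: "x \<ge> 12 * h'" "y \<ge> 12 * k" "z \<ge> 12 * j"
    using m h' k j by (auto simp: x_def y_def z_def intro: mult_right_mono)
  have mono: "m * a \<le> m * b" if "a \<le> b" for a b
    using that m by (intro mult_left_mono) auto
  have C0: "cone m h k t j \<longleftrightarrow> j \<le> h' + 2 + k \<and> - (h' + 2 + k) \<le> j
     \<and> t \<le> h' + 2 + y + k \<and> - (h' + 2 + y + k) \<le> t
     \<and> t + j \<le> h' + 2 + y \<and> - (h' + 2 + y) \<le> t + j
     \<and> t + z \<le> x + 2 * m + k \<and> - (x + 2 * m + k) \<le> t + z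
     \<and> t + z + j \<le> x + 2 * m + h' + 2 + k \<and> - (x + 2 * m + h' + 2 + k) \<le> t + z + j"
    using k h' unfolding cone_def abs_le_iff x_def y_def z_def by (auto simp: algebra_simps)
  have C: "cone m (h - 1) k (t - a) (j - b)"
    if "j - b \<le> h' + 1 + k" "- (h' + 1 + k) \<le> j - b"
      "t - a \<le> h' + 1 + y + k" "- (h' + 1 + y + k) \<le> t - a"
      "t - a + j - b \<le> h' + 1 + y" "- (h' + 1 + y) \<le> t - a + j - b"
      "t - a + z - mb \<le> x + m + k" "- (x + m + k) \<le> t - a + z - mb"
      "t - a + z - mb + j - b \<le> x + m + h' + 1 + k" "- (x + m + h' + 1 + k) \<le> t - a + z - mb + j - b"
      "mb = m * b" for a b mb
    using k h' that unfolding cone_def abs_le_iff x_def y_def z_def by (auto simp: algebra_simps)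
  have c0: "j \<le> h' + 2 + k" "t \<le> h' + 2 + y + k" "- (h' + 2 + y + k) \<le> t"
    "t + j \<le> h' + 2 + y" "- (h' + 2 + y) \<le> t + j"
    "t + z \<le> x + 2 * m + k" "- (x + 2 * m + k) \<le> t + z"
    "t + z + j \<le> x + 2 * m + h' + 2 + k" "- (x + 2 * m + h' + 2 + k) \<le> t + z + j"
    using c C0 by blast+
  \<comment> \<open>\<open>bu\<close> has t at its maximum; \<open>bl\<close> and
    \<open>blcl\<close> have t at its minimum, with t + j far from or close to its own lower bound.
    In \<open>lo\<close> the choice (0, 1) would break a lower bound, in \<open>ok\<close> it breaks
    none.\<close>
  consider (bu) "t = h' + 2 + y + k"
    | (blcl) "t = - (h' + 2) - y - k" "t + j < - (h' + 2) - y + 2"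
    | (bl) "t = - (h' + 2) - y - k" "t + j \<ge> - (h' + 2) - y + 2"
    | (lo) "t + j < - (h' + 2) - y + 2 \<or> t + z < - x - k \<or> t + z + j < - x - k - h'" "t > - (h' + 2) - y - k"
    | (ok) "t \<noteq> h' + 2 + y + k" "t > - (h' + 2) - y - k" "t + j \<ge> - (h' + 2) - y + 2" "t + z \<ge> - x - k"
       "t + z + j \<ge> - x - k - h'"
    using c0 by linarith
  then have "\<exists>(a,b)\<in>hexagon. cone m (h - 1) k (t - a) (j - b)"
  proof cases
    case bu
    then have "j = 0" "k = 0" using c0 k j by linarith+
    then have "y = 0" "z = 0" by (simp_all add: y_def z_def)
    then have "cone m (h - 1) k (t - 1) (j - 0)"
      using c0 xyz bu h' m \<open>j = 0\<close> \<open>k = 0\<close> by (intro C[where mb = "0"]) (smt (verit))+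
    then show ?thesis by (auto simp: hexagon_def)
  next
    case blcl
    have "m * j \<le> m * (k + 1)" "m * k \<le> m * j"
      using blcl c0 by (intro mono; linarith)+
    then have "z \<le> y + m" "y \<le> z" by (simp_all add: y_def z_def algebra_simps)
    then have "cone m (h - 1) k (t - (-1)) (j - 0)"
      using c0 xyz blcl h' k j m by (intro C[where mb = "0"]) (smt (verit))+
    then show ?thesis by (auto simp: hexagon_def)
  next
    case bl
    have "m * (k + 2) \<le> m * j" using bl by (intro mono) linarith+
    then have "y + 2 * m \<le> z" by (simp add: y_def z_def algebra_simps)
    moreover have "m * j \<le> m * (h + k)" using c0 h' by (intro mono) linarith
    then have "z \<le> x + y + 2 * m" by (simp add: x_def y_def z_def h' algebra_simps)
    ultimately have "cone m (h - 1) k (t - (-1)) (j - 1)"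
      using c0 xyz bl h' k j m by (intro C[where mb = "m"]) (smt (verit))+
    then show ?thesis by (auto simp: hexagon_def)
  next
    case lo
    \<comment> \<open>Removing (0, -1) raises the forms, so the upper bounds need room. A larger j
      would lift all three forms above the thresholds of \<open>lo\<close>, because t is not
      minimal.\<close>
    have jl: "j \<le> h' + k"
    proof (rule ccontr)
      assume "\<not> ?thesis"
      then have g: "j \<ge> h' + k + 1" by simp
      then have "m * (h' + k + 1) \<le> m * j" by (rule mono)
      then have "x + y + m \<le> z" by (simp add: x_def y_def z_def algebra_simps)
      with g lo xyz k h' m show False by linarith
    qed
    then have "m * j \<le> m * (h' + k)" by (rule mono)
    then have zl: "z \<le> x + y" by (simp add: x_def y_def z_def algebra_simps)
    have "cone m (h - 1) k (t - 0) (j - (-1))"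
      using lo(1)
    proof (elim disjE)
      assume "t + j < - (h' + 2) - y + 2"
      then show ?thesis
        using c0 xyz lo(2) h' k j m zl jl by (intro C[where mb = "-m"]) (smt (verit))+
    next
      assume "t + z < - x - k"
      then show ?thesis
        using c0 xyz lo(2) h' k j m zl jl by (intro C[where mb = "-m"]) (smt (verit))+
    next
      assume "t + z + j < - x - k - h'"
      then show ?thesis
        using c0 xyz lo(2) h' k j m zl jl by (intro C[where mb = "-m"]) (smt (verit))+
    qed
    then show ?thesis by (auto simp: hexagon_def)
  next
    case ok
    then have "t < h' + 2 + y + k" using c0 by linarith
    then have "cone m (h - 1) k (t - 0) (j - 1)"
      using c0 xyz ok(2-) h' k j m by (intro C[where mb = "m"]) (smt (verit))+
    then show ?thesis by (auto simp: hexagon_def)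
  qed
  then show ?thesis .
qed

lemma cone_step:
  assumes "m \<ge> 12" "cone m h k t j" "h \<ge> 2"
  shows "\<exists>(a,b)\<in>hexagon. cone m (h - 1) k (t - a) (j - b)"
proof (cases "j \<ge> 0")
  case False
  then have "\<exists>(a,b)\<in>hexagon. cone m (h - 1) k (-t - a) (-j - b)"
    using cone_step_nonneg[of m h k "-t" "-j"] assms by (simp add: cone_minus)
  then obtain a b where ab: "(a,b) \<in> hexagon" "cone m (h - 1) k (-t - a) (-j - b)" by blast
  have "(-a,-b) \<in> hexagon" using ab(1) by (auto simp: hexagon_def)
  moreover have "cone m (h - 1) k (t - -a) (j - -b)"
  proof -
    have e: "-t - a = - (t + a)" "-j - b = - (j + b)" "t - -a = t + a" "j - -b = j + b" by simp_all
    show ?thesis using ab(2) unfolding e cone_minus .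
  qed
  ultimately show ?thesis by blast
qed (use assms cone_step_nonneg in blast)

definition thin_hexagon :: "int \<Rightarrow> (int \<times> int) set" where
  "thin_hexagon m = {(0,0), (1,0), (-1,0), (-(m+1),1), (-m,1), (m+1,-1), (m,-1)}"

lemma cone_step':
  assumes "m \<ge> 12" "cone m h k t j" "k \<ge> 2"
  shows "\<exists>(a,b)\<in>thin_hexagon m. cone m h (k - 1) (t - a) (j - b)"
proof -
  have "cone m k h (t + (m + 1) * j) (-j)" using assms by (simp add: cone_swap)
  from cone_step[OF assms(1) this assms(3)] obtain a b where
    ab: "(a,b) \<in> hexagon" "cone m (k - 1) h (t + (m + 1) * j - a) (-j - b)" by blast
  have "(a + (m + 1) * b, -b) \<in> thin_hexagon m"
    using ab(1) by (auto simp: hexagon_def thin_hexagon_def)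
  moreover have "cone m h (k - 1) (t - (a + (m + 1) * b)) (j - -b)"
  proof -
    have e: "t + (m + 1) * j - a = (t - (a + (m + 1) * b)) + (m + 1) * (j + b)" "-j - b = - (j + b)"
      "j - -b = j + b"
      by (simp_all add: algebra_simps)
    show ?thesis using ab(2) unfolding e cone_swap .
  qed
  ultimately show ?thesis by blast
qed

lemma cone_0_0: "cone m 0 0 t j \<Longrightarrow> t = 0 \<and> j = 0"
  by (simp add: cone_def)

lemma cone_1_0:
  assumes "cone m 1 0 t j"
  shows "(t, j) \<in> hexagon"
proof -
  have "j \<in> {-1,0,1}" "t \<in> {-1,0,1}" "\<bar>t + j\<bar> \<le> 1" using assms by (auto simp: cone_def)
  then show ?thesis by (auto simp: hexagon_def)
qed

lemma cone_0_1:
  assumes "cone m 0 1 t j"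
  shows "(t, j) \<in> thin_hexagon m"
proof -
  have "cone m 1 0 (t + (m + 1) * j) (-j)" using assms by (simp add: cone_swap)
  then have "(t + (m + 1) * j, -j) \<in> hexagon" by (rule cone_1_0)
  then show ?thesis by (auto simp: hexagon_def thin_hexagon_def)
qed

text \<open>The points at height (1, 1) that need two units of height at once: by
  \<open>cone_1_1\<close> every other lattice point there is a sum of two hexagon points, and by
  \<open>extra_not_sum\<close> none of these is.\<close>

definition extra :: "int \<Rightarrow> (int \<times> int) set" where
  "extra m = {(t, j). j = 0 \<and> 3 \<le> \<bar>t\<bar> \<and> \<bar>t\<bar> \<le> m - 2 \<or> j = -1 \<and> 3 \<le> t \<and> t \<le> m - 2
     \<or> j = 1 \<and> 3 \<le> -t \<and> -t \<le> m - 2}"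

lemma hexagon_minus: "(a, b) \<in> hexagon \<Longrightarrow> (-a, -b) \<in> hexagon"
  by (auto simp: hexagon_def)

lemma thin_hexagon_minus: "(a, b) \<in> thin_hexagon m \<Longrightarrow> (-a, -b) \<in> thin_hexagon m"
  by (auto simp: thin_hexagon_def)

lemma extra_minus: "(a, b) \<in> extra m \<Longrightarrow> (-a, -b) \<in> extra m"
  by (auto simp: extra_def)

text \<open>For fixed j the sums cover the ends of the admissible interval for t and, when j = 0,
  also the block of t from -2 to 2. What lies between is \<open>extra\<close>; for j = -2 nothing is
  left over.\<close>

lemma cone_1_1_nonpos:
  assumes m: "m \<ge> 12" and c: "cone m 1 1 t j" and j: "j \<le> 0"
  shows "(\<exists>(a,b)\<in>hexagon. (t - a, j - b) \<in> thin_hexagon m) \<or> (t, j) \<in> extra m"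
proof -
  have "j \<in> {-2,-1,0}" using c j by (auto simp: cone_def)
  then consider "j = -2" | "j = -1" | "j = 0" by blast
  then show ?thesis
  proof cases
    case 1
    then have "\<bar>t\<bar> \<le> m + 2" "\<bar>t - 2 * m - 2\<bar> \<le> m + 2" using c by (simp_all add: cone_def algebra_simps)
    then have "t = m \<or> t = m + 1 \<or> t = m + 2" by linarith
    then show ?thesis using 1 by (auto simp: hexagon_def thin_hexagon_def)
  next
    case 2
    then have "\<bar>t\<bar> \<le> m + 2" "\<bar>t - m\<bar> \<le> m + 1" using c by (simp_all add: cone_def algebra_simps)
    then have "-1 \<le> t" "t \<le> m + 2" by linarith+
    then consider "t \<le> 2" | "m - 1 \<le> t" | "3 \<le> t" "t \<le> m - 2" by linarith
    then show ?thesis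
    proof cases
      case 1
      with \<open>-1 \<le> t\<close> have "t = -1 \<or> t = 0 \<or> t = 1 \<or> t = 2" by linarith
      then show ?thesis using \<open>j = -1\<close> by (auto simp: hexagon_def thin_hexagon_def)
    next
      case 2
      with \<open>t \<le> m + 2\<close> have "t = m - 1 \<or> t = m \<or> t = m + 1 \<or> t = m + 2" by linarith
      then show ?thesis using \<open>j = -1\<close> by (auto simp: hexagon_def thin_hexagon_def)
    next
      case 3
      then show ?thesis using \<open>j = -1\<close> by (simp add: extra_def)
    qed
  next
    case 3
    then have "\<bar>t\<bar> \<le> m + 1" using c by (simp add: cone_def)
    then have "- (m + 1) \<le> t" "t \<le> m + 1" by linarith+
    then consider "t \<le> - (m - 1)" | "-2 \<le> t" "t \<le> 2" | "m - 1 \<le> t" | "3 \<le> \<bar>t\<bar>" "\<bar>t\<bar> \<le> m - 2"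
      by linarith
    then show ?thesis
    proof cases
      case 1
      with \<open>- (m + 1) \<le> t\<close> have "t = -(m+1) \<or> t = -m \<or> t = -(m-1)" by linarith
      then show ?thesis using 3 by (auto simp: hexagon_def thin_hexagon_def)
    next
      case 2
      then have "t = -2 \<or> t = -1 \<or> t = 0 \<or> t = 1 \<or> t = 2" by linarith
      then show ?thesis using 3 by (auto simp: hexagon_def thin_hexagon_def)
    next
      case 3
      with \<open>t \<le> m + 1\<close> have "t = m-1 \<or> t = m \<or> t = m+1" by linarith
      then show ?thesis using \<open>j = 0\<close> by (auto simp: hexagon_def thin_hexagon_def)
    next
      case 4
      then show ?thesis using 3 by (simp add: extra_def)
    qed
  qed
qed

lemma cone_1_1:
  assumes m: "m \<ge> 12" and c: "cone m 1 1 t j"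
  shows "(\<exists>(a,b)\<in>hexagon. (t - a, j - b) \<in> thin_hexagon m) \<or> (t, j) \<in> extra m"
proof (cases "j \<le> 0")
  case False
  then have "(\<exists>(a,b)\<in>hexagon. (-t - a, -j - b) \<in> thin_hexagon m) \<or> (-t, -j) \<in> extra m"
    using c m by (intro cone_1_1_nonpos) (simp_all add: cone_minus)
  then show ?thesis
  proof
    assume "\<exists>(a,b)\<in>hexagon. (-t - a, -j - b) \<in> thin_hexagon m"
    then obtain a b where ab: "(a,b) \<in> hexagon" "(-t - a, -j - b) \<in> thin_hexagon m" by blast
    have "(-a, -b) \<in> hexagon" using ab(1) by (rule hexagon_minus)
    moreover have "(t - -a, j - -b) \<in> thin_hexagon m" using thin_hexagon_minus[OF ab(2)] by (simp add: add.commute)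
    ultimately show ?thesis by blast
  next
    assume "(-t, -j) \<in> extra m"
    from extra_minus[OF this] show ?thesis by simp
  qed
qed (use m c cone_1_1_nonpos in blast)

text \<open>The first coordinate of a thin point is at most 1 or at least m in absolute value, and a
  hexagon point changes it by at most 1. The range from 3 to m - 2 is never reached.\<close>

lemma extra_not_sum:
  assumes "(a, b) \<in> hexagon" "(a', b') \<in> thin_hexagon m" "m \<ge> 12"
  shows "(a + a', b + b') \<notin> extra m"
proof
  assume *: "(a + a', b + b') \<in> extra m"
  have 1: "b \<in> {-1, 0, 1}" "-1 \<le> a" "a \<le> 1" "\<bar>a + b\<bar> \<le> 1" using assms(1) by (auto simp: hexagon_def)
  have 2: "b' = 0 \<and> \<bar>a'\<bar> \<le> 1 \<or> b' = 1 \<and> a' \<le> -m \<or> b' = -1 \<and> m \<le> a'"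
    using assms(2) by (auto simp: thin_hexagon_def)
  from * consider "b + b' = 0" "3 \<le> \<bar>a + a'\<bar>" "\<bar>a + a'\<bar> \<le> m - 2"
    | "b + b' = -1" "3 \<le> a + a'" "a + a' \<le> m - 2" | "b + b' = 1" "3 \<le> -(a + a')" "-(a + a') \<le> m - 2"
    by (auto simp: extra_def)
  then show False using 1 2 by cases (smt (verit) insertE empty_iff assms(3))+
qed

section \<open>The integral lattice and its conjugates\<close>

lemma sqrt_irrational_between_squares:
  fixes x k :: int
  assumes "0 \<le> k" "k ^ 2 < x" "x < (k + 1) ^ 2"
  shows "sqrt x \<notin> \<rat>"
proof
  assume "sqrt x \<in> \<rat>"
  moreover have "algebraic_int (sqrt x)" by (intro algebraic_int_sqrt int_imp_algebraic_int) auto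
  ultimately have "sqrt x \<in> \<int>" using rational_algebraic_int_is_int by blast
  then obtain y :: int where y: "sqrt x = y" by (auto elim: Ints_cases)
  have "0 \<le> x" using assms(2) by (smt (verit) zero_le_power2)
  then have "real_of_int x = real_of_int (y ^ 2)" using y by (metis of_int_0_le_iff of_int_power real_sqrt_pow2)
  then have xy: "x = y ^ 2" by linarith
  have "0 \<le> y" using y \<open>0 \<le> x\<close> by (metis of_int_0_le_iff real_sqrt_ge_zero)
  then have "k < y" "y < k + 1" using assms xy by (auto dest: power_less_imp_less_base)
  then show False by simp
qed

type_synonym quad = "int \<times> int \<times> int \<times> int"

locale biquadratic =
  fixes n :: int
  assumes n_ge: "6 \<le> n"
begin

definition \<alpha> :: real where "\<alpha> = sqrt (2 * n - 1)"
definition \<beta> :: real where "\<beta> = sqrt (2 * n + 1)"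
definition \<gamma> :: real where "\<gamma> = sqrt (2 * n + 3)"

lemma \<alpha>_pos: "0 < \<alpha>" and \<beta>_pos: "0 < \<beta>" and \<gamma>_pos: "0 < \<gamma>"
  and \<alpha>_less_\<beta>: "\<alpha> < \<beta>" and \<beta>_less_\<gamma>: "\<beta> < \<gamma>"
  using n_ge by (auto simp: \<alpha>_def \<beta>_def \<gamma>_def)

lemma \<alpha>_sq: "\<alpha> * \<alpha> = 2 * n - 1" and \<beta>_sq: "\<beta> * \<beta> = 2 * n + 1" and \<gamma>_sq: "\<gamma> * \<gamma> = 2 * n + 3"
  using n_ge by (auto simp: \<alpha>_def \<beta>_def \<gamma>_def)

definition p :: int where "p = (2 * n - 1) * (2 * n + 1)"
definition q :: int where "q = (2 * n - 1) * (2 * n + 3)"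
definition r :: int where "r = (2 * n + 1) * (2 * n + 3)"

lemma sqrt_p: "sqrt p = \<alpha> * \<beta>" and sqrt_q: "sqrt q = \<alpha> * \<gamma>" and sqrt_r: "sqrt r = \<beta> * \<gamma>"
  by (simp_all add: \<alpha>_def \<beta>_def \<gamma>_def p_def q_def r_def flip: real_sqrt_mult)

lemma sqrt_p_irrational: "sqrt p \<notin> \<rat>"
  by (rule sqrt_irrational_between_squares[of "2 * n - 1"])
     (use n_ge in \<open>auto simp: p_def power2_eq_square algebra_simps\<close>)

lemma sqrt_q_irrational: "sqrt q \<notin> \<rat>"
  by (rule sqrt_irrational_between_squares[of "2 * n"])
     (use n_ge in \<open>auto simp: q_def power2_eq_square algebra_simps\<close>)

lemma sqrt_r_irrational: "sqrt r \<notin> \<rat>"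
  by (rule sqrt_irrational_between_squares[of "2 * n + 1"])
     (use n_ge in \<open>auto simp: r_def power2_eq_square algebra_simps\<close>)

lemma \<beta>_\<gamma>_eq: "\<beta> * \<gamma> = sqrt p * sqrt q / (2 * n - 1)"
proof -
  have "sqrt p * sqrt q = (\<alpha> * \<alpha>) * (\<beta> * \<gamma>)" by (simp add: sqrt_p sqrt_q)
  then show ?thesis using n_ge by (simp add: \<alpha>_sq field_simps)
qed

lemma irrational_lin:
  assumes "x \<notin> \<rat>" "a \<in> \<rat>" "b \<in> \<rat>" "a + b * x = 0"
  shows "a = 0" "b = (0::real)"
proof -
  show "b = 0"
  proof (rule ccontr)
    assume b: "b \<noteq> 0"
    then have "x = - a / b" using assms by (simp add: field_simps eq_neg_iff_add_eq_0)
    then show False using assms(1-3) by simp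
  qed
  then show "a = 0" using assms by simp
qed

lemma irrational_sq:
  assumes "sqrt x \<notin> \<rat>" "a \<in> \<rat>" "b \<in> \<rat>" "a * a = x * (b * b)" "0 \<le> x"
  shows "a = 0"
proof (rule ccontr)
  assume a: "a \<noteq> 0"
  then have b: "b \<noteq> 0" using assms by auto
  then have "sqrt x = \<bar>a / b\<bar>" using assms(4) b by (intro real_sqrt_unique) (auto simp: power2_eq_square field_simps assms(5))
  then show False using assms(1-3) by simp
qed

text \<open>The signs are parameters, so that the single law \<open>lin_mult\<close> serves all four
  conjugates; the coefficients are real, to accommodate the halves of the integral basis.\<close>

definition lin :: "real \<Rightarrow> real \<Rightarrow> real \<Rightarrow> real \<Rightarrow> real \<Rightarrow> real \<Rightarrow> real" where
  "lin e f a b c d = a + b * (e * (\<alpha> * \<beta>)) + c * (f * (\<alpha> * \<gamma>)) + d * (e * f * (\<beta> * \<gamma>))"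

lemma lin_mult:
  fixes a b c d a' b' c' d' :: real
  assumes "e * e = 1" "f * f = 1"
  shows "lin e f a b c d * lin e f a' b' c' d' =
    lin e f (a * a' + p * (b * b') + q * (c * c') + r * (d * d'))
            (a * b' + b * a' + (2 * n + 3) * (c * d' + d * c'))
            (a * c' + c * a' + (2 * n + 1) * (b * d' + d * b'))
            (a * d' + d * a' + (2 * n - 1) * (b * c' + c * b'))"
proof -
  define P where "P = e * (\<alpha> * \<beta>)"
  define Q where "Q = f * (\<alpha> * \<gamma>)"
  define R where "R = e * f * (\<beta> * \<gamma>)"
  have PP: "P * P = p"
  proof -
    have "P * P = (e * e) * (\<alpha> * \<alpha>) * (\<beta> * \<beta>)" by (simp add: P_def)
    then show ?thesis by (simp add: assms \<alpha>_sq \<beta>_sq p_def)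
  qed
  have QQ: "Q * Q = q"
  proof -
    have "Q * Q = (f * f) * (\<alpha> * \<alpha>) * (\<gamma> * \<gamma>)" by (simp add: Q_def)
    then show ?thesis by (simp add: assms \<alpha>_sq \<gamma>_sq q_def)
  qed
  have RR: "R * R = r"
  proof -
    have "R * R = (e * e) * (f * f) * (\<beta> * \<beta>) * (\<gamma> * \<gamma>)" by (simp add: R_def)
    then show ?thesis by (simp add: assms \<beta>_sq \<gamma>_sq r_def)
  qed
  have PQ: "P * Q = (2 * n - 1) * R"
  proof -
    have "P * Q = (\<alpha> * \<alpha>) * (e * f * (\<beta> * \<gamma>))" by (simp add: P_def Q_def)
    then show ?thesis by (simp add: \<alpha>_sq R_def)
  qed
  have PR: "P * R = (2 * n + 1) * Q"
  proof -
    have "P * R = (e * e) * (\<beta> * \<beta>) * (f * (\<alpha> * \<gamma>))" by (simp add: P_def R_def)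
    then show ?thesis by (simp add: assms \<beta>_sq Q_def)
  qed
  have QR: "Q * R = (2 * n + 3) * P"
  proof -
    have "Q * R = (f * f) * (\<gamma> * \<gamma>) * (e * (\<alpha> * \<beta>))" by (simp add: Q_def R_def)
    then show ?thesis by (simp add: assms \<gamma>_sq P_def)
  qed
  have "(a + b * P + c * Q + d * R) * (a' + b' * P + c' * Q + d' * R) =
     a * a' + b * b' * (P * P) + c * c' * (Q * Q) + d * d' * (R * R) + (a * b' + b * a') * P
     + (a * c' + c * a') * Q + (a * d' + d * a') * R + (b * c' + c * b') * (P * Q)
     + (b * d' + d * b') * (P * R) + (c * d' + d * c') * (Q * R)"
    by (simp add: algebra_simps)
  also have "\<dots> = a * a' + b * b' * p + c * c' * q + d * d' * r + (a * b' + b * a') * P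
     + (a * c' + c * a') * Q + (a * d' + d * a') * R + (b * c' + c * b') * ((2 * n - 1) * R)
     + (b * d' + d * b') * ((2 * n + 1) * Q) + (c * d' + d * c') * ((2 * n + 3) * P)"
    by (simp only: PP QQ RR PQ PR QR)
  finally show ?thesis unfolding lin_def P_def[symmetric] Q_def[symmetric] R_def[symmetric]
    by (simp add: algebra_simps)
qed

text \<open>Multiplication by the conjugate over Q(sqrt p) gives an element of that field, whose
  sqrt p coefficient must vanish. The three subfields yield \<open>A\<close>, \<open>B\<close> and
  \<open>C\<close>; multiplying \<open>A\<close> by \<open>B\<close> gives b c (a^2 - r d^2) = 0,
  and the irrationality of sqrt r then rules out a different from 0.\<close>

lemma lin_eq_0:
  assumes rat: "a \<in> \<rat>" "b \<in> \<rat>" "c \<in> \<rat>" "d \<in> \<rat>" and z: "lin 1 1 a b c d = 0"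
  shows "a = 0 \<and> b = 0 \<and> c = 0 \<and> d = 0"
proof -
  have A: "a * b = (2 * n + 3) * (c * d)"
  proof -
    have "lin 1 1 a b c d * lin 1 1 a b (-c) (-d) = 0" using z by simp
    then have "(a * a + p * (b * b) - q * (c * c) - r * (d * d)) + (2 * (a * b) - 2 * ((2 * n + 3) * (c * d))) * sqrt p = 0"
      by (simp only: lin_mult[of 1 1, OF mult_1 mult_1]) (simp add: lin_def sqrt_p algebra_simps)
    then have "2 * (a * b) - 2 * ((2 * n + 3) * (c * d)) = 0"
      using irrational_lin(2)[OF sqrt_p_irrational] rat by (metis Rats_add Rats_diff Rats_mult Rats_of_int Rats_number_of)
    then show ?thesis by simp
  qed
  have B: "a * c = (2 * n + 1) * (b * d)"
  proof -
    have "lin 1 1 a b c d * lin 1 1 a (-b) c (-d) = 0" using z by simp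
    then have "(a * a - p * (b * b) + q * (c * c) - r * (d * d)) + (2 * (a * c) - 2 * ((2 * n + 1) * (b * d))) * sqrt q = 0"
      by (simp only: lin_mult[of 1 1, OF mult_1 mult_1]) (simp add: lin_def sqrt_q algebra_simps)
    then have "2 * (a * c) - 2 * ((2 * n + 1) * (b * d)) = 0"
      using irrational_lin(2)[OF sqrt_q_irrational] rat by (metis Rats_add Rats_diff Rats_mult Rats_of_int Rats_number_of)
    then show ?thesis by simp
  qed
  have C: "a * d = (2 * n - 1) * (b * c)"
  proof -
    have "lin 1 1 a b c d * lin 1 1 a (-b) (-c) d = 0" using z by simp
    then have "(a * a - p * (b * b) - q * (c * c) + r * (d * d)) + (2 * (a * d) - 2 * ((2 * n - 1) * (b * c))) * sqrt r = 0"
      by (simp only: lin_mult[of 1 1, OF mult_1 mult_1]) (simp add: lin_def sqrt_r algebra_simps)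
    then have "2 * (a * d) - 2 * ((2 * n - 1) * (b * c)) = 0"
      using irrational_lin(2)[OF sqrt_r_irrational] rat by (metis Rats_add Rats_diff Rats_mult Rats_of_int Rats_number_of)
    then show ?thesis by simp
  qed
  have n0: "real_of_int (2 * n - 1) \<noteq> 0" "real_of_int (2 * n + 1) \<noteq> 0" "real_of_int (2 * n + 3) \<noteq> 0"
    "p \<ge> 0" "r \<ge> 0" "q \<ge> 0"
    using n_ge by (auto simp: p_def q_def r_def)
  have a0: "a = 0"
  proof (rule ccontr)
    assume a: "a \<noteq> 0"
    have "(a * b) * (a * c) = ((2 * n + 3) * (c * d)) * ((2 * n + 1) * (b * d))" by (simp only: A B)
    then have "(b * c) * (a * a - r * (d * d)) = 0" by (simp add: r_def algebra_simps)
    moreover have "a * a - r * (d * d) \<noteq> 0"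
      using irrational_sq[OF sqrt_r_irrational, of a d] rat a n0 by auto
    ultimately have "b * c = 0" by simp
    then have "d = 0" using C a by (metis mult_eq_0_iff)
    then have "b = 0" "c = 0" using A B a by auto
    then show False using z \<open>d = 0\<close> a by (simp add: lin_def)
  qed
  then have "c * d = 0" "b * d = 0" "b * c = 0" using A B C n0 by auto
  then have "b = 0 \<and> c = 0 \<or> b = 0 \<and> d = 0 \<or> c = 0 \<and> d = 0" by auto
  then show ?thesis using a0 z \<alpha>_pos \<beta>_pos \<gamma>_pos by (auto simp: lin_def)
qed

text \<open>
  A quadruple \<open>(a, b, c, d)\<close> stands for the element with these coordinates in the integral basis
  \<open>1, \<surd>p, (1 + \<surd>q) / 2, (\<surd>p + \<surd>r) / 2\<close>, and \<open>emb e f\<close> with \<open>e, f = \<plusminus>1\<close> is the embedding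
  \<open>\<surd>p \<mapsto> e\<surd>p\<close>, \<open>\<surd>q \<mapsto> f\<surd>q\<close>, \<open>\<surd>r \<mapsto> ef\<surd>r\<close>.
\<close>

fun emb :: "real \<Rightarrow> real \<Rightarrow> quad \<Rightarrow> real" where
  "emb e f (a, b, c, d) = lin e f (a + c / 2) (b + d / 2) (c / 2) (d / 2)"

text \<open>Structure constants of the integral basis: n^2 + n - 1 = (q - 1) / 4 comes from the
  square of (1 + sqrt q) / 2, and n (2n + 1) from the square of (sqrt p + sqrt r) / 2.\<close>

fun qmult :: "quad \<Rightarrow> quad \<Rightarrow> quad" (infixl "\<bullet>" 70) where
  "(a, b, c, d) \<bullet> (a', b', c', d') =
    (a * a' + (2 * n - 1) * (2 * n + 1) * (b * b') + (2 * n + 1) * (n - 1) * (b * d' + d * b')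
       + (n * n + n - 1) * (c * c') + n * (2 * n + 1) * (d * d'),
     a * b' + b * a' - (n - 1) * (b * c' + c * b') + (c * d' + d * c'),
     a * c' + c * a' + (2 * n + 1) * (b * d' + d * b') + c * c' + (2 * n + 1) * (d * d'),
     a * d' + d * a' + (2 * n - 1) * (b * c' + c * b') + n * (c * d' + d * c'))"

lemma emb_mult:
  assumes "e * e = 1" "f * f = 1"
  shows "emb e f (x \<bullet> y) = emb e f x * emb e f y"
proof -
  obtain a b c d a' b' c' d' where xy: "x = (a, b, c, d)" "y = (a', b', c', d')"
    by (metis prod_cases4)
  define C D C' D' where half: "C = real_of_int c / 2" "D = real_of_int d / 2"
    "C' = real_of_int c' / 2" "D' = real_of_int d' / 2"
  have double: "real_of_int c = 2 * C" "real_of_int d = 2 * D" "real_of_int c' = 2 * C'" "real_of_int d' = 2 * D'"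
    by (simp_all add: half)
  have lin_cong: "lin e f w x y z = lin e f w' x' y' z'" if "w = w'" "x = x'" "y = y'" "z = z'"
    for w x y z w' x' y' z' using that by simp
  show ?thesis unfolding xy emb.simps qmult.simps lin_mult[OF assms]
    by (rule lin_cong; simp add: p_def q_def r_def double; simp add: field_simps)
qed

lemma emb_add: "emb e f (x + y) = emb e f x + emb e f y"
  by (cases x; cases y) (simp add: lin_def add_divide_distrib diff_divide_distrib algebra_simps)

lemma emb_diff: "emb e f (x - y) = emb e f x - emb e f y"
  by (cases x; cases y) (simp add: lin_def add_divide_distrib diff_divide_distrib algebra_simps)

lemma emb_int: "emb e f (k, 0, 0, 0) = k"
  by (simp add: lin_def)

lemma emb_0 [simp]: "emb e f 0 = 0"
  by (simp add: zero_prod_def lin_def)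

text \<open>This is linear independence of the basis. Through it the ring laws pass from the reals
  to quadruples without expanding the structure constants.\<close>

lemma emb_inj: "emb 1 1 x = emb 1 1 y \<longleftrightarrow> x = y"
proof
  assume "emb 1 1 x = emb 1 1 y"
  then have z: "emb 1 1 (x - y) = 0" by (simp add: emb_diff)
  obtain a b c d where d: "x - y = (a, b, c, d)" by (metis prod_cases4)
  have "real_of_int a + c / 2 = 0 \<and> real_of_int b + d / 2 = 0 \<and> real_of_int c / 2 = 0 \<and> real_of_int d / 2 = 0"
    using z unfolding d emb.simps by (intro lin_eq_0) auto
  then have "x - y = 0" by (simp add: d zero_prod_def)
  then show "x = y" by simp
qed simp

definition one :: quad where "one = (1, 0, 0, 0)"

lemma emb_one [simp]: "emb e f one = 1"
  by (simp add: one_def lin_def)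

lemma qmult_comm: "x \<bullet> y = y \<bullet> x"
  by (simp add: emb_mult flip: emb_inj)

lemma qmult_assoc: "x \<bullet> y \<bullet> z = x \<bullet> (y \<bullet> z)"
  by (simp add: emb_mult flip: emb_inj)

lemma qmult_one [simp]: "one \<bullet> x = x" "x \<bullet> one = x"
  by (simp_all add: emb_mult flip: emb_inj)

lemma qmult_distrib: "x \<bullet> (y + z) = x \<bullet> y + x \<bullet> z"
  by (simp add: emb_mult emb_add distrib_left flip: emb_inj)

section \<open>Total positivity and the group of known totally positive units\<close>

definition tp :: "quad \<Rightarrow> bool" where
  "tp x \<longleftrightarrow> (\<forall>e\<in>{1,-1}. \<forall>f\<in>{1,-1}. 0 < emb e f x)"

lemma tp_mult: "tp x \<Longrightarrow> tp y \<Longrightarrow> tp (x \<bullet> y)"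
  by (auto simp: tp_def emb_mult)

lemma tp_add: "tp x \<Longrightarrow> tp y \<Longrightarrow> tp (x + y)"
  by (auto simp: tp_def emb_add add_pos_pos)

lemma tp_one: "tp one"
  by (simp add: tp_def)

lemma tp_nonzero: "\<not> tp 0"
  unfolding tp_def by (metis emb_0 insertI1 less_irrefl)

text \<open>\<open>EP\<close>, \<open>EQ\<close>, \<open>ER\<close> are (\<alpha> + \<beta>)^2 / 2,
  (\<alpha> + \<gamma>)^2 / 4 and (\<beta> + \<gamma>)^2 / 2; a prime marks the inverse, which is
  also the conjugate. That they are the fundamental units is proved later, from the rings of
  integers of the quadratic fields.\<close>

definition EP :: quad where "EP = (2 * n, 1, 0, 0)"
definition EP' :: quad where "EP' = (2 * n, -1, 0, 0)"
definition EQ :: quad where "EQ = (n, 0, 1, 0)"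
definition EQ' :: quad where "EQ' = (n + 1, 0, -1, 0)"
definition ER :: quad where "ER = (2 * n + 2, -1, 0, 2)"
definition ER' :: quad where "ER' = (2 * n + 2, 1, 0, -2)"
lemmas E_defs = EP_def EP'_def EQ_def EQ'_def ER_def ER'_def one_def

lemma EP_inverse: "EP \<bullet> EP' = one" and EQ_inverse: "EQ \<bullet> EQ' = one" and ER_inverse: "ER \<bullet> ER' = one"
  by (simp_all add: E_defs algebra_simps)

text \<open>The expression is (x + u y)^2. With two of \<alpha>, \<beta>, \<gamma> for x and y it
  gives a positive multiple of each conjugate of the units.\<close>

lemma sum_sq_pos: "x * x + y * y + 2 * (u * (x * y)) > 0" if "x > 0" "y > 0" "x \<noteq> y" "u \<in> {1, -1}" for x y u :: real
proof -
  have "x + u * y \<noteq> 0" using that by auto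
  then have "0 < (x + u * y) * (x + u * y)" by (metis not_real_square_gt_zero)
  also have "\<dots> = x * x + (u * u) * (y * y) + 2 * (u * (x * y))" by (simp add: algebra_simps)
  also have "u * u = 1" using that by auto
  finally show ?thesis by simp
qed

lemma tp_E: "tp EP" "tp EP'" "tp EQ" "tp EQ'" "tp ER" "tp ER'"
proof -
  have 1: "0 < 4 * n + 2 * (u * (\<alpha> * \<beta>))" "0 < 4 * n + 2 + 2 * (u * (\<alpha> * \<gamma>))"
    "0 < 4 * n + 4 + 2 * (u * (\<beta> * \<gamma>))" if "u \<in> {1, -1}" for u
    using that \<alpha>_less_\<beta> \<beta>_less_\<gamma> sum_sq_pos[OF \<alpha>_pos \<beta>_pos _ that] sum_sq_pos[OF \<alpha>_pos \<gamma>_pos _ that]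
      sum_sq_pos[OF \<beta>_pos \<gamma>_pos _ that] unfolding \<alpha>_sq \<beta>_sq \<gamma>_sq by simp_all
  show "tp EP" "tp EP'" "tp EQ" "tp EQ'" "tp ER" "tp ER'"
    using 1[of 1] 1[of "-1"] by (simp_all add: tp_def E_defs lin_def)
qed

text \<open>Words in the generators and their inverses, without exponents, which makes closure an
  easy induction. Exponents are recovered in \<open>V_unit_form\<close>.\<close>

inductive_set V :: "quad set" where
  V_one: "one \<in> V"
| V_mult: "u \<in> {EP, EP', EQ, EQ', ER, ER'} \<Longrightarrow> v \<in> V \<Longrightarrow> u \<bullet> v \<in> V"

lemma V_gen: "EP \<in> V" "EP' \<in> V" "EQ \<in> V" "EQ' \<in> V" "ER \<in> V" "ER' \<in> V"
  using V_mult[OF _ V_one] by auto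

lemma V_qmult: "u \<in> V \<Longrightarrow> v \<in> V \<Longrightarrow> u \<bullet> v \<in> V"
  by (induction rule: V.induct) (auto simp: qmult_assoc intro: V_mult)

lemma V_tp: "v \<in> V \<Longrightarrow> tp v"
proof (induction rule: V.induct)
  case (V_mult u v)
  then have "tp u" using tp_E by blast
  then show ?case using V_mult by (intro tp_mult)
qed (rule tp_one)

lemma V_inverse:
  assumes "v \<in> V"
  obtains w where "w \<in> V" "w \<bullet> v = one"
proof -
  have "\<exists>w\<in>V. w \<bullet> v = one" using assms
  proof induction
    case V_one
    then show ?case by (auto intro: V.V_one)
  next
    case (V_mult u v)
    then obtain w where w: "w \<in> V" "w \<bullet> v = one" by blast
    have "\<exists>u'\<in>V. u' \<bullet> u = one"
      using V_mult(1) V_gen EP_inverse EQ_inverse ER_inverse qmult_comm[of EP] qmult_comm[of EQ] qmult_comm[of ER]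
      unfolding insert_iff empty_iff by (elim disjE FalseE) metis+
    then obtain u' where u': "u' \<in> V" "u' \<bullet> u = one" by blast
    have "(u' \<bullet> w) \<bullet> (u \<bullet> v) = (u' \<bullet> u) \<bullet> (w \<bullet> v)" by (metis qmult_assoc qmult_comm)
    then have "(u' \<bullet> w) \<bullet> (u \<bullet> v) = one" using u' w by simp
    then show ?case using V_qmult[OF u'(1) w(1)] by blast
  qed
  then show ?thesis using that by blast
qed

section \<open>The two facets\<close>

text \<open>The functionals are \<open>Tr (\<delta> x)\<close> with \<open>4\<delta> = (1 - \<alpha>/\<beta>)(1 - \<beta>/\<gamma>)\<close> and \<open>4\<delta> = (1 - \<alpha>/\<beta>)(1 - \<alpha>/\<gamma>)\<close>.\<close>

fun L2 :: "quad \<Rightarrow> int" where "L2 (a, b, c, d) = a - (2 * n - 1) * b + n * c - 2 * n * d"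
fun L3 :: "quad \<Rightarrow> int" where "L3 (a, b, c, d) = a - (2 * n - 1) * b - (n - 1) * c"

lemma L2_add: "L2 (x + y) = L2 x + L2 y" and L3_add: "L3 (x + y) = L3 x + L3 y"
  by (cases x; cases y; simp add: algebra_simps)+

text \<open>Conjugation multiplies \<alpha>/\<beta> by e and \<beta>/\<gamma> by e f, so the four
  coefficients are the conjugates of 4\<delta>. They are all positive because \<alpha> < \<beta> <
  \<gamma>, which is what makes \<open>L2_pos\<close> work.\<close>

lemma L2_eq: "4 * real_of_int (L2 x) = (1 - \<alpha> / \<beta>) * (1 - \<beta> / \<gamma>) * emb 1 1 x + (1 - \<alpha> / \<beta>) * (1 + \<beta> / \<gamma>) * emb 1 (-1) x
  + (1 + \<alpha> / \<beta>) * (1 + \<beta> / \<gamma>) * emb (-1) 1 x + (1 + \<alpha> / \<beta>) * (1 - \<beta> / \<gamma>) * emb (-1) (-1) x"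
proof -
  obtain a b c d where x: "x = (a, b, c, d)" by (metis prod_cases4)
  have e: "\<alpha> / \<beta> * (\<alpha> * \<beta>) = 2 * n - 1" "\<beta> / \<gamma> * (\<beta> * \<gamma>) = 2 * n + 1" "\<alpha> / \<gamma> * (\<alpha> * \<gamma>) = 2 * n - 1"
    "\<alpha> / \<beta> * (\<beta> / \<gamma>) = \<alpha> / \<gamma>"
    using \<alpha>_pos \<beta>_pos \<gamma>_pos \<alpha>_sq \<beta>_sq by (simp_all add: field_simps)
  define A where "A = \<alpha> / \<beta>"
  define B where "B = \<beta> / \<gamma>"
  have key: "(1 - A) * (1 - B) * lin 1 1 a' b' c' d' + (1 - A) * (1 + B) * lin 1 (-1) a' b' c' d' + (1 + A) * (1 + B) * lin (-1) 1 a' b' c' d' + (1 + A) * (1 - B) * lin (-1) (-1) a' b' c' d' =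
    4 * a' - 4 * b' * (A * (\<alpha> * \<beta>)) + 4 * c' * ((A * B) * (\<alpha> * \<gamma>)) - 4 * d' * (B * (\<beta> * \<gamma>))" for a' b' c' d'
    by (simp add: lin_def algebra_simps)
  have "(1 - A) * (1 - B) * emb 1 1 x + (1 - A) * (1 + B) * emb 1 (-1) x + (1 + A) * (1 + B) * emb (-1) 1 x + (1 + A) * (1 - B) * emb (-1) (-1) x = 4 * real_of_int (L2 x)"
    unfolding x emb.simps key unfolding A_def B_def e by (simp add: algebra_simps)
  then show ?thesis by (simp add: A_def B_def)
qed

lemma L3_eq: "4 * real_of_int (L3 x) = (1 - \<alpha> / \<beta>) * (1 - \<alpha> / \<gamma>) * emb 1 1 x + (1 - \<alpha> / \<beta>) * (1 + \<alpha> / \<gamma>) * emb 1 (-1) x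
  + (1 + \<alpha> / \<beta>) * (1 - \<alpha> / \<gamma>) * emb (-1) 1 x + (1 + \<alpha> / \<beta>) * (1 + \<alpha> / \<gamma>) * emb (-1) (-1) x"
proof -
  obtain a b c d where x: "x = (a, b, c, d)" by (metis prod_cases4)
  have e: "\<alpha> / \<beta> * (\<alpha> * \<beta>) = 2 * n - 1" "\<alpha> / \<gamma> * (\<alpha> * \<gamma>) = 2 * n - 1" "\<alpha> / \<beta> * (\<alpha> / \<gamma>) * (\<beta> * \<gamma>) = 2 * n - 1"
    using \<alpha>_pos \<beta>_pos \<gamma>_pos \<alpha>_sq \<beta>_sq by (simp_all add: field_simps)
  define A where "A = \<alpha> / \<beta>"
  define B where "B = \<alpha> / \<gamma>"
  have key: "(1 - A) * (1 - B) * lin 1 1 a' b' c' d' + (1 - A) * (1 + B) * lin 1 (-1) a' b' c' d' + (1 + A) * (1 - B) * lin (-1) 1 a' b' c' d' + (1 + A) * (1 + B) * lin (-1) (-1) a' b' c' d' =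
    4 * a' - 4 * b' * (A * (\<alpha> * \<beta>)) - 4 * c' * (B * (\<alpha> * \<gamma>)) + 4 * d' * (A * B * (\<beta> * \<gamma>))" for a' b' c' d'
    by (simp add: lin_def algebra_simps)
  have "(1 - A) * (1 - B) * emb 1 1 x + (1 - A) * (1 + B) * emb 1 (-1) x + (1 + A) * (1 - B) * emb (-1) 1 x + (1 + A) * (1 + B) * emb (-1) (-1) x = 4 * real_of_int (L3 x)"
    unfolding x emb.simps key unfolding A_def B_def e by (simp add: algebra_simps)
  then show ?thesis by (simp add: A_def B_def)
qed

lemma L2_pos: assumes "tp x" shows "0 < L2 x"
proof -
  have "\<alpha> / \<beta> < 1" "\<beta> / \<gamma> < 1" "\<alpha> / \<beta> > 0" "\<beta> / \<gamma> > 0" using \<alpha>_pos \<beta>_pos \<gamma>_pos \<alpha>_less_\<beta> \<beta>_less_\<gamma> by simp_all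
  then have "0 < 4 * real_of_int (L2 x)"
    unfolding L2_eq using assms by (intro add_pos_pos mult_pos_pos) (auto simp: tp_def)
  then show ?thesis by simp
qed

lemma L3_pos: assumes "tp x" shows "0 < L3 x"
proof -
  have "\<alpha> / \<beta> < 1" "\<alpha> / \<gamma> < 1" "\<alpha> / \<beta> > 0" "\<alpha> / \<gamma> > 0" using \<alpha>_pos \<beta>_pos \<gamma>_pos \<alpha>_less_\<beta> \<beta>_less_\<gamma> by simp_all
  then have "0 < 4 * real_of_int (L3 x)"
    unfolding L3_eq using assms by (intro add_pos_pos mult_pos_pos) (auto simp: tp_def)
  then show ?thesis by simp
qed

text \<open>
  Coordinates adapted to the cone of \<open>L2 = hc + kc\<close>. The conditions of \<open>cone3\<close> are the barycentric
  coordinates, multiplied by \<open>2n - 1\<close>, with respect to \<open>1, \<epsilon>\<^sub>p, \<epsilon>\<^sub>q, \<epsilon>\<^sub>p\<epsilon>\<^sub>q\<close>.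
\<close>

fun hc :: "quad \<Rightarrow> int" where "hc (a, b, c, d) = a - 2 * n * b + (n + 1) * c - (2 * n + 1) * d"
fun kc :: "quad \<Rightarrow> int" where "kc (a, b, c, d) = b - c + d"
fun tc :: "quad \<Rightarrow> int" where "tc (a, b, c, d) = - (2 * n + 1) * b + c"
fun jc :: "quad \<Rightarrow> int" where "jc (a, b, c, d) = - a + (2 * n + 1) * b - (n + 1) * c + (2 * n + 1) * d"

definition cone2 :: "quad \<Rightarrow> bool" where
  "cone2 x \<longleftrightarrow> cone (2 * n) (hc x) (kc x) (tc x) (jc x)"

fun cone3 :: "quad \<Rightarrow> bool" where
  "cone3 (a, b, c, d) \<longleftrightarrow> 0 \<le> (2 * n - 1) * (a - 2 * n * b - n * c) + 2 * n * d \<and> 0 \<le> (2 * n - 1) * b - d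
     \<and> 0 \<le> (2 * n - 1) * c - 2 * n * d \<and> 0 \<le> d"

lemma zero_le_index_mult_iff: "0 \<le> (2 * n - 1) * k \<longleftrightarrow> 0 \<le> k"
  using n_ge by (simp add: zero_le_mult_iff)

text \<open>The unit multiples are chosen so that the right-hand sides are the twelve inequalities
  of \<open>cone\<close>: five two-sided ones, \<open>hc x\<close> >= 0 and \<open>kc x\<close> >=
  0. The factor 2n - 1 occurs for the comparisons with \<open>L2\<close> only.\<close>

lemma neighbours_2:
  "L2 (EP' \<bullet> (EQ' \<bullet> x)) - L2 x = (2 * n - 1) * (hc x + (2 * n + 1) * kc x + tc x)"
  "L2 (EP \<bullet> (EQ' \<bullet> x)) - L2 x = (2 * n - 1) * (hc x + (2 * n + 1) * kc x - tc x)"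
  "L2 (EP' \<bullet> x) - L2 x = (2 * n - 1) * (hc x + kc x - jc x)"
  "L2 (EP \<bullet> x) - L2 x = (2 * n - 1) * (hc x + kc x + jc x)"
  "L2 (EP' \<bullet> (EQ \<bullet> x)) - L2 x = (2 * n - 1) * ((2 * n + 1) * hc x + kc x - (tc x + (2 * n + 1) * jc x))"
  "L2 (EP \<bullet> (EQ \<bullet> x)) - L2 x = (2 * n - 1) * ((2 * n + 1) * hc x + kc x + (tc x + (2 * n + 1) * jc x))"
  "L2 (EQ' \<bullet> x) - L2 x = (2 * n - 1) * kc x"
  "L2 (EQ \<bullet> x) - L2 x = (2 * n - 1) * hc x"
  "L3 (ER' \<bullet> x) - L2 x = hc x + 2 * n * kc x - (tc x + jc x)"
  "L3 x - L2 x = hc x + 2 * n * kc x + (tc x + jc x)"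
  "L3 (EQ \<bullet> (ER' \<bullet> x)) - L2 x = 2 * n * hc x + kc x - (tc x + 2 * n * jc x)"
  "L3 (EQ \<bullet> x) - L2 x = 2 * n * hc x + kc x + (tc x + 2 * n * jc x)"
  by (cases x; simp add: E_defs algebra_simps)+

lemma cone2I:
  assumes min: "\<And>v. v \<in> V \<Longrightarrow> L2 x \<le> L2 (v \<bullet> x)" "\<And>v. v \<in> V \<Longrightarrow> L2 x \<le> L3 (v \<bullet> x)"
  shows "cone2 x"
proof -
  have V: "u \<bullet> v \<in> V" if "u \<in> V" "v \<in> V" for u v using that by (rule V_qmult)
  note m = min(1)[OF V, unfolded qmult_assoc] min(1) min(2)[OF V, unfolded qmult_assoc] min(2)
  have "0 \<le> L2 (EP' \<bullet> (EQ' \<bullet> x)) - L2 x" "0 \<le> L2 (EP \<bullet> (EQ' \<bullet> x)) - L2 x"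
    "0 \<le> L2 (EP' \<bullet> x) - L2 x" "0 \<le> L2 (EP \<bullet> x) - L2 x"
    "0 \<le> L2 (EP' \<bullet> (EQ \<bullet> x)) - L2 x" "0 \<le> L2 (EP \<bullet> (EQ \<bullet> x)) - L2 x"
    "0 \<le> L2 (EQ' \<bullet> x) - L2 x" "0 \<le> L2 (EQ \<bullet> x) - L2 x"
    "0 \<le> L3 (ER' \<bullet> x) - L2 x" "0 \<le> L3 x - L2 x"
    "0 \<le> L3 (EQ \<bullet> (ER' \<bullet> x)) - L2 x" "0 \<le> L3 (EQ \<bullet> x) - L2 x"
    using m V_gen min(2)[OF V_one] by simp_all
  then show ?thesis unfolding neighbours_2 zero_le_index_mult_iff cone2_def cone_def by linarith
qed

text \<open>Each difference vanishes at three of the vertices 1, eps_p, eps_q, eps_p eps_q and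
  equals 2n - 1 at the fourth; this is where the barycentric coordinates of \<open>cone3\<close>
  come from.\<close>

lemma neighbours_3:
  "L2 ((EQ' \<bullet> (ER \<bullet> (a, b, c, d)))) - L3 (a, b, c, d) = (2 * n - 1) * (a - 2 * n * b - n * c) + 2 * n * d"
  "L2 (EQ' \<bullet> (a, b, c, d)) - L3 (a, b, c, d) = (2 * n - 1) * b - d"
  "L2 (a, b, c, d) - L3 (a, b, c, d) = (2 * n - 1) * c - 2 * n * d"
  "L2 (ER \<bullet> (a, b, c, d)) - L3 (a, b, c, d) = d"
  by (simp_all add: E_defs algebra_simps)

lemma cone3I:
  assumes min: "\<And>v. v \<in> V \<Longrightarrow> L3 x \<le> L2 (v \<bullet> x)"
  shows "cone3 x"
proof -
  obtain a b c d where x: "x = (a, b, c, d)" by (metis prod_cases4)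
  have V: "u \<bullet> v \<in> V" if "u \<in> V" "v \<in> V" for u v using that by (rule V_qmult)
  note m = min(1)[OF V, unfolded qmult_assoc] min(1)
  have "0 \<le> L2 (EQ' \<bullet> (ER \<bullet> x)) - L3 x" "0 \<le> L2 (EQ' \<bullet> x) - L3 x" "0 \<le> L2 x - L3 x" "0 \<le> L2 (ER \<bullet> x) - L3 x"
    using m V_gen min[OF V_one] by simp_all
  then show ?thesis unfolding x neighbours_3 by simp
qed

lemma cone_cover:
  assumes "tp x"
  shows "\<exists>v\<in>V. cone2 (v \<bullet> x) \<or> cone3 (v \<bullet> x)"
proof -
  define \<phi> where "\<phi> v = min (L2 (v \<bullet> x)) (L3 (v \<bullet> x))" for v
  have pos: "0 \<le> \<phi> v" if "v \<in> V" for v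
    using that assms V_tp tp_mult L2_pos L3_pos by (simp add: \<phi>_def less_imp_le)
  have "\<exists>v. v \<in> V \<and> (\<forall>w. w \<in> V \<longrightarrow> nat (\<phi> v) \<le> nat (\<phi> w))"
    using ex_has_least_nat[of "\<lambda>v. v \<in> V" one "\<lambda>v. nat (\<phi> v)"] V_one by blast
  then obtain v where v: "v \<in> V" and least: "\<And>w. w \<in> V \<Longrightarrow> nat (\<phi> v) \<le> nat (\<phi> w)" by blast
  have le: "\<phi> v \<le> \<phi> w" if "w \<in> V" for w
    using pos[OF v] pos[OF that] least[OF that] by linarith
  have le': "\<phi> v \<le> L2 (w \<bullet> (v \<bullet> x))" "\<phi> v \<le> L3 (w \<bullet> (v \<bullet> x))" if "w \<in> V" for w
    using le[OF V_qmult[OF that v]] by (simp_all add: \<phi>_def qmult_assoc)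
  show ?thesis
  proof (cases "L2 (v \<bullet> x) \<le> L3 (v \<bullet> x)")
    case True
    then have "\<phi> v = L2 (v \<bullet> x)" by (simp add: \<phi>_def)
    then show ?thesis using v le' by (auto intro!: bexI[of _ v] cone2I)
  next
    case False
    then have "\<phi> v = L3 (v \<bullet> x)" by (simp add: \<phi>_def)
    then show ?thesis using v le' by (auto intro!: bexI[of _ v] cone3I)
  qed
qed

text \<open>Inverse of the coordinate map (\<open>hc\<close>, \<open>kc\<close>, \<open>tc\<close>,
  \<open>jc\<close>), which is therefore unimodular. The direction of t is the element \<mu> -
  1.\<close>

definition mk :: "int \<Rightarrow> int \<Rightarrow> int \<Rightarrow> int \<Rightarrow> quad" where
  "mk h k t j = (h * (n * (2 * n + 1)) + k * (2 * n + 1) + t * n + j * (n * (2 * n + 1) - 1), h + j,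
     (h + j) * (2 * n + 1) + t, (h + j) * (2 * n) + k + t)"

lemma mk_coords [simp]: "hc (mk h k t j) = h" "kc (mk h k t j) = k" "tc (mk h k t j) = t" "jc (mk h k t j) = j"
  by (simp_all add: mk_def algebra_simps)

lemma coords_mk: "mk (hc x) (kc x) (tc x) (jc x) = x"
  by (cases x) (simp add: mk_def algebra_simps)

lemma mk_add: "mk h k t j + mk h' k' t' j' = mk (h + h') (k + k') (t + t') (j + j')"
  by (simp add: mk_def algebra_simps)

lemma mk_eq_0: "mk h k t j = 0 \<longleftrightarrow> h = 0 \<and> k = 0 \<and> t = 0 \<and> j = 0"
proof
  assume "mk h k t j = 0"
  moreover have "mk 0 0 0 0 = 0" by (simp add: mk_def zero_prod_def)
  ultimately have "mk h k t j = mk 0 0 0 0" by simp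
  then show "h = 0 \<and> k = 0 \<and> t = 0 \<and> j = 0" by (metis mk_coords)
qed (simp add: mk_def zero_prod_def)

lemma L2_mk: "L2 (mk h k t j) = h + k"
  by (simp add: mk_def algebra_simps)

lemma cone2_mk: "cone2 (mk h k t j) \<longleftrightarrow> cone (2 * n) h k t j"
  by (simp add: cone2_def)

section \<open>Lattice points of the cone over the \<open>L2\<close> facet\<close>

definition HQ :: quad where "HQ = (2 * n + 1, -1, 0, 1)"
definition MU :: quad where "MU = (n + 1, 0, 1, 1)"

text \<open>Twice each conjugate is \<beta> (2\<beta> + e (f\<gamma> - \<alpha>)), so everything
  reduces to \<alpha> + \<gamma> < 2\<beta>, an instance of the concavity of the square
  root.\<close>

lemma tp_HQ: "tp HQ"
proof -
  have "(\<alpha> + \<gamma>) ^ 2 < (2 * \<beta>) ^ 2"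
  proof -
    have "(\<alpha> * \<gamma>) ^ 2 = (\<alpha> * \<alpha>) * (\<gamma> * \<gamma>)" by (simp add: power2_eq_square)
    also have "\<dots> < (2 * n + 1) ^ 2" unfolding \<alpha>_sq \<gamma>_sq by (simp add: power2_eq_square algebra_simps)
    finally have "\<alpha> * \<gamma> < 2 * n + 1" using n_ge by (auto dest: power_less_imp_less_base)
    then show ?thesis using \<alpha>_sq \<beta>_sq \<gamma>_sq by (simp add: power2_eq_square algebra_simps)
  qed
  from power_less_imp_less_base[OF this] have 1: "\<alpha> + \<gamma> < 2 * \<beta>" using \<beta>_pos by simp
  have "0 < (2 * \<beta> + e * (f * \<gamma> - \<alpha>))" if "e \<in> {1,-1}" "f \<in> {1,-1}" for e f :: real
    using that 1 \<alpha>_pos \<beta>_pos \<gamma>_pos \<alpha>_less_\<beta> \<beta>_less_\<gamma> by auto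
  then have "0 < \<beta> * (2 * \<beta> + e * (f * \<gamma> - \<alpha>))" if "e \<in> {1,-1}" "f \<in> {1,-1}" for e f :: real
    using that \<beta>_pos by (intro mult_pos_pos) auto
  moreover have "\<beta> * (2 * \<beta> + e * (f * \<gamma> - \<alpha>)) = 2 * emb e f HQ" for e f
    using \<beta>_sq by (simp add: HQ_def lin_def algebra_simps)
  ultimately show ?thesis unfolding tp_def by (metis zero_less_mult_iff zero_less_numeral less_asym)
qed

text \<open>Twice each conjugate is 2 + (\<beta> + e\<alpha>) (\<beta> + e f\<gamma>). If the second
  factor is negative, the product still exceeds -(\<gamma> + \<beta>) (\<gamma> - \<beta>) =
  -2.\<close>

lemma tp_MU: "tp MU"
proof -
  have 1: "0 < 2 + (\<beta> + e * \<alpha>) * (\<beta> + g * \<gamma>)" if "e \<in> {1,-1}" "g \<in> {1,-1}" for e g :: real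
  proof -
    have a: "0 < \<beta> + e * \<alpha>" using that \<alpha>_pos \<alpha>_less_\<beta> \<beta>_pos by auto
    show ?thesis
    proof (cases "g = 1")
      case True
      then show ?thesis using a \<beta>_pos \<gamma>_pos by (simp add: add_pos_pos)
    next
      case False
      then have g: "g = -1" using that by auto
      have "\<beta> + e * \<alpha> < \<beta> + \<gamma>" using that \<alpha>_pos \<gamma>_pos \<alpha>_less_\<beta> \<beta>_less_\<gamma> by auto
      then have "(\<beta> + e * \<alpha>) * (\<gamma> - \<beta>) < (\<beta> + \<gamma>) * (\<gamma> - \<beta>)" using \<beta>_less_\<gamma> by simp
      also have "\<dots> = 2" using \<beta>_sq \<gamma>_sq by (simp add: algebra_simps)
      finally show ?thesis by (simp add: g algebra_simps)
    qed
  qed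
  have 2: "2 + (\<beta> + e * \<alpha>) * (\<beta> + (e * f) * \<gamma>) = 2 * emb e f MU" if "e * e = 1" for e f
  proof -
    have "e * \<alpha> * ((e * f) * \<gamma>) = (e * e) * (f * (\<alpha> * \<gamma>))" by simp
    then have "e * \<alpha> * ((e * f) * \<gamma>) = f * (\<alpha> * \<gamma>)" using that by simp
    then have "2 + (\<beta> + e * \<alpha>) * (\<beta> + (e * f) * \<gamma>) = 2 + \<beta> * \<beta> + e * (\<alpha> * \<beta>) + f * (\<alpha> * \<gamma>) + e * f * (\<beta> * \<gamma>)"
      by (simp add: algebra_simps)
    then show ?thesis unfolding \<beta>_sq by (simp add: MU_def lin_def algebra_simps)
  qed
  have "0 < 2 * emb e f MU" if "e \<in> {1,-1}" "f \<in> {1,-1}" for e f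
    using 1[of e "e * f"] 2[of e f] that by auto
  then show ?thesis by (simp add: tp_def)
qed

text \<open>All points of the hexagon at (1, 0) are unit multiples of 1, \<open>HQ\<close> and
  \<open>MU\<close>, with \<open>EP \<bullet> HQ\<close> as its centre. Together with
  \<open>gens_thin\<close> this makes the generators totally positive and leaves only three classes
  at height 1.\<close>

lemma gens_hexagon:
  "mk 1 0 0 0 = EP \<bullet> HQ" "mk 1 0 1 0 = EQ \<bullet> ER" "mk 1 0 (-1) 0 = EP \<bullet> EQ" "mk 1 0 0 1 = EP \<bullet> ER"
  "mk 1 0 0 (-1) = one" "mk 1 0 1 (-1) = MU" "mk 1 0 (-1) 1 = EP \<bullet> MU"
  by (simp_all add: mk_def E_defs HQ_def MU_def algebra_simps)

lemma gens_thin: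
  "mk 0 1 0 0 = EP \<bullet> EQ' \<bullet> HQ" "mk 0 1 1 0 = EP \<bullet> EQ' \<bullet> ER" "mk 0 1 (-1) 0 = EQ'"
  "mk 0 1 (- (2 * n + 1)) 1 = EP" "mk 0 1 (- (2 * n)) 1 = EP \<bullet> EQ' \<bullet> MU"
  "mk 0 1 (2 * n + 1) (-1) = ER" "mk 0 1 (2 * n) (-1) = EQ' \<bullet> MU"
  by (simp_all add: mk_def E_defs HQ_def MU_def algebra_simps)

definition reps0 :: "quad set" where "reps0 = {one, HQ, MU}"

definition orbit :: "quad set \<Rightarrow> quad set" where "orbit S = {v \<bullet> s |v s. v \<in> V \<and> s \<in> S}"

lemma gens_hexagon_orbit: "(a, b) \<in> hexagon \<Longrightarrow> mk 1 0 a b \<in> orbit reps0"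
proof -
  have V: "EQ \<bullet> ER \<in> V" "EP \<bullet> EQ \<in> V" "EP \<bullet> ER \<in> V" using V_gen V_qmult by auto
  assume "(a, b) \<in> hexagon"
  then have "\<exists>v s. mk 1 0 a b = v \<bullet> s \<and> v \<in> V \<and> s \<in> reps0"
    unfolding hexagon_def insert_iff empty_iff prod.inject
    by (elim disjE) (use V V_gen V_one qmult_one(1) qmult_one(2)[symmetric] gens_hexagon in \<open>metis reps0_def insertI1 insertI2\<close>)+
  then show ?thesis by (auto simp: orbit_def)
qed

lemma gens_thin_orbit: "(a, b) \<in> thin_hexagon (2 * n) \<Longrightarrow> mk 0 1 a b \<in> orbit reps0"
proof -
  have V: "EP \<bullet> EQ' \<in> V" "EP \<bullet> EQ' \<bullet> ER \<in> V" using V_gen V_qmult by auto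
  assume "(a, b) \<in> thin_hexagon (2 * n)"
  then have "\<exists>v s. mk 0 1 a b = v \<bullet> s \<and> v \<in> V \<and> s \<in> reps0"
    unfolding thin_hexagon_def insert_iff empty_iff prod.inject
    by (elim disjE) (use V V_gen V_one qmult_one(1) qmult_one(2)[symmetric] gens_thin in \<open>metis reps0_def insertI1 insertI2\<close>)+
  then show ?thesis by (auto simp: orbit_def)
qed

lemma tp_reps0: "s \<in> reps0 \<Longrightarrow> tp s"
  using tp_one tp_HQ tp_MU by (auto simp: reps0_def)

lemma tp_orbit: "x \<in> orbit reps0 \<Longrightarrow> tp x"
  unfolding orbit_def using tp_mult V_tp tp_reps0 by blast

lemma tp_gens: "(a, b) \<in> hexagon \<Longrightarrow> tp (mk 1 0 a b)" "(a, b) \<in> thin_hexagon (2 * n) \<Longrightarrow> tp (mk 0 1 a b)"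
  by (simp_all add: tp_orbit gens_hexagon_orbit gens_thin_orbit)

lemma emb_mk: "emb e f (mk h k t j) = emb e f (mk h k 0 j) + t * emb e f (mk 0 0 1 0)"
proof -
  have "mk h k t j = mk h k 0 j + (t, 0, 0, 0) \<bullet> mk 0 0 1 0" by (simp add: mk_def algebra_simps)
  moreover have "emb e f ((t, 0, 0, 0) \<bullet> mk 0 0 1 0) = t * emb e f (mk 0 0 1 0)"
    by (simp add: mk_def lin_def algebra_simps)
  ultimately show ?thesis by (metis emb_add)
qed

text \<open>Each conjugate is an affine function of t, so positivity at two ends passes to all
  points between them. A whole progression is then totally positive as soon as its ends are.\<close>

lemma tp_mk_between:
  assumes "tp (mk h k t1 j)" "tp (mk h k t2 j)" "t1 \<le> t" "t \<le> t2"
  shows "tp (mk h k t j)"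
  unfolding tp_def
proof (intro ballI)
  fix e f :: real assume ef: "e \<in> {1,-1}" "f \<in> {1,-1}"
  define s where "s = emb e f (mk 0 0 1 0)"
  define c where "c = emb e f (mk h k 0 j)"
  have 1: "0 < c + t1 * s" "0 < c + t2 * s"
    using assms(1,2) ef emb_mk[of e f h k t1 j] emb_mk[of e f h k t2 j] by (auto simp: tp_def s_def c_def)
  have "0 < c + t * s"
  proof (cases "0 \<le> s")
    case True
    then have "t1 * s \<le> t * s" using assms(3) by (intro mult_right_mono) auto
    then show ?thesis using 1 by linarith
  next
    case False
    then have "t2 * s \<le> t * s" using assms(4) by (intro mult_right_mono_neg) auto
    then show ?thesis using 1 by linarith
  qed
  then show "0 < emb e f (mk h k t j)" unfolding emb_mk[of e f h k t j] s_def c_def .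
qed

lemma tp_extra:
  assumes "(t, j) \<in> extra (2 * n)"
  shows "tp (mk 1 1 t j)"
proof -
  have s: "tp (mk 1 1 (a + a') (b + b'))" if "(a, b) \<in> hexagon" "(a', b') \<in> thin_hexagon (2 * n)" for a b a' b'
    using tp_add[OF tp_gens(1)[OF that(1)] tp_gens(2)[OF that(2)]] by (simp add: mk_add)
  have "(0, -1) \<in> hexagon" "(0, 1) \<in> hexagon" "(0, 0) \<in> hexagon"
    "(0, 0) \<in> thin_hexagon (2 * n)" "(2 * n + 1, -1) \<in> thin_hexagon (2 * n)" "(- (2 * n + 1), 1) \<in> thin_hexagon (2 * n)"
    by (simp_all add: hexagon_def thin_hexagon_def)
  \<comment> \<open>Endpoints for \<open>tp_mk_between\<close>, all of them sums of two generators: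
    t = -(2n + 1) and 2n + 1 for j = 0, t = 0 and 2n + 1 for j = -1, t = -(2n + 1) and 0 for j =
    1.\<close>
  note e = s[OF this(1,6)] s[OF this(2,5)] s[OF this(1,4)] s[OF this(3,5)] s[OF this(2,4)] s[OF this(3,6)]
  from assms consider "j = 0" "\<bar>t\<bar> \<le> 2 * n - 2" | "j = -1" "3 \<le> t" "t \<le> 2 * n - 2" | "j = 1" "3 \<le> -t" "-t \<le> 2 * n - 2"
    by (auto simp: extra_def)
  then show ?thesis
  proof cases
    case 1
    have "tp (mk 1 1 (- (2 * n + 1)) 0)" "tp (mk 1 1 (2 * n + 1) 0)" using e(1,2) by simp_all
    moreover have "- (2 * n + 1) \<le> t" "t \<le> 2 * n + 1" using 1 by linarith+
    ultimately show ?thesis unfolding 1(1) by (rule tp_mk_between)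
  next
    case 2
    have "tp (mk 1 1 0 (-1))" "tp (mk 1 1 (2 * n + 1) (-1))" using e(3,4) by simp_all
    from tp_mk_between[OF this, of t] 2 show ?thesis by simp
  next
    case 3
    have "tp (mk 1 1 (- (2 * n + 1)) 1)" "tp (mk 1 1 0 1)" using e(5,6) by simp_all
    from tp_mk_between[OF this, of t] 3 show ?thesis by simp
  qed
qed

definition decomposable :: "quad \<Rightarrow> bool" where
  "decomposable x \<longleftrightarrow> (\<exists>y z. tp y \<and> tp z \<and> x = y + z)"

lemma decomposableI: "tp y \<Longrightarrow> tp z \<Longrightarrow> decomposable (y + z)"
  unfolding decomposable_def by blast

text \<open>Induction on h + k: \<open>cone_step\<close> and its mirror image peel off a generator
  while h >= 2 or k >= 2, which leaves the heights (1, 0), (0, 1) and (1, 1). Total positivity is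
  part of the claim because the remainder must be totally positive for the splitting to be a
  decomposition.\<close>

lemma cone2_cases:
  assumes "cone (2 * n) h k t j" "(h, k) \<noteq> (0, 0)"
  shows "tp (mk h k t j) \<and> (h = 1 \<and> k = 0 \<and> (t, j) \<in> hexagon \<or> h = 0 \<and> k = 1 \<and> (t, j) \<in> thin_hexagon (2 * n)
     \<or> h = 1 \<and> k = 1 \<and> (t, j) \<in> extra (2 * n) \<or> decomposable (mk h k t j))"
  using assms
proof (induction "nat (h + k)" arbitrary: h k t j rule: less_induct)
  case less
  have hk: "0 \<le> h" "0 \<le> k" using less.prems(1) by (simp_all add: cone_def)
  have m: "2 * n \<ge> 12" using n_ge by simp
  have dec: ?case if "tp y" "tp z" "mk h k t j = y + z" for y z
    using tp_add[OF that(1,2)] decomposableI[OF that(1,2)] unfolding that(3) by blast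
  show ?case
  proof (cases "h \<ge> 2")
    case True
    from cone_step[OF m less.prems(1) this] obtain a b where
      ab: "(a, b) \<in> hexagon" "cone (2 * n) (h - 1) k (t - a) (j - b)" by blast
    have "tp (mk (h - 1) k (t - a) (j - b))"
      using less.hyps[OF _ ab(2)] True hk by auto
    then show ?thesis by (rule dec[OF tp_gens(1)[OF ab(1)]]) (simp add: mk_add)
  next
    case h: False
    show ?thesis
    proof (cases "k \<ge> 2")
      case True
      from cone_step'[OF m less.prems(1) this] obtain a b where
        ab: "(a, b) \<in> thin_hexagon (2 * n)" "cone (2 * n) h (k - 1) (t - a) (j - b)" by blast
      have "tp (mk h (k - 1) (t - a) (j - b))"
        using less.hyps[OF _ ab(2)] True hk by auto
      then show ?thesis by (rule dec[OF tp_gens(2)[OF ab(1)]]) (simp add: mk_add)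
    next
      case False
      then consider "h = 1" "k = 0" | "h = 0" "k = 1" | "h = 1" "k = 1" using h hk less.prems(2) by fastforce
      then show ?thesis
      proof cases
        case 1
        then show ?thesis using less.prems(1) cone_1_0 tp_gens(1) by auto
      next
        case 2
        then show ?thesis using less.prems(1) cone_0_1 tp_gens(2) by auto
      next
        case 3
        from cone_1_1[OF m, of t j] less.prems(1) 3
        consider a b where "(a, b) \<in> hexagon" "(t - a, j - b) \<in> thin_hexagon (2 * n)" | "(t, j) \<in> extra (2 * n)" by auto
        then show ?thesis
        proof cases
          case 1
          show ?thesis by (rule dec[OF tp_gens(1)[OF 1(1)] tp_gens(2)[OF 1(2)]]) (simp add: mk_add 3)
        next
          case 2
          then show ?thesis using 3 tp_extra by auto
        qed
      qed
    qed
  qed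
qed

section \<open>The simplicial cone over the \<open>L3\<close> facet\<close>

definition ES :: "int \<Rightarrow> quad" where "ES t = (2 * n + 1 + (n - 1) * t, 1, t, t - 1)"

lemma cone3_tp:
  assumes "cone3 x" "x \<noteq> 0"
  shows "tp x"
proof -
  obtain a b c d where x: "x = (a, b, c, d)" by (metis prod_cases4)
  define b0 where "b0 = (2 * n - 1) * (a - 2 * n * b - n * c) + 2 * n * d"
  define b1 where "b1 = (2 * n - 1) * b - d"
  define b2 where "b2 = (2 * n - 1) * c - 2 * n * d"
  have pos: "0 \<le> b0" "0 \<le> b1" "0 \<le> b2" "0 \<le> d" using assms(1) by (simp_all add: x b0_def b1_def b2_def)
  have nz: "b0 \<noteq> 0 \<or> b1 \<noteq> 0 \<or> b2 \<noteq> 0 \<or> d \<noteq> 0"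
  proof (rule ccontr)
    assume *: "\<not> ?thesis"
    then have "b = 0" "c = 0" using n_ge by (auto simp: b1_def b2_def)
    then have "a = 0" using * n_ge by (auto simp: b0_def)
    then show False using assms(2) * \<open>b = 0\<close> \<open>c = 0\<close> by (simp add: x zero_prod_def)
  qed
  have eq: "(2 * n - 1, 0, 0, 0) \<bullet> x = (b0, 0, 0, 0) \<bullet> one + (b1, 0, 0, 0) \<bullet> EP + (b2, 0, 0, 0) \<bullet> EQ + (d, 0, 0, 0) \<bullet> (EP \<bullet> EQ)"
    by (simp add: x E_defs b0_def b1_def b2_def algebra_simps)
  show ?thesis unfolding tp_def
  proof (intro ballI)
    fix e f :: real assume ef: "e \<in> {1,-1}" "f \<in> {1,-1}"
    then have ef1: "e * e = 1" "f * f = 1" by auto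
    have g: "0 < emb e f one" "0 < emb e f EP" "0 < emb e f EQ" "0 < emb e f (EP \<bullet> EQ)"
      using tp_one tp_E tp_mult ef unfolding tp_def by blast+
    have "(2 * n - 1) * emb e f x = b0 * emb e f one + b1 * emb e f EP + b2 * emb e f EQ + d * emb e f (EP \<bullet> EQ)"
      using arg_cong[OF eq, of "emb e f"] unfolding emb_add emb_mult[OF ef1] emb_int by simp
    also have "\<dots> > 0"
    proof -
      have "0 \<le> b0 * emb e f one" "0 \<le> b1 * emb e f EP" "0 \<le> b2 * emb e f EQ" "0 \<le> d * emb e f (EP \<bullet> EQ)"
        using g pos by (intro mult_nonneg_nonneg; simp)+
      moreover have "b0 * emb e f one \<noteq> 0 \<or> b1 * emb e f EP \<noteq> 0 \<or> b2 * emb e f EQ \<noteq> 0 \<or> d * emb e f (EP \<bullet> EQ) \<noteq> 0"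
        using nz g by (metis less_irrefl mult_eq_0_iff of_int_eq_0_iff)
      ultimately show ?thesis by linarith
    qed
    finally show "0 < emb e f x" using n_ge by (auto simp: zero_less_mult_iff)
  qed
qed

text \<open>If no vertex can be subtracted, all four barycentric numerators are below 2n - 1, so x
  lies in the half-open parallelepiped of the simplex. Its points are determined by the last
  coordinate d: zero for d = 0, and \<open>ES (d + 1)\<close> otherwise. The numerators of
  \<open>ES t\<close> are t - 1, 2n - t, 2n - t, t - 1.\<close>

lemma cone3_cases:
  assumes "cone3 x" "x \<noteq> 0"
  shows "x \<in> {one, EP, EQ, EP \<bullet> EQ} \<union> {ES t |t. 2 \<le> t \<and> t \<le> 2 * n - 1} \<or> decomposable x"
proof (rule ccontr)
  assume neg: "\<not> ?thesis"
  obtain a b c d where x: "x = (a, b, c, d)" by (metis prod_cases4)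
  have no: "\<not> cone3 (x - g)" if "g \<in> {one, EP, EQ, EP \<bullet> EQ}" for g
  proof
    assume c: "cone3 (x - g)"
    have "x - g \<noteq> 0" using that neg by auto
    with c have "tp (x - g)" by (rule cone3_tp)
    moreover have "tp g" using that tp_one tp_E tp_mult[OF tp_E(1,3)] by auto
    ultimately have "decomposable x" unfolding decomposable_def by (metis diff_add_cancel)
    then show False using neg by simp
  qed
  define b0 where "b0 = (2 * n - 1) * (a - 2 * n * b - n * c) + 2 * n * d"
  define b1 where "b1 = (2 * n - 1) * b - d"
  define b2 where "b2 = (2 * n - 1) * c - 2 * n * d"
  have pos: "0 \<le> b0" "0 \<le> b1" "0 \<le> b2" "0 \<le> d" using assms(1) by (simp_all add: x b0_def b1_def b2_def)
  have "b0 < 2 * n - 1" using no[of one] pos by (simp add: x E_defs b0_def b1_def b2_def algebra_simps)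
  moreover have "b1 < 2 * n - 1" using no[of EP] pos by (simp add: x E_defs b0_def b1_def b2_def algebra_simps)
  moreover have "b2 < 2 * n - 1" using no[of EQ] pos by (simp add: x E_defs b0_def b1_def b2_def algebra_simps)
  moreover have "d < 2 * n - 1" using no[of "EP \<bullet> EQ"] pos by (simp add: x E_defs b0_def b1_def b2_def algebra_simps)
  ultimately have lt: "b0 < 2 * n - 1" "b1 < 2 * n - 1" "b2 < 2 * n - 1" "d < 2 * n - 1" by simp_all
  have small: "k = 0" if "- (2 * n - 1) < (2 * n - 1) * k" "(2 * n - 1) * k < 2 * n - 1" for k
  proof -
    have "(2 * n - 1) * (-1) < (2 * n - 1) * k" "(2 * n - 1) * k < (2 * n - 1) * 1" using that by simp_all
    then show ?thesis using n_ge by (simp only: mult_less_cancel_left) auto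
  qed
  show False
  proof (cases "d = 0")
    case True
    then have "b = 0" "c = 0" using pos lt by (intro small; simp add: b1_def b2_def)+
    then have "a = 0" using pos lt True by (intro small; simp add: b0_def)
    then show False using assms(2) True \<open>b = 0\<close> \<open>c = 0\<close> by (simp add: x zero_prod_def)
  next
    case False
    have "b - 1 = 0" using pos lt False by (intro small) (simp_all add: b1_def algebra_simps)
    then have b: "b = 1" by simp
    have "c - d - 1 = 0" using pos lt False by (intro small) (simp_all add: b2_def algebra_simps)
    then have c: "c = d + 1" by simp
    have "a - 2 * n * b - n * c + d = 0" using pos lt False by (intro small) (simp_all add: b0_def algebra_simps)
    then have "a = 2 * n + n * (d + 1) - d" by (simp add: b c)
    then have "x = ES (d + 1)" by (simp add: x ES_def b c algebra_simps)
    moreover have "2 \<le> d + 1" "d + 1 \<le> 2 * n - 1" using pos lt False by linarith+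
    ultimately show False using neg by blast
  qed
qed

section \<open>Indecomposable elements up to the action of \<open>V\<close>\<close>

definition indec :: "quad \<Rightarrow> bool" where "indec x \<longleftrightarrow> tp x \<and> \<not> decomposable x"

lemma decomposable_mult: "v \<in> V \<Longrightarrow> decomposable x \<Longrightarrow> decomposable (v \<bullet> x)"
  unfolding decomposable_def using tp_mult V_tp qmult_distrib by metis

lemma indec_mult:
  assumes "v \<in> V" shows "indec (v \<bullet> x) \<longleftrightarrow> indec x"
proof -
  obtain w where w: "w \<in> V" "w \<bullet> v = one" using V_inverse[OF assms] .
  then have "w \<bullet> (v \<bullet> x) = x" by (metis qmult_assoc qmult_one(1))
  then show ?thesis unfolding indec_def using w assms decomposable_mult tp_mult V_tp by metis
qed

definition reps :: "quad set" where
  "reps = {one, HQ, MU} \<union> {mk 1 1 t j |t j. (t, j) \<in> extra (2 * n)} \<union> {ES t |t. 2 \<le> t \<and> t \<le> 2 * n - 1}"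

lemma orbit_reps: "s \<in> reps \<Longrightarrow> s \<in> orbit reps"
  unfolding orbit_def using V_one qmult_one(1) by (metis (mono_tags, lifting) mem_Collect_eq)

lemma indec_orbit:
  assumes "indec x" shows "x \<in> orbit reps"
proof -
  have tp: "tp x" "\<not> decomposable x" using assms by (simp_all add: indec_def)
  from cone_cover[OF tp(1)] obtain v where v: "v \<in> V" "cone2 (v \<bullet> x) \<or> cone3 (v \<bullet> x)" by blast
  define y where "y = v \<bullet> x"
  have y: "indec y" using indec_mult[OF v(1)] assms by (simp add: y_def)
  then have ny: "\<not> decomposable y" "y \<noteq> 0" using tp_nonzero by (auto simp: indec_def)
  have sub: "orbit reps0 \<subseteq> orbit reps" unfolding orbit_def reps0_def reps_def by blast
  have "y \<in> orbit reps"
    using v(2) unfolding y_def[symmetric]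
  proof
    assume c: "cone2 y"
    obtain h k t j where ymk: "y = mk h k t j" using coords_mk by metis
    have c': "cone (2 * n) h k t j" using c by (simp add: ymk cone2_mk)
    have "(h, k) \<noteq> (0, 0)" using cone_0_0[of "2 * n" t j] c' ny(2) by (auto simp: ymk mk_eq_0)
    from cone2_cases[OF c' this] ny(1) show ?thesis
      using gens_hexagon_orbit[of t j] gens_thin_orbit[of t j] sub orbit_reps[of y] unfolding ymk reps_def by blast
  next
    assume "cone3 y"
    from cone3_cases[OF this ny(2)] ny(1)
    consider "y \<in> {one, EP, EQ, EP \<bullet> EQ}" | "y \<in> reps" unfolding reps_def by blast
    then show ?thesis
    proof cases
      case 1
      then have "y \<in> V" using V_one V_gen V_qmult[OF V_gen(1,3)] by auto
      then have "y \<bullet> one \<in> orbit reps" unfolding orbit_def reps_def by blast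
      then show ?thesis by simp
    qed (rule orbit_reps)
  qed
  then obtain u s where us: "u \<in> V" "s \<in> reps" "y = u \<bullet> s" unfolding orbit_def by blast
  obtain w where w: "w \<in> V" "w \<bullet> v = one" using V_inverse[OF v(1)] .
  have "x = (w \<bullet> u) \<bullet> s" using us(3) w(2) unfolding y_def by (metis qmult_assoc qmult_one(1))
  then show ?thesis unfolding orbit_def using us V_qmult[OF w(1) us(1)] by blast
qed

text \<open>Both functionals are additive and at least 1 on totally positive elements, so they are
  at least 2 on a sum of two.\<close>

lemma level_one_indec: "tp x \<Longrightarrow> L2 x = 1 \<or> L3 x = 1 \<Longrightarrow> indec x"
proof -
  assume x: "tp x" "L2 x = 1 \<or> L3 x = 1"
  have "\<not> decomposable x"
  proof
    assume "decomposable x"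
    then obtain y z where yz: "tp y" "tp z" "x = y + z" unfolding decomposable_def by blast
    have "0 < L2 y" "0 < L3 y" "0 < L2 z" "0 < L3 z" using yz L2_pos L3_pos by blast+
    then show False using x(2) unfolding yz(3) L2_add L3_add by linarith
  qed
  then show ?thesis using x by (simp add: indec_def)
qed

lemma L2_level_one:
  assumes "tp x" "L2 x = 1"
  obtains a b where "(a, b) \<in> hexagon" "x = mk 1 0 a b" | a b where "(a, b) \<in> thin_hexagon (2 * n)" "x = mk 0 1 a b"
proof -
  obtain h k t j where x: "x = mk h k t j" using coords_mk by metis
  have "cone2 x"
  proof (rule cone2I)
    fix v assume "v \<in> V"
    then have "tp (v \<bullet> x)" using assms V_tp tp_mult by blast
    then show "L2 x \<le> L2 (v \<bullet> x)" "L2 x \<le> L3 (v \<bullet> x)" using assms(2) L2_pos L3_pos by fastforce+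
  qed
  then have c: "cone (2 * n) h k t j" by (simp add: x cone2_mk)
  have hk: "h + k = 1" using assms(2) by (simp add: x L2_mk)
  then have "(h, k) \<noteq> (0, 0)" by auto
  from cone2_cases[OF c this] level_one_indec[OF assms(1)] assms(2) hk
  have "h = 1 \<and> k = 0 \<and> (t, j) \<in> hexagon \<or> h = 0 \<and> k = 1 \<and> (t, j) \<in> thin_hexagon (2 * n)"
    unfolding indec_def x by auto
  then show ?thesis using that x by auto
qed

lemma L3_ES: "L3 (ES t) = 2" by (simp add: ES_def algebra_simps)

lemma L3_level_one:
  assumes "tp x" "L3 x = 1"
  shows "x \<in> {one, EP, EQ, EP \<bullet> EQ}"
proof -
  have "cone3 x"
  proof (rule cone3I)
    fix v assume "v \<in> V"
    then have "tp (v \<bullet> x)" using assms V_tp tp_mult by blast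
    then show "L3 x \<le> L2 (v \<bullet> x)" using assms(2) L2_pos by fastforce
  qed
  moreover have "x \<noteq> 0" using assms(1) tp_nonzero by blast
  ultimately show ?thesis using cone3_cases level_one_indec[OF assms(1)] assms(2) L3_ES unfolding indec_def by fastforce
qed

lemma indec_reps:
  assumes "s \<in> reps" shows "indec s"
proof -
  consider "s \<in> reps0" | t j where "(t, j) \<in> extra (2 * n)" "s = mk 1 1 t j" | t where "2 \<le> t" "t \<le> 2 * n - 1" "s = ES t"
    using assms unfolding reps_def reps0_def by blast
  then show ?thesis
  proof cases
    case 1
    have "indec (mk 1 0 a b)" if "(a, b) \<in> hexagon" for a b
      using tp_gens(1)[OF that] by (intro level_one_indec) (simp_all add: L2_mk)
    then have "indec (mk 1 0 0 0)" "indec (mk 1 0 0 (-1))" "indec (mk 1 0 1 (-1))" by (simp_all add: hexagon_def)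
    \<comment> \<open>\<open>L2 HQ\<close> is 2n, so the criterion is applied to
      \<open>EP \<bullet> HQ\<close>, the centre of the hexagon, and transported back by the
      unit.\<close>
    then show ?thesis using 1 indec_mult[OF V_gen(1)] unfolding gens_hexagon reps0_def by auto
  next
    case 2
    have "\<not> decomposable s"
    proof
      assume "decomposable s"
      then obtain y z where yz: "tp y" "tp z" "s = y + z" unfolding decomposable_def by blast
      have "L2 s = 2" by (simp add: 2(2) L2_mk)
      then have "L2 y + L2 z = 2" using L2_add[of y z] yz(3) by simp
      then have "L2 y = 1" "L2 z = 1" using L2_pos[OF yz(1)] L2_pos[OF yz(2)] by linarith+
      note ones = L2_level_one[OF yz(1) this(1)] L2_level_one[OF yz(2) this(2)]
      obtain h k a b where y: "y = mk h k a b" "h = 1 \<and> k = 0 \<and> (a, b) \<in> hexagon \<or> h = 0 \<and> k = 1 \<and> (a, b) \<in> thin_hexagon (2 * n)"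
        using ones(1) by metis
      obtain h' k' a' b' where z: "z = mk h' k' a' b'" "h' = 1 \<and> k' = 0 \<and> (a', b') \<in> hexagon \<or> h' = 0 \<and> k' = 1 \<and> (a', b') \<in> thin_hexagon (2 * n)"
        using ones(2) by metis
      have "mk 1 1 t j = mk (h + h') (k + k') (a + a') (b + b')" using yz(3) 2(2) by (simp add: y(1) z(1) mk_add)
      then have eq: "1 = h + h'" "1 = k + k'" "t = a + a'" "j = b + b'" by (metis mk_coords)+
      have m: "2 * n \<ge> 12" using n_ge by simp
      \<comment> \<open>The heights force one summand into each hexagon; both orders are possible,
        hence the two instances.\<close>
      show False using extra_not_sum[of a b a' b' "2 * n"] extra_not_sum[of a' b' a b "2 * n"] y(2) z(2) eq m 2(1)
        by (auto simp: add.commute)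
    qed
    then show ?thesis using tp_extra 2 by (simp add: indec_def)
  next
    case 3
    \<comment> \<open>The last coordinate is the obstruction: it is 0 or 2n - 1 on elements with
      \<open>L3\<close> equal to 1, hence a multiple of 2n - 1 on their sums, whereas on
      \<open>ES t\<close> it is t - 1, strictly between 0 and 2n - 1.\<close>
    have d: "snd (snd (snd g)) \<in> {0, 2 * n - 1}" if "g \<in> {one, EP, EQ, EP \<bullet> EQ}" for g
      using that by (auto simp: E_defs)
    have "\<not> decomposable s"
    proof
      assume "decomposable s"
      then obtain y z where yz: "tp y" "tp z" "s = y + z" unfolding decomposable_def by blast
      have "L3 s = 2" unfolding 3(3) by (rule L3_ES)
      then have "L3 y + L3 z = 2" using L3_add[of y z] yz(3) by simp
      then have "L3 y = 1" "L3 z = 1" using L3_pos[OF yz(1)] L3_pos[OF yz(2)] by linarith+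
      from d[OF L3_level_one[OF yz(1) this(1)]] d[OF L3_level_one[OF yz(2) this(2)]]
      have "snd (snd (snd s)) \<in> {0, 2 * n - 1, 2 * (2 * n - 1)}" by (auto simp: yz(3))
      then show False using 3 n_ge by (auto simp: ES_def)
    qed
    moreover have "cone3 s"
    proof -
      have "(2 * n - 1) * (2 * n + 1 + (n - 1) * t - 2 * n * 1 - n * t) + 2 * n * (t - 1) = t - 1"
        "(2 * n - 1) * 1 - (t - 1) = 2 * n - t" "(2 * n - 1) * t - 2 * n * (t - 1) = 2 * n - t"
        by (simp_all add: algebra_simps)
      then show ?thesis using 3 unfolding 3(3) ES_def cone3.simps by simp
    qed
    then have "tp s" by (rule cone3_tp) (use 3 in \<open>simp add: ES_def zero_prod_def\<close>)
    ultimately show ?thesis by (simp add: indec_def)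
  qed
qed

end

section \<open>The number field and its ring of integers\<close>

lemma real_ring_simps [simp]:
  "carrier real_ring = UNIV" "x \<otimes>\<^bsub>real_ring\<^esub> y = x * y" "x \<oplus>\<^bsub>real_ring\<^esub> y = x + y"
  "\<one>\<^bsub>real_ring\<^esub> = 1" "\<zero>\<^bsub>real_ring\<^esub> = 0"
  by (simp_all add: ring_of_type_algebra_def)

lemma real_ring_field: "field real_ring"
  by (rule field_from_type_algebra)

lemma real_ring_minus [simp]: "\<ominus>\<^bsub>real_ring\<^esub> x = - x"
proof -
  interpret field real_ring by (rule real_ring_field)
  show ?thesis by (rule minus_equality) simp_all
qed

lemma real_ring_inv [simp]: "x \<noteq> 0 \<Longrightarrow> inv\<^bsub>real_ring\<^esub> x = inverse x"
proof -
  interpret field real_ring by (rule real_ring_field)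
  assume "x \<noteq> 0"
  then have "inverse x = inv\<^bsub>real_ring\<^esub> x" by (intro comm_inv_char[symmetric]) simp_all
  then show ?thesis by simp
qed

lemma adjoin_rat_one: "1 \<in> adjoin_rat S"
  using generate_field.one[of real_ring S] by (simp add: adjoin_rat_def)

lemma adjoin_rat_incl: "x \<in> S \<Longrightarrow> x \<in> adjoin_rat S"
  unfolding adjoin_rat_def by (rule generate_field.incl)

lemma adjoin_rat_add: "x \<in> adjoin_rat S \<Longrightarrow> y \<in> adjoin_rat S \<Longrightarrow> x + y \<in> adjoin_rat S"
  using generate_field.eng_add[of x real_ring S y] by (simp add: adjoin_rat_def)

lemma adjoin_rat_mult: "x \<in> adjoin_rat S \<Longrightarrow> y \<in> adjoin_rat S \<Longrightarrow> x * y \<in> adjoin_rat S"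
  using generate_field.eng_mult[of x real_ring S y] by (simp add: adjoin_rat_def)

lemma adjoin_rat_minus: "x \<in> adjoin_rat S \<Longrightarrow> - x \<in> adjoin_rat S"
  using generate_field.a_inv[of x real_ring S] by (simp add: adjoin_rat_def)

lemma adjoin_rat_zero: "0 \<in> adjoin_rat S"
  using adjoin_rat_add[OF adjoin_rat_one adjoin_rat_minus[OF adjoin_rat_one]] by simp

lemma adjoin_rat_inverse: "x \<in> adjoin_rat S \<Longrightarrow> inverse x \<in> adjoin_rat S"
  using generate_field.m_inv[of x real_ring S] adjoin_rat_zero by (cases "x = 0") (simp_all add: adjoin_rat_def)

lemma adjoin_rat_of_nat: "of_nat k \<in> adjoin_rat S"
  by (induction k) (auto intro: adjoin_rat_zero adjoin_rat_one adjoin_rat_add)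

lemma adjoin_rat_of_int: "of_int k \<in> adjoin_rat S"
  by (cases k) (use adjoin_rat_of_nat adjoin_rat_minus in \<open>force simp flip: of_nat_Suc\<close>)+

lemma adjoin_rat_Rats: "x \<in> \<rat> \<Longrightarrow> x \<in> adjoin_rat S"
  by (elim Rats_cases') (auto simp: divide_inverse intro!: adjoin_rat_mult adjoin_rat_inverse adjoin_rat_of_int)

lemma adjoin_rat_minimal:
  assumes "S \<subseteq> F" "1 \<in> F" "\<And>x y. x \<in> F \<Longrightarrow> y \<in> F \<Longrightarrow> x + y \<in> F" "\<And>x y. x \<in> F \<Longrightarrow> y \<in> F \<Longrightarrow> x * y \<in> F"
    "\<And>x. x \<in> F \<Longrightarrow> - x \<in> F" "\<And>x. x \<in> F \<Longrightarrow> inverse x \<in> F"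
  shows "adjoin_rat S \<subseteq> F"
proof
  fix x assume "x \<in> adjoin_rat S"
  then have "x \<in> generate_field real_ring S" by (simp add: adjoin_rat_def)
  then show "x \<in> F" by induction (use assms in auto)
qed

lemma integer_units_iff:
  "x \<in> integer_units F \<longleftrightarrow> x \<in> ring_of_integers F \<and> (\<exists>y\<in>ring_of_integers F. x * y = 1)"
  by (auto simp: integer_units_def Units_def mult.commute)

lemma real_embeddings_iff:
  "\<sigma> \<in> real_embeddings F \<longleftrightarrow>
     (\<forall>x\<in>F. \<forall>y\<in>F. \<sigma> (x * y) = \<sigma> x * \<sigma> y \<and> \<sigma> (x + y) = \<sigma> x + \<sigma> y) \<and> \<sigma> 1 = 1"
  by (auto simp: real_embeddings_def ring_hom_def)

lemma embedding_of_rat: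
  assumes "\<sigma> \<in> real_embeddings (adjoin_rat S)" "x \<in> \<rat>"
  shows "\<sigma> x = x"
proof -
  have add: "\<sigma> (x + y) = \<sigma> x + \<sigma> y" and mult: "\<sigma> (x * y) = \<sigma> x * \<sigma> y"
    if "x \<in> adjoin_rat S" "y \<in> adjoin_rat S" for x y
    using assms(1) that by (auto simp: real_embeddings_iff)
  have one: "\<sigma> 1 = 1" using assms(1) by (simp add: real_embeddings_iff)
  have zero: "\<sigma> 0 = 0" using add[OF adjoin_rat_zero adjoin_rat_zero] by simp
  have nat: "\<sigma> (of_nat k) = of_nat k" for k
    by (induction k) (simp_all add: zero one add adjoin_rat_one adjoin_rat_of_nat)
  have minus: "\<sigma> (- y) = - \<sigma> y" if "y \<in> adjoin_rat S" for y
    using add[OF that adjoin_rat_minus[OF that]] zero by simp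
  have int: "\<sigma> (of_int k) = of_int k" for k
    by (cases k) (use nat minus adjoin_rat_of_nat in \<open>simp_all flip: of_nat_Suc\<close>)
  obtain a b where ab: "b > 0" "x = of_int a / of_int b" using assms(2) by (rule Rats_cases')
  have "x * of_int b = of_int a" using ab by simp
  then have "\<sigma> x * \<sigma> (of_int b) = \<sigma> (of_int a)"
    using mult[OF adjoin_rat_Rats[OF assms(2)] adjoin_rat_of_int] by metis
  then have "\<sigma> x * of_int b = x * of_int b" unfolding int \<open>x * of_int b = of_int a\<close> .
  then show ?thesis using ab(1) by simp
qed

section \<open>The field as a rational vector space and its four embeddings\<close>

context biquadratic
begin

definition KK :: "real set" where
  "KK = {lin 1 1 a b c d |a b c d. a \<in> \<rat> \<and> b \<in> \<rat> \<and> c \<in> \<rat> \<and> d \<in> \<rat>}"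

lemma lin_mult1:
  fixes a b c d a' b' c' d' :: real
  shows "lin 1 1 a b c d * lin 1 1 a' b' c' d' =
    lin 1 1 (a * a' + p * (b * b') + q * (c * c') + r * (d * d'))
            (a * b' + b * a' + (2 * n + 3) * (c * d' + d * c'))
            (a * c' + c * a' + (2 * n + 1) * (b * d' + d * b'))
            (a * d' + d * a' + (2 * n - 1) * (b * c' + c * b'))"
  by (rule lin_mult) simp_all

lemma lin_add: "lin e f a b c d + lin e f a' b' c' d' = lin e f (a + a') (b + b') (c + c') (d + d')"
  by (simp add: lin_def algebra_simps)

lemma lin_minus: "- lin e f a b c d = lin e f (-a) (-b) (-c) (-d)"
  by (simp add: lin_def algebra_simps)

lemma lin_scale: "x * lin e f a b c d = lin e f (x * a) (x * b) (x * c) (x * d)"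
  by (simp add: lin_def algebra_simps)

lemma KK_I: "a \<in> \<rat> \<Longrightarrow> b \<in> \<rat> \<Longrightarrow> c \<in> \<rat> \<Longrightarrow> d \<in> \<rat> \<Longrightarrow> lin 1 1 a b c d \<in> KK"
  unfolding KK_def by blast

lemma KK_add: assumes "x \<in> KK" "y \<in> KK" shows "x + y \<in> KK"
proof -
  obtain a b c d a' b' c' d' where "x = lin 1 1 a b c d" "y = lin 1 1 a' b' c' d'"
    "a \<in> \<rat>" "b \<in> \<rat>" "c \<in> \<rat>" "d \<in> \<rat>" "a' \<in> \<rat>" "b' \<in> \<rat>" "c' \<in> \<rat>" "d' \<in> \<rat>"
    using assms unfolding KK_def by blast
  then show ?thesis by (simp only: lin_add) (intro KK_I; simp)
qed

lemma KK_mult: assumes "x \<in> KK" "y \<in> KK" shows "x * y \<in> KK"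
proof -
  obtain a b c d a' b' c' d' where "x = lin 1 1 a b c d" "y = lin 1 1 a' b' c' d'"
    "a \<in> \<rat>" "b \<in> \<rat>" "c \<in> \<rat>" "d \<in> \<rat>" "a' \<in> \<rat>" "b' \<in> \<rat>" "c' \<in> \<rat>" "d' \<in> \<rat>"
    using assms unfolding KK_def by blast
  then show ?thesis by (simp only: lin_mult1) (intro KK_I; simp)
qed

lemma KK_minus: assumes "x \<in> KK" shows "- x \<in> KK"
proof -
  obtain a b c d where "x = lin 1 1 a b c d" "a \<in> \<rat>" "b \<in> \<rat>" "c \<in> \<rat>" "d \<in> \<rat>"
    using assms unfolding KK_def by blast
  then show ?thesis by (simp only: lin_minus) (intro KK_I; simp)
qed

lemma KK_inverse: assumes "x \<in> KK" shows "inverse x \<in> KK"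
proof (cases "x = 0")
  case False
  obtain a b c d where x: "x = lin 1 1 a b c d" and rat: "a \<in> \<rat>" "b \<in> \<rat>" "c \<in> \<rat>" "d \<in> \<rat>"
    using assms unfolding KK_def by blast
  \<comment> \<open>Inversion in two stages: y is the conjugate over Q(sqrt p), so x y = u + v sqrt
    p, and a second conjugation leaves the rational number N.\<close>
  define y where "y = lin 1 1 a b (-c) (-d)"
  define u where "u = a * a + p * (b * b) + q * (c * (-c)) + r * (d * (-d))"
  define v where "v = a * b + b * a + (2 * n + 3) * (c * (-d) + d * (-c))"
  have uv: "u \<in> \<rat>" "v \<in> \<rat>" using rat by (simp_all add: u_def v_def)
  have "y \<noteq> 0"
  proof
    assume "y = 0"
    then have "a = 0 \<and> b = 0 \<and> -c = 0 \<and> -d = 0" unfolding y_def using rat by (intro lin_eq_0) simp_all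
    then show False using False by (simp add: x lin_def)
  qed
  have xy: "x * y = lin 1 1 u v 0 0" unfolding x y_def lin_mult1 u_def v_def by (simp add: algebra_simps)
  have nz: "lin 1 1 u v 0 0 \<noteq> 0" using xy \<open>y \<noteq> 0\<close> False by (metis mult_eq_0_iff)
  have "lin 1 1 u (-v) 0 0 \<noteq> 0"
  proof
    assume "lin 1 1 u (-v) 0 0 = 0"
    then have "u = 0 \<and> -v = 0 \<and> (0::real) = 0 \<and> (0::real) = 0" using uv by (intro lin_eq_0) simp_all
    then show False using nz by (simp add: lin_def)
  qed
  define N where "N = u * u - p * (v * v)"
  have N: "lin 1 1 u v 0 0 * lin 1 1 u (-v) 0 0 = N" unfolding lin_mult1 by (simp add: lin_def N_def)
  then have "N \<noteq> 0" using nz \<open>lin 1 1 u (-v) 0 0 \<noteq> 0\<close> by auto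
  have "x * (y * lin 1 1 u (-v) 0 0 * lin 1 1 (1 / N) 0 0 0) = 1"
    using N \<open>N \<noteq> 0\<close> xy by (simp add: lin_def mult.assoc[symmetric])
  then have "inverse x = y * lin 1 1 u (-v) 0 0 * lin 1 1 (1 / N) 0 0 0" by (metis inverse_unique)
  also have "\<dots> \<in> KK" unfolding y_def using rat uv by (intro KK_mult KK_I) (simp_all add: N_def)
  finally show ?thesis .
qed (use KK_I[of 0 0 0 0] in \<open>simp add: lin_def\<close>)

lemma adjoin_eq_KK: "adjoin_rat {sqrt p, sqrt q} = KK"
proof
  have "sqrt p \<in> KK" "sqrt q \<in> KK" "1 \<in> KK"
    using KK_I[of 0 1 0 0] KK_I[of 0 0 1 0] KK_I[of 1 0 0 0] by (simp_all add: lin_def sqrt_p sqrt_q)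
  then show "adjoin_rat {sqrt p, sqrt q} \<subseteq> KK"
    by (intro adjoin_rat_minimal KK_add KK_mult KK_minus KK_inverse) auto
  show "KK \<subseteq> adjoin_rat {sqrt p, sqrt q}"
  proof
    fix x assume "x \<in> KK"
    then obtain a b c d where x: "x = lin 1 1 a b c d" and rat: "a \<in> \<rat>" "b \<in> \<rat>" "c \<in> \<rat>" "d \<in> \<rat>"
      unfolding KK_def by blast
    have "x = a + b * sqrt p + c * sqrt q + d / (2 * n - 1) * (sqrt p * sqrt q)"
      unfolding x lin_def \<beta>_\<gamma>_eq by (simp add: sqrt_p sqrt_q)
    also have "\<dots> \<in> adjoin_rat {sqrt p, sqrt q}"
      using rat by (intro adjoin_rat_add adjoin_rat_mult adjoin_rat_Rats adjoin_rat_incl) simp_all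
    finally show "x \<in> adjoin_rat {sqrt p, sqrt q}" .
  qed
qed

lemma adjoin_sqrt_eq:
  assumes "s * s = of_int x" "s \<notin> \<rat>"
  shows "adjoin_rat {s} = {a + b * s |a b. a \<in> \<rat> \<and> b \<in> \<rat>}" (is "_ = ?F")
proof
  have I: "a + b * s \<in> ?F" if "a \<in> \<rat>" "b \<in> \<rat>" for a b using that by blast
  show "adjoin_rat {s} \<subseteq> ?F"
  proof (rule adjoin_rat_minimal)
    show "{s} \<subseteq> ?F" "1 \<in> ?F" using I[of 0 1] I[of 1 0] by simp_all
    fix u assume "u \<in> ?F"
    then obtain a b where u: "u = a + b * s" "a \<in> \<rat>" "b \<in> \<rat>" by blast
    have "- u = (-a) + (-b) * s" by (simp add: u)
    then show "- u \<in> ?F" using u I[of "-a" "-b"] by simp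
    show "inverse u \<in> ?F"
    proof (cases "u = 0")
      case True
      then show ?thesis using I[of 0 0] by simp
    next
      case False
      define N where "N = a * a - x * (b * b)"
      have e: "u * (a - b * s) = N" by (simp add: u N_def assms(1)[symmetric] algebra_simps)
      have "a - b * s \<noteq> 0"
        using irrational_lin[OF assms(2), of a "-b"] u False by auto
      then have "N \<noteq> 0" using e False by auto
      then have "u * (a / N + (- b / N) * s) = 1" using e by (simp add: field_simps)
      then have "inverse u = a / N + (- b / N) * s" by (metis inverse_unique)
      then show ?thesis using I[of "a / N" "- b / N"] u by (simp add: N_def)
    qed
    fix w assume "w \<in> ?F"
    then obtain a' b' where w: "w = a' + b' * s" "a' \<in> \<rat>" "b' \<in> \<rat>" by blast
    have "u + w = (a + a') + (b + b') * s" by (simp add: u w algebra_simps)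
    from this I show "u + w \<in> ?F" by (rule ssubst) (simp_all add: u w)
    have "u * w = (a * a' + b * b' * (s * s)) + (a * b' + b * a') * s" by (simp add: u w algebra_simps)
    then have "u * w = (a * a' + b * b' * x) + (a * b' + b * a') * s" by (simp only: assms(1))
    from this I show "u * w \<in> ?F" by (rule ssubst) (simp_all add: u w)
  qed
  show "?F \<subseteq> adjoin_rat {s}"
    using adjoin_rat_incl[of s "{s}"] by (auto intro: adjoin_rat_add adjoin_rat_mult adjoin_rat_Rats)
qed

text \<open>The signs come from the squares of sqrt p and sqrt q; the image of \<beta>\<gamma> is
  then forced by \<beta>\<gamma> = sqrt p sqrt q / (2n - 1).\<close>

lemma embedding_of_lin:
  assumes "\<sigma> \<in> real_embeddings KK"
  obtains e f where "e \<in> {1,-1}" "f \<in> {1,-1}"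
    "\<And>a b c d. a \<in> \<rat> \<Longrightarrow> b \<in> \<rat> \<Longrightarrow> c \<in> \<rat> \<Longrightarrow> d \<in> \<rat> \<Longrightarrow> \<sigma> (lin 1 1 a b c d) = lin e f a b c d"
proof -
  have hom: "\<sigma> (x + y) = \<sigma> x + \<sigma> y" "\<sigma> (x * y) = \<sigma> x * \<sigma> y" if "x \<in> KK" "y \<in> KK" for x y
    using assms that by (auto simp: real_embeddings_iff)
  have rat: "\<sigma> x = x" if "x \<in> \<rat>" for x
    using embedding_of_rat assms that unfolding adjoin_eq_KK[symmetric] by blast
  have K: "sqrt p \<in> KK" "sqrt q \<in> KK" "x \<in> \<rat> \<Longrightarrow> x \<in> KK" for x
    unfolding adjoin_eq_KK[symmetric] by (auto intro: adjoin_rat_incl adjoin_rat_Rats)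
  have pq: "0 < p" "0 < q" using n_ge by (simp_all add: p_def q_def)
  have sign: "\<exists>e\<in>{1,-1}. \<sigma> (sqrt x) = e * sqrt x" if "sqrt x \<in> KK" "0 < x" for x :: int
  proof -
    have "\<sigma> (sqrt x) * \<sigma> (sqrt x) = \<sigma> (sqrt x * sqrt x)" by (rule hom(2)[OF that(1) that(1), symmetric])
    also have "\<dots> = sqrt x * sqrt x" using that rat[of x] by simp
    finally have "\<sigma> (sqrt x) = sqrt x \<or> \<sigma> (sqrt x) = - sqrt x" by (simp only: square_eq_iff)
    then show ?thesis by auto
  qed
  obtain e f where ef: "e \<in> {1,-1}" "f \<in> {1,-1}" "\<sigma> (sqrt p) = e * sqrt p" "\<sigma> (sqrt q) = f * sqrt q"
    using sign[OF K(1) pq(1)] sign[OF K(2) pq(2)] by blast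
  have "\<sigma> (lin 1 1 a b c d) = lin e f a b c d" if r: "a \<in> \<rat>" "b \<in> \<rat>" "c \<in> \<rat>" "d \<in> \<rat>" for a b c d
  proof -
    have l: "lin e f a b c d = a + b * (e * sqrt p) + c * (f * sqrt q) + d / (2 * n - 1) * ((e * sqrt p) * (f * sqrt q))" for e f
      unfolding lin_def \<beta>_\<gamma>_eq by (simp add: sqrt_p sqrt_q)
    have d: "d / (2 * n - 1) \<in> \<rat>" using r by simp
    have "\<sigma> (a + b * sqrt p + c * sqrt q + d' * (sqrt p * sqrt q)) =
      \<sigma> a + \<sigma> b * \<sigma> (sqrt p) + \<sigma> c * \<sigma> (sqrt q) + \<sigma> d' * (\<sigma> (sqrt p) * \<sigma> (sqrt q))" if "d' \<in> \<rat>" for d'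
      using r that K by (simp add: hom KK_add KK_mult)
    from this[OF d] have "\<sigma> (lin 1 1 a b c d) =
      \<sigma> a + \<sigma> b * \<sigma> (sqrt p) + \<sigma> c * \<sigma> (sqrt q) + \<sigma> (d / (2 * n - 1)) * (\<sigma> (sqrt p) * \<sigma> (sqrt q))"
      unfolding l[of 1 1] mult_1 .
    also have "\<dots> = lin e f a b c d" unfolding l rat[OF d] using rat r ef by simp
    finally show ?thesis .
  qed
  then show ?thesis using that ef by blast
qed

text \<open>Changing signs of the coefficients is well defined by \<open>lin_eq_0\<close>, and
  multiplicative because \<open>lin_mult\<close> has the same coefficients for all signs.\<close>

lemma lin_embedding:
  assumes "e \<in> {1,-1}" "f \<in> {1,-1}"
  obtains \<sigma> where "\<sigma> \<in> real_embeddings KK"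
    "\<And>a b c d. a \<in> \<rat> \<Longrightarrow> b \<in> \<rat> \<Longrightarrow> c \<in> \<rat> \<Longrightarrow> d \<in> \<rat> \<Longrightarrow> \<sigma> (lin 1 1 a b c d) = lin e f a b c d"
proof -
  have ef: "e * e = 1" "f * f = 1" using assms by auto
  define \<sigma> where "\<sigma> x = (THE y. \<exists>a b c d. a \<in> \<rat> \<and> b \<in> \<rat> \<and> c \<in> \<rat> \<and> d \<in> \<rat> \<and> x = lin 1 1 a b c d \<and> y = lin e f a b c d)" for x
  have \<sigma>: "\<sigma> (lin 1 1 a b c d) = lin e f a b c d" if r: "a \<in> \<rat>" "b \<in> \<rat>" "c \<in> \<rat>" "d \<in> \<rat>" for a b c d
    unfolding \<sigma>_def
  proof (rule the_equality)
    fix y assume "\<exists>a' b' c' d'. a' \<in> \<rat> \<and> b' \<in> \<rat> \<and> c' \<in> \<rat> \<and> d' \<in> \<rat> \<and> lin 1 1 a b c d = lin 1 1 a' b' c' d' \<and> y = lin e f a' b' c' d'"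
    then obtain a' b' c' d' where h: "a' \<in> \<rat>" "b' \<in> \<rat>" "c' \<in> \<rat>" "d' \<in> \<rat>" "lin 1 1 a b c d = lin 1 1 a' b' c' d'" "y = lin e f a' b' c' d'"
      by blast
    have "lin 1 1 (a - a') (b - b') (c - c') (d - d') = 0" using h(5) by (simp add: lin_def algebra_simps)
    then have "a - a' = 0 \<and> b - b' = 0 \<and> c - c' = 0 \<and> d - d' = 0" using h r by (intro lin_eq_0) simp_all
    then show "y = lin e f a b c d" using h by simp
  qed (use r in blast)
  have "\<sigma> \<in> real_embeddings KK"
    unfolding real_embeddings_iff
  proof (intro conjI ballI)
    fix x y assume "x \<in> KK" "y \<in> KK"
    then obtain a b c d a' b' c' d' where xy: "x = lin 1 1 a b c d" "y = lin 1 1 a' b' c' d'" and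
      rat: "a \<in> \<rat>" "b \<in> \<rat>" "c \<in> \<rat>" "d \<in> \<rat>" "a' \<in> \<rat>" "b' \<in> \<rat>" "c' \<in> \<rat>" "d' \<in> \<rat>"
      unfolding KK_def by blast
    show "\<sigma> (x + y) = \<sigma> x + \<sigma> y" unfolding xy lin_add using rat by (simp add: \<sigma> lin_add)
    show "\<sigma> (x * y) = \<sigma> x * \<sigma> y" unfolding xy lin_mult1 using rat by (simp add: \<sigma> lin_mult[OF ef])
  next
    have "\<sigma> (lin 1 1 1 0 0 0) = lin e f 1 0 0 0" by (rule \<sigma>) simp_all
    then show "\<sigma> 1 = 1" by (simp add: lin_def)
  qed
  then show ?thesis using that \<sigma> by blast
qed

end

section \<open>Integrality: bounded denominators and the integral basis\<close>

lemma squarefree_mult_square_Ints: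
  fixes x :: int and y :: real
  assumes "squarefree x" "y \<in> \<rat>" "x * (y * y) \<in> \<int>"
  shows "y \<in> \<int>"
proof -
  obtain a b where ab: "b > 0" "coprime a b" "y = of_int a / of_int b" using assms(2) by (rule Rats_cases')
  obtain m where "x * (y * y) = of_int m" using assms(3) by (auto elim: Ints_cases)
  then have "real_of_int (x * a ^ 2) = real_of_int (m * b ^ 2)"
    using ab(1) by (simp add: ab(3) power2_eq_square field_simps)
  then have "x * a ^ 2 = m * b ^ 2" by linarith
  then have "b ^ 2 dvd x * a ^ 2" by simp
  moreover have "coprime (b ^ 2) (a ^ 2)" using ab(2) by (simp add: coprime_commute)
  ultimately have "b ^ 2 dvd x" by (simp add: coprime_dvd_mult_left_iff)
  then have "b dvd 1" using assms(1) unfolding squarefree_def by blast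
  then have "b = 1" using ab(1) by simp
  then show ?thesis by (simp add: ab(3))
qed

lemma four_dvd_sum_squares:
  fixes x y :: int
  assumes "4 dvd x ^ 2 + y ^ 2"
  shows "even x \<and> even y"
proof -
  have sq: "z ^ 2 mod 4 = (if even z then 0 else 1)" for z :: int
  proof (cases "even z")
    case True
    then obtain k where "z = 2 * k" by (elim evenE)
    then show ?thesis by (simp add: power2_eq_square)
  next
    case False
    then obtain k where "z = 2 * k + 1" by (elim oddE)
    then have "z ^ 2 = 4 * (k * k + k) + 1" by (simp add: power2_eq_square algebra_simps)
    then have "z ^ 2 mod 4 = (4 * (k * k + k) + 1) mod 4" by simp
    then show ?thesis using False by presburger
  qed
  have "(x ^ 2 mod 4 + y ^ 2 mod 4) mod 4 = 0" using assms by (simp add: mod_add_eq)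
  then show ?thesis unfolding sq by (auto split: if_splits)
qed

context biquadratic
begin

definition Lat :: "real set" where
  "Lat = {lin 1 1 a b c d |a b c d. a \<in> \<int> \<and> b \<in> \<int> \<and> c \<in> \<int> \<and> d \<in> \<int>}"

lemma Lat_I: "a \<in> \<int> \<Longrightarrow> b \<in> \<int> \<Longrightarrow> c \<in> \<int> \<Longrightarrow> d \<in> \<int> \<Longrightarrow> lin 1 1 a b c d \<in> Lat"
  unfolding Lat_def by blast

lemma Lat_add: assumes "x \<in> Lat" "y \<in> Lat" shows "x + y \<in> Lat"
proof -
  obtain a b c d a' b' c' d' where "x = lin 1 1 a b c d" "y = lin 1 1 a' b' c' d'"
    "a \<in> \<int>" "b \<in> \<int>" "c \<in> \<int>" "d \<in> \<int>" "a' \<in> \<int>" "b' \<in> \<int>" "c' \<in> \<int>" "d' \<in> \<int>"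
    using assms unfolding Lat_def by blast
  then show ?thesis by (simp only: lin_add) (intro Lat_I; simp)
qed

lemma Lat_mult: assumes "x \<in> Lat" "y \<in> Lat" shows "x * y \<in> Lat"
proof -
  obtain a b c d a' b' c' d' where "x = lin 1 1 a b c d" "y = lin 1 1 a' b' c' d'"
    "a \<in> \<int>" "b \<in> \<int>" "c \<in> \<int>" "d \<in> \<int>" "a' \<in> \<int>" "b' \<in> \<int>" "c' \<in> \<int>" "d' \<in> \<int>"
    using assms unfolding Lat_def by blast
  then show ?thesis by (simp only: lin_mult1) (intro Lat_I; simp)
qed

lemma Lat_Ints: assumes "x \<in> \<int>" shows "x \<in> Lat"
  using Lat_I[of x 0 0 0] assms by (simp add: lin_def)

lemma Lat_sum: "(\<And>i. i \<in> I \<Longrightarrow> g i \<in> Lat) \<Longrightarrow> sum g I \<in> Lat"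
  by (induction I rule: infinite_finite_induct) (auto intro: Lat_add Lat_Ints)

lemma Lat_Rats: assumes "x \<in> Lat" "x \<in> \<rat>" shows "x \<in> \<int>"
proof -
  obtain a b c d where x: "x = lin 1 1 a b c d" "a \<in> \<int>" "b \<in> \<int>" "c \<in> \<int>" "d \<in> \<int>"
    using assms unfolding Lat_def by blast
  have R: "y \<in> \<rat>" if "y \<in> \<int>" for y :: real using that Ints_subset_Rats by blast
  have "lin 1 1 (a - x) b c d = 0" using x by (simp add: lin_def)
  then have "a - x = 0 \<and> b = 0 \<and> c = 0 \<and> d = 0" using x R assms(2) by (intro lin_eq_0) auto
  then have "x = a" by simp
  then show ?thesis using x(2) by metis
qed

text \<open>
  Algebraic integers of \<open>KK\<close> have powers with bounded denominators. This property is visibly stable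
  under sums, products and conjugation, which replaces the ring structure of the algebraic integers.
\<close>

definition bounded_powers :: "real \<Rightarrow> bool" where
  "bounded_powers x \<longleftrightarrow> (\<exists>D::int. 0 < D \<and> (\<forall>k. of_int D * x ^ k \<in> Lat))"

lemma bounded_powers_mult:
  assumes "bounded_powers x" "bounded_powers y"
  shows "bounded_powers (x * y)"
proof -
  obtain D E :: int where D: "D > 0" "\<And>k. D * x ^ k \<in> Lat" and E: "E > 0" "\<And>k. E * y ^ k \<in> Lat"
    using assms unfolding bounded_powers_def by blast
  have "(D * E) * (x * y) ^ k \<in> Lat" for k
    using Lat_mult[OF D(2)[of k] E(2)[of k]] by (simp add: power_mult_distrib mult_ac)
  then show ?thesis unfolding bounded_powers_def using D(1) E(1) by (intro exI[of _ "D * E"]) simp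
qed

lemma bounded_powers_add:
  assumes "bounded_powers x" "bounded_powers y"
  shows "bounded_powers (x + y)"
proof -
  obtain D E :: int where D: "D > 0" "\<And>k. D * x ^ k \<in> Lat" and E: "E > 0" "\<And>k. E * y ^ k \<in> Lat"
    using assms unfolding bounded_powers_def by blast
  have "(D * E) * (x + y) ^ k \<in> Lat" for k
  proof -
    have "(D * E) * (x + y) ^ k = (\<Sum>i\<le>k. of_nat (k choose i) * ((D * x ^ i) * (E * y ^ (k - i))))"
      unfolding binomial_ring sum_distrib_left by (simp add: mult_ac)
    also have "\<dots> \<in> Lat" by (intro Lat_sum Lat_mult D E Lat_Ints) simp
    finally show ?thesis .
  qed
  then show ?thesis unfolding bounded_powers_def using D(1) E(1) by (intro exI[of _ "D * E"]) simp
qed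

lemma bounded_powers_Rats:
  assumes "bounded_powers x" "x \<in> \<rat>"
  shows "x \<in> \<int>"
proof -
  obtain D :: int where D: "D > 0" "\<And>k. D * x ^ k \<in> Lat" using assms(1) unfolding bounded_powers_def by blast
  obtain a b where ab: "b > 0" "coprime a b" "x = of_int a / of_int b" using assms(2) by (rule Rats_cases')
  have dvd: "b ^ k dvd D" for k
  proof -
    have "D * x ^ k \<in> \<int>" using Lat_Rats[OF D(2)] assms(2) by simp
    then obtain m where "D * x ^ k = of_int m" by (auto elim: Ints_cases)
    then have "real_of_int (D * a ^ k) = real_of_int (m * b ^ k)"
      using ab(1) by (simp add: ab(3) power_divide field_simps)
    then have "D * a ^ k = m * b ^ k" by linarith
    then have "b ^ k dvd D * a ^ k" by simp
    moreover have "coprime (b ^ k) (a ^ k)" using ab(2) by (simp add: coprime_commute)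
    ultimately show ?thesis by (simp add: coprime_dvd_mult_left_iff)
  qed
  \<comment> \<open>Every power of b divides the fixed D; with b >= 2 the exponent D would give 2^D
    <= D.\<close>
  have "b = 1"
  proof (rule ccontr)
    assume "b \<noteq> 1"
    then have "2 \<le> b" using ab(1) by simp
    then have "2 ^ nat D \<le> b ^ nat D" by (intro power_mono) simp_all
    also have "\<dots> \<le> D" using dvd D(1) by (intro zdvd_imp_le)
    finally have "(2::int) ^ nat D \<le> D" .
    moreover have "int (nat D) < 2 ^ nat D" by (metis of_nat_less_two_power)
    ultimately show False using D(1) by simp
  qed
  then show ?thesis by (simp add: ab(3))
qed

lemma common_denominator:
  assumes "\<And>i::nat. i < m \<Longrightarrow> y i \<in> KK"
  shows "\<exists>D::int. 0 < D \<and> (\<forall>i<m. of_int D * y i \<in> Lat)"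
  using assms
proof (induction m)
  case 0
  then show ?case by (auto intro: exI[of _ 1])
next
  case (Suc m)
  then obtain D :: int where D: "D > 0" "\<And>i. i < m \<Longrightarrow> D * y i \<in> Lat" by force
  have "y m \<in> KK" using Suc.prems by simp
  then obtain a b c d where y: "y m = lin 1 1 a b c d" and rat: "a \<in> \<rat>" "b \<in> \<rat>" "c \<in> \<rat>" "d \<in> \<rat>"
    unfolding KK_def by blast
  have den: "\<exists>E::int. 0 < E \<and> of_int E * x \<in> \<int>" if xr: "x \<in> \<rat>" for x :: real
  proof -
    obtain u v where "v > 0" "x = of_int u / of_int v" using xr by (rule Rats_cases')
    then show ?thesis by (intro exI[of _ v]) simp
  qed
  obtain e1 e2 e3 e4 :: int where e: "e1 > 0" "e2 > 0" "e3 > 0" "e4 > 0" "e1 * a \<in> \<int>" "e2 * b \<in> \<int>" "e3 * c \<in> \<int>" "e4 * d \<in> \<int>"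
    using den rat by metis
  define E where "E = e1 * e2 * e3 * e4"
  have "E * a = of_int (e2 * e3 * e4) * (e1 * a)" "E * b = of_int (e1 * e3 * e4) * (e2 * b)"
    "E * c = of_int (e1 * e2 * e4) * (e3 * c)" "E * d = of_int (e1 * e2 * e3) * (e4 * d)"
    by (simp_all add: E_def)
  then have "E * a \<in> \<int>" "E * b \<in> \<int>" "E * c \<in> \<int>" "E * d \<in> \<int>" using e by (metis Ints_mult Ints_of_int)+
  then have Ey: "E * y m \<in> Lat" unfolding y lin_scale by (intro Lat_I)
  have "(D * E) * y i \<in> Lat" if "i < Suc m" for i
  proof (cases "i = m")
    case True
    then show ?thesis using Lat_mult[OF Lat_Ints Ey, of D] by (simp add: mult_ac)
  next
    case False
    then show ?thesis using Lat_mult[OF Lat_Ints D(2), of E i] that by (simp add: mult_ac)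
  qed
  then show ?case using D(1) e unfolding E_def by (intro exI[of _ "D * (e1 * e2 * e3 * e4)"]) auto
qed

lemma KK_power: "x \<in> KK \<Longrightarrow> x ^ k \<in> KK"
proof (induction k)
  case 0
  then show ?case using KK_I[of 1 0 0 0] by (simp add: lin_def)
qed (simp add: KK_mult)

text \<open>The monic equation expresses every power of x from the m-th on as an integer combination
  of lower ones, so a common denominator of the first m powers serves for all.\<close>

lemma bounded_powers_algebraic_int:
  assumes "x \<in> KK" "algebraic_int x"
  shows "bounded_powers x"
proof -
  obtain P where P: "lead_coeff P = 1" "\<forall>i. coeff P i \<in> \<int>" "poly P x = 0"
    using assms(2) by (auto elim: algebraic_int.cases)
  define m where "m = degree P"
  have "poly P x = (\<Sum>i<m. coeff P i * x ^ i) + x ^ m"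
    using P(1) by (simp add: poly_altdef m_def lessThan_Suc_atMost[symmetric])
  then have xm: "x ^ m = - (\<Sum>i<m. coeff P i * x ^ i)" using P(3) by simp
  obtain D :: int where D: "D > 0" "\<And>i. i < m \<Longrightarrow> D * x ^ i \<in> Lat"
    using common_denominator[of m "\<lambda>i. x ^ i"] KK_power[OF assms(1)] by blast
  have "D * x ^ k \<in> Lat" for k
  proof (induction k rule: less_induct)
    case (less k)
    show ?case
    proof (cases "k < m")
      case False
      then have "x ^ k = x ^ (k - m) * x ^ m" by (simp flip: power_add)
      then have "D * x ^ k = (\<Sum>i<m. - coeff P i * (D * x ^ (k - m + i)))"
        unfolding xm by (simp add: sum_distrib_left sum_negf power_add mult_ac)
      also have "\<dots> \<in> Lat"
      proof (rule Lat_sum)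
        fix i assume "i \<in> {..<m}"
        then have "D * x ^ (k - m + i) \<in> Lat" using False by (intro less.IH) simp
        moreover have "- coeff P i \<in> \<int>" using P(2) by simp
        ultimately show "- coeff P i * (D * x ^ (k - m + i)) \<in> Lat" using Lat_mult[OF Lat_Ints] by blast
      qed
      finally show ?thesis .
    qed (use D in simp)
  qed
  then show ?thesis unfolding bounded_powers_def using D(1) by blast
qed

lemma lin_signs: "lin e f a b c d = lin 1 1 a (e * b) (f * c) (e * f * d)"
  by (simp add: lin_def)

text \<open>An embedding fixes D and maps \<open>Lat\<close> into itself, so the same denominator
  works for the conjugate.\<close>

lemma bounded_powers_conj:
  assumes "bounded_powers (lin 1 1 a b c d)" "a \<in> \<rat>" "b \<in> \<rat>" "c \<in> \<rat>" "d \<in> \<rat>" "e \<in> {1,-1}" "f \<in> {1,-1}"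
  shows "bounded_powers (lin e f a b c d)"
proof -
  define x where "x = lin 1 1 a b c d"
  have x: "x \<in> KK" unfolding x_def using assms by (intro KK_I)
  obtain \<sigma> where \<sigma>: "\<sigma> \<in> real_embeddings KK"
    "\<And>a b c d. a \<in> \<rat> \<Longrightarrow> b \<in> \<rat> \<Longrightarrow> c \<in> \<rat> \<Longrightarrow> d \<in> \<rat> \<Longrightarrow> \<sigma> (lin 1 1 a b c d) = lin e f a b c d"
    using lin_embedding[OF assms(6,7)] by blast
  obtain D :: int where D: "D > 0" "\<And>k. D * x ^ k \<in> Lat" using assms(1) unfolding bounded_powers_def x_def by blast
  have mult: "\<sigma> (u * v) = \<sigma> u * \<sigma> v" if "u \<in> KK" "v \<in> KK" for u v
    using \<sigma>(1) that by (auto simp: real_embeddings_iff)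
  have int: "\<sigma> (of_int k) = of_int k" "of_int k \<in> KK" for k
    using \<sigma>(2)[of "of_int k" 0 0 0] KK_I[of "of_int k" 0 0 0] by (simp_all add: lin_def)
  have pow: "\<sigma> (x ^ k) = \<sigma> x ^ k" for k
    by (induction k) (use int(1)[of 1] mult x KK_power in simp_all)
  have Lat: "\<sigma> u \<in> Lat" if u: "u \<in> Lat" for u
  proof -
    obtain a b c d where u: "u = lin 1 1 a b c d" "a \<in> \<int>" "b \<in> \<int>" "c \<in> \<int>" "d \<in> \<int>"
      using u unfolding Lat_def by blast
    have "e \<in> \<int>" "f \<in> \<int>" using assms by auto
    have R: "y \<in> \<rat>" if "y \<in> \<int>" for y :: real using that Ints_subset_Rats by blast
    have "\<sigma> u = lin e f a b c d" unfolding u(1) using u R by (intro \<sigma>(2))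
    then show ?thesis unfolding lin_signs[of e f] using u \<open>e \<in> \<int>\<close> \<open>f \<in> \<int>\<close> by (simp only:) (intro Lat_I Ints_mult)
  qed
  have "D * (\<sigma> x) ^ k \<in> Lat" for k
    using Lat[OF D(2)[of k]] by (simp add: mult int KK_power x pow)
  moreover have "\<sigma> x = lin e f a b c d" unfolding x_def using assms by (intro \<sigma>(2))
  ultimately show ?thesis unfolding bounded_powers_def using D(1) by metis
qed

text \<open>The trace 2u and the norm u^2 - x v^2 are rational with bounded powers, hence integers.
  Then x (2v)^2 is an integer, and squarefreeness of x makes 2v one.\<close>

lemma half_integers:
  fixes x :: int and w :: real
  assumes "bounded_powers (u + v * w)" "bounded_powers (u - v * w)" "u \<in> \<rat>" "v \<in> \<rat>" "w * w = x" "squarefree x"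
  obtains U V :: int where "u = U / 2" "v = V / 2" "4 dvd U ^ 2 - x * V ^ 2"
proof -
  have "bounded_powers (2 * u)" using bounded_powers_add[OF assms(1,2)] by simp
  then have "2 * u \<in> \<int>" using assms(3) by (intro bounded_powers_Rats) simp_all
  then obtain U where U: "2 * u = of_int U" by (auto elim: Ints_cases)
  have "(u + v * w) * (u - v * w) = u * u - x * (v * v)" unfolding assms(5)[symmetric] by (simp add: algebra_simps)
  then have "bounded_powers (u * u - x * (v * v))" using bounded_powers_mult[OF assms(1,2)] by simp
  then have "u * u - x * (v * v) \<in> \<int>" using assms(3,4) by (intro bounded_powers_Rats) simp_all
  then obtain M where M: "u * u - x * (v * v) = of_int M" by (auto elim: Ints_cases)
  have "x * ((2 * v) * (2 * v)) = of_int (U * U - 4 * M)"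
    unfolding of_int_diff of_int_mult U[symmetric] M[symmetric] by (simp add: algebra_simps)
  then have int: "x * ((2 * v) * (2 * v)) \<in> \<int>" by (simp only: Ints_of_int)
  have "2 * v \<in> \<rat>" by (intro Rats_mult Rats_number_of assms(4))
  from squarefree_mult_square_Ints[OF assms(6) this int] have "2 * v \<in> \<int>" .
  then obtain V where V: "2 * v = of_int V" by (auto elim: Ints_cases)
  have "real_of_int (U ^ 2 - x * V ^ 2) = 4 * (u * u - x * (v * v))"
    unfolding of_int_diff of_int_mult of_int_power U[symmetric] V[symmetric] by (simp add: power2_eq_square algebra_simps)
  also have "\<dots> = real_of_int (4 * M)" unfolding M by simp
  finally have "U ^ 2 - x * V ^ 2 = 4 * M" by linarith
  then have "4 dvd U ^ 2 - x * V ^ 2" by simp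
  then show ?thesis using U V by (intro that) simp_all
qed

text \<open>Over Z[\<theta>] with \<theta> = (1 + sqrt q) / 2 the element is a root of a monic
  quadratic formed from its relative trace and norm. Multiplying by the quadratic with 1 - \<theta>
  in place of \<theta> gives the integer quartic \<open>P\<close>.\<close>

lemma algebraic_int_emb: "algebraic_int (emb 1 1 x)"
proof -
  obtain a b c d where x: "x = (a, b, c, d)" by (metis prod_cases4)
  define y where "y = (a, -b, c, -d)"
  define x1 where "x1 = emb 1 1 x"
  define y1 where "y1 = emb 1 1 y"
  define \<theta> where "\<theta> = (1 + \<alpha> * \<gamma>) / 2"
  define S0 S1 W0 W1 where "S0 = 2 * a" and "S1 = 2 * c" and
    "W0 = a * a - (2 * n - 1) * (2 * n + 1) * (b * b) - 2 * ((2 * n + 1) * (n - 1) * (b * d)) + (n * n + n - 1) * (c * c) - n * (2 * n + 1) * (d * d)"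
    and "W1 = 2 * (a * c) - 2 * ((2 * n + 1) * (b * d)) + c * c - (2 * n + 1) * (d * d)"
  have 1: "x1 + y1 = S0 + S1 * \<theta>" by (simp add: x1_def y1_def x y_def S0_def S1_def lin_def \<theta>_def add_divide_distrib algebra_simps)
  have "x \<bullet> y = (W0, 0, W1, 0)" by (simp add: x y_def W0_def W1_def algebra_simps)
  then have 2: "x1 * y1 = W0 + W1 * \<theta>"
    using emb_mult[of 1 1 x y] by (simp add: x1_def y1_def lin_def \<theta>_def add_divide_distrib algebra_simps)
  define e where "e = n * n + n - 1"
  have \<theta>: "\<theta> * \<theta> = \<theta> + e"
  proof -
    have "(\<alpha> * \<gamma>) * (\<alpha> * \<gamma>) = (\<alpha> * \<alpha>) * (\<gamma> * \<gamma>)" by simp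
    then have "(\<alpha> * \<gamma>) * (\<alpha> * \<gamma>) = 4 * e + 1" unfolding \<alpha>_sq \<gamma>_sq by (simp add: e_def algebra_simps)
    then show ?thesis by (simp add: \<theta>_def field_simps)
  qed
  define P where "P = [: of_int (W0 * W0 + W0 * W1 - e * (W1 * W1)),
     - of_int (2 * (S0 * W0) + S0 * W1 + S1 * W0 - 2 * (e * (S1 * W1))),
     of_int (S0 * S0 + S0 * S1 - e * (S1 * S1) + 2 * W0 + W1), - of_int (2 * S0 + S1), (1::real) :]"
  have "poly P x1 = (x1 * x1 - (S0 + S1 * \<theta>) * x1 + (W0 + W1 * \<theta>)) * (x1 * x1 - (S0 + S1 * (1 - \<theta>)) * x1 + (W0 + W1 * (1 - \<theta>)))"
  proof -
    have "(x1 * x1 - (S0 + S1 * \<theta>) * x1 + (W0 + W1 * \<theta>)) * (x1 * x1 - (S0 + S1 * (1 - \<theta>)) * x1 + (W0 + W1 * (1 - \<theta>)))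
      = x1 * x1 * x1 * x1 - (2 * S0 + S1) * (x1 * x1 * x1) + (S0 * S0 + S0 * S1 + S1 * S1 * (\<theta> - \<theta> * \<theta>) + 2 * W0 + W1) * (x1 * x1)
       - (2 * S0 * W0 + S0 * W1 + S1 * W0 + 2 * S1 * W1 * (\<theta> - \<theta> * \<theta>)) * x1 + (W0 * W0 + W0 * W1 + W1 * W1 * (\<theta> - \<theta> * \<theta>))"
      by (simp add: algebra_simps)
    also have "\<theta> - \<theta> * \<theta> = - e" using \<theta> by simp
    finally show ?thesis by (simp add: P_def algebra_simps)
  qed
  also have "x1 * x1 - (S0 + S1 * \<theta>) * x1 + (W0 + W1 * \<theta>) = 0" unfolding 1[symmetric] 2[symmetric] by (simp add: algebra_simps)
  finally have "poly P x1 = 0" by simp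
  moreover have "lead_coeff P = 1" by (simp add: P_def)
  moreover have "\<forall>i. coeff P i \<in> \<int>" by (auto simp: P_def coeff_pCons split: nat.splits)
  ultimately show ?thesis unfolding x1_def[symmetric] by (intro algebraic_int.intros)
qed

lemma emb_KK: "emb 1 1 x \<in> KK"
  by (cases x) (auto intro!: KK_I)

end

locale squarefree_biquadratic = biquadratic +
  assumes squarefree_p: "squarefree p" and squarefree_q: "squarefree q" and squarefree_r: "squarefree r"
begin

text \<open>The traces to the three quadratic subfields bound the denominators by 4, congruences
  modulo 4 lower this to 2, and the relative norm to Q(sqrt q) yields the two parity conditions that
  define the integral basis.\<close>

lemma ring_of_integers_KK: "ring_of_integers KK = range (emb 1 1)"
proof
  show "range (emb 1 1) \<subseteq> ring_of_integers KK"
    using emb_KK algebraic_int_emb by (auto simp: ring_of_integers_def)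
  show "ring_of_integers KK \<subseteq> range (emb 1 1)"
  proof
    fix x assume "x \<in> ring_of_integers KK"
    then have xK: "x \<in> KK" and "algebraic_int x" by (simp_all add: ring_of_integers_def)
    then have "bounded_powers x" by (intro bounded_powers_algebraic_int)
    obtain a b c d where x: "x = lin 1 1 a b c d" and rat: "a \<in> \<rat>" "b \<in> \<rat>" "c \<in> \<rat>" "d \<in> \<rat>"
      using xK unfolding KK_def by blast
    define z where "z e f = lin e f a b c d" for e f
    have bp: "bounded_powers (z e f)" if "e \<in> {1,-1}" "f \<in> {1,-1}" for e f
      using bounded_powers_conj \<open>bounded_powers x\<close> rat that unfolding x z_def by blast
    have R: "2 * a \<in> \<rat>" "2 * b \<in> \<rat>" "2 * c \<in> \<rat>" "2 * d \<in> \<rat>" using rat by simp_all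
    have sq: "(\<alpha> * \<beta>) * (\<alpha> * \<beta>) = p" "(\<alpha> * \<gamma>) * (\<alpha> * \<gamma>) = q" "(\<beta> * \<gamma>) * (\<beta> * \<gamma>) = r"
      using n_ge by (simp_all add: p_def q_def r_def flip: sqrt_p sqrt_q sqrt_r)
    have "bounded_powers (2 * a + (2 * b) * (\<alpha> * \<beta>))" "bounded_powers (2 * a - (2 * b) * (\<alpha> * \<beta>))"
      using bounded_powers_add[OF bp[of 1 1] bp[of 1 "-1"]] bounded_powers_add[OF bp[of "-1" 1] bp[of "-1" "-1"]]
      by (simp_all add: z_def lin_def algebra_simps)
    from half_integers[OF this R(1,2) sq(1) squarefree_p]
    obtain A B :: int where AB: "2 * a = A / 2" "2 * b = B / 2" "4 dvd A ^ 2 - p * B ^ 2" .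
    have "bounded_powers (2 * a + (2 * c) * (\<alpha> * \<gamma>))" "bounded_powers (2 * a - (2 * c) * (\<alpha> * \<gamma>))"
      using bounded_powers_add[OF bp[of 1 1] bp[of "-1" 1]] bounded_powers_add[OF bp[of 1 "-1"] bp[of "-1" "-1"]]
      by (simp_all add: z_def lin_def algebra_simps)
    from half_integers[OF this R(1,3) sq(2) squarefree_q]
    obtain A1 C :: int where AC: "2 * a = A1 / 2" "2 * c = C / 2" "4 dvd A1 ^ 2 - q * C ^ 2" .
    have "bounded_powers (2 * a + (2 * d) * (\<beta> * \<gamma>))" "bounded_powers (2 * a - (2 * d) * (\<beta> * \<gamma>))"
      using bounded_powers_add[OF bp[of 1 1] bp[of "-1" "-1"]] bounded_powers_add[OF bp[of 1 "-1"] bp[of "-1" 1]]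
      by (simp_all add: z_def lin_def algebra_simps)
    from half_integers[OF this R(1,4) sq(3) squarefree_r]
    obtain A2 D :: int where AD: "2 * a = A2 / 2" "2 * d = D / 2" "4 dvd A2 ^ 2 - r * D ^ 2" .
    have A: "A1 = A" "A2 = A" using AB AC AD by simp_all
    \<comment> \<open>Since p = 4n^2 - 1, the norm condition modulo 4 is about A^2 + B^2; the same
      happens for r = 4 (n + 1)^2 - 1.\<close>
    have "A ^ 2 - p * B ^ 2 + 4 * (n * n * B ^ 2) = A ^ 2 + B ^ 2" by (simp add: p_def algebra_simps)
    then have "4 dvd A ^ 2 + B ^ 2" using AB(3) by (metis dvd_add dvd_triv_left)
    then have even: "even A" "even B" by (simp_all add: four_dvd_sum_squares)
    have "A ^ 2 - r * D ^ 2 + 4 * ((n + 1) * (n + 1) * D ^ 2) = A ^ 2 + D ^ 2" by (simp add: r_def algebra_simps)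
    then have "4 dvd A ^ 2 + D ^ 2" using AD(3) A by (metis dvd_add dvd_triv_left)
    then have "even D" by (simp add: four_dvd_sum_squares)
    have "odd q" by (simp add: q_def)
    have "even (A ^ 2 - q * C ^ 2)" using AC(3) A by (metis dvd_trans even_numeral)
    then have "even C" using even(1) \<open>odd q\<close> by simp
    obtain A' B' C' D' where half: "A = 2 * A'" "B = 2 * B'" "C = 2 * C'" "D = 2 * D'"
      using even \<open>even C\<close> \<open>even D\<close> by (elim evenE)
    have abcd: "a = A' / 2" "b = B' / 2" "c = C' / 2" "d = D' / 2"
      using AB AC AD half by simp_all
    \<comment> \<open>The traces alone leave a, b, c, d as arbitrary half-integers; u + v sqrt q is
      the relative norm, whose integrality gives the missing relations.\<close>
    define u where "u = a * a + q * (c * c) - p * (b * b) - r * (d * d)"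
    define v where "v = 2 * (a * c) - 2 * ((2 * n + 1) * (b * d))"
    have zz: "z e f * z (-e) f = lin e f u 0 v 0" if "e * e = 1" "f * f = 1" for e f
    proof -
      have "z (-e) f = lin e f a (-b) c (-d)" by (simp add: z_def lin_def)
      then show ?thesis unfolding z_def using lin_mult[OF that, of a b c d a "-b" c "-d"]
        by (simp add: u_def v_def algebra_simps)
    qed
    have "bounded_powers (u + v * (\<alpha> * \<gamma>))" "bounded_powers (u - v * (\<alpha> * \<gamma>))"
      using bounded_powers_mult[OF bp[of 1 1] bp[of "-1" 1]] bounded_powers_mult[OF bp[of 1 "-1"] bp[of "-1" "-1"]]
        zz[of 1 1] zz[of 1 "-1"] by (simp_all add: lin_def)
    moreover have "u \<in> \<rat>" "v \<in> \<rat>" using rat by (simp_all add: u_def v_def)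
    ultimately obtain U V :: int where UV: "u = U / 2" "v = V / 2" "4 dvd U ^ 2 - q * V ^ 2"
      by (rule half_integers[OF _ _ _ _ sq(2) squarefree_q])
    have "real_of_int (2 * U) = real_of_int (A' ^ 2 + q * C' ^ 2 - p * B' ^ 2 - r * D' ^ 2)"
      using UV(1) by (simp add: u_def abcd power2_eq_square field_simps)
    then have U: "2 * U = A' ^ 2 + q * C' ^ 2 - p * B' ^ 2 - r * D' ^ 2" by linarith
    have "real_of_int V = real_of_int (A' * C' - (2 * n + 1) * (B' * D'))"
      using UV(2) by (simp add: v_def abcd field_simps)
    then have V: "V = A' * C' - (2 * n + 1) * (B' * D')" by linarith
    have "even (U ^ 2 - q * V ^ 2)" using UV(3) by (metis dvd_trans even_numeral)
    then have "even (U - V)" using \<open>odd q\<close> by simp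
    then obtain w where "U - V = 2 * w" by (elim evenE)
    then have "2 * U - 2 * V = 4 * w" by simp
    \<comment> \<open>U and V have equal parity because q is odd. Modulo 4 the form 2U - 2V is a sum
      of two squares, which forces A' and C', and likewise B' and D', to agree modulo 2.\<close>
    moreover have "2 * U - 2 * V = (A' - C') ^ 2 + (B' + D') ^ 2 + 4 * ((n * n + n - 1) * C' ^ 2 - n * n * B' ^ 2 - (n + 1) * (n + 1) * D' ^ 2 + n * (B' * D'))"
      unfolding U V by (simp add: p_def q_def r_def power2_eq_square algebra_simps)
    ultimately have "(A' - C') ^ 2 + (B' + D') ^ 2 = 4 * (w - ((n * n + n - 1) * C' ^ 2 - n * n * B' ^ 2 - (n + 1) * (n + 1) * D' ^ 2 + n * (B' * D')))"
      by simp
    then have "4 dvd (A' - C') ^ 2 + (B' + D') ^ 2" by simp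
    then have "even (A' - C')" "even (B' - D')" using four_dvd_sum_squares[of "A' - C'" "B' + D'"] by simp_all
    then obtain a' b' where "A' - C' = 2 * a'" "B' - D' = 2 * b'" by (elim evenE)
    then have "A' = 2 * a' + C'" "B' = 2 * b' + D'" by simp_all
    then have "x = emb 1 1 (a', b', C', D')" by (simp add: x abcd add_divide_distrib)
    then show "x \<in> range (emb 1 1)" by blast
  qed
qed

lemma totally_positive_integers_KK: "totally_positive_integers KK = emb 1 1 ` {x. tp x}"
proof -
  have emb: "\<sigma> (emb 1 1 x) = emb e f x"
    if "\<And>a b c d. a \<in> \<rat> \<Longrightarrow> b \<in> \<rat> \<Longrightarrow> c \<in> \<rat> \<Longrightarrow> d \<in> \<rat> \<Longrightarrow> \<sigma> (lin 1 1 a b c d) = lin e f a b c d" for \<sigma> e f x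
    by (cases x) (simp add: that)
  have "(\<forall>\<sigma>\<in>real_embeddings KK. 0 < \<sigma> (emb 1 1 x)) \<longleftrightarrow> tp x" for x
  proof
    assume "tp x"
    show "\<forall>\<sigma>\<in>real_embeddings KK. 0 < \<sigma> (emb 1 1 x)"
    proof
      fix \<sigma> assume "\<sigma> \<in> real_embeddings KK"
      then obtain e f where "e \<in> {1,-1}" "f \<in> {1,-1}"
        "\<And>a b c d. a \<in> \<rat> \<Longrightarrow> b \<in> \<rat> \<Longrightarrow> c \<in> \<rat> \<Longrightarrow> d \<in> \<rat> \<Longrightarrow> \<sigma> (lin 1 1 a b c d) = lin e f a b c d"
        using embedding_of_lin by blast
      then show "0 < \<sigma> (emb 1 1 x)" using emb[of \<sigma> e f x] \<open>tp x\<close> by (auto simp: tp_def)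
    qed
  next
    assume *: "\<forall>\<sigma>\<in>real_embeddings KK. 0 < \<sigma> (emb 1 1 x)"
    show "tp x" unfolding tp_def
    proof (intro ballI)
      fix e f :: real assume "e \<in> {1,-1}" "f \<in> {1,-1}"
      then obtain \<sigma> where "\<sigma> \<in> real_embeddings KK"
        "\<And>a b c d. a \<in> \<rat> \<Longrightarrow> b \<in> \<rat> \<Longrightarrow> c \<in> \<rat> \<Longrightarrow> d \<in> \<rat> \<Longrightarrow> \<sigma> (lin 1 1 a b c d) = lin e f a b c d"
        using lin_embedding by blast
      then show "0 < emb e f x" using emb[of \<sigma> e f x] * by auto
    qed
  qed
  then show ?thesis unfolding totally_positive_integers_def ring_of_integers_KK by blast
qed

end

section \<open>The fundamental units\<close>

text \<open>Dividing a positive unit by the power of \<epsilon> whose exponent is the floor of its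
  logarithm lands in [1, \<epsilon>), where minimality leaves only 1. Another generator \<delta>
  satisfies \<epsilon> = \<delta> powi k with k >= 1, so \<delta> <= \<epsilon>, and minimality
  gives equality.\<close>

lemma fundamental_unit_eqI:
  assumes unit: "\<epsilon> \<in> integer_units F" and gt: "1 < \<epsilon>"
    and mult: "\<And>x y. x \<in> ring_of_integers F \<Longrightarrow> y \<in> ring_of_integers F \<Longrightarrow> x * y \<in> ring_of_integers F"
    and minus: "\<And>x. x \<in> ring_of_integers F \<Longrightarrow> - x \<in> ring_of_integers F"
    and min: "\<And>u. u \<in> integer_units F \<Longrightarrow> 1 < u \<Longrightarrow> \<epsilon> \<le> u"
  shows "fundamental_unit F = \<epsilon>"
proof -
  have U_mult: "x * y \<in> integer_units F" if x: "x \<in> integer_units F" and y: "y \<in> integer_units F" for x y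
  proof -
    obtain x' where x': "x' \<in> ring_of_integers F" "x * x' = 1" using x by (auto simp: integer_units_iff)
    obtain y' where y': "y' \<in> ring_of_integers F" "y * y' = 1" using y by (auto simp: integer_units_iff)
    have "(x * y) * (x' * y') = (x * x') * (y * y')" by simp
    then have "(x * y) * (x' * y') = 1" using x' y' by simp
    then show ?thesis using x y x' y' mult unfolding integer_units_iff by blast
  qed
  have U_minus: "- x \<in> integer_units F" if "x \<in> integer_units F" for x
    using that minus unfolding integer_units_iff by (metis minus_mult_minus)
  have U_inverse: "inverse x \<in> integer_units F" if "x \<in> integer_units F" for x
    using that unfolding integer_units_iff by (metis inverse_unique mult.commute)
  have U_power: "\<epsilon> ^ k \<in> integer_units F" for k
  proof (induction k)
    case 0
    have "\<epsilon> * inverse \<epsilon> = 1" using gt by simp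
    then show ?case using U_mult[OF unit U_inverse[OF unit]] by simp
  qed (use U_mult[OF unit] in simp)
  have U_powi: "\<epsilon> powi k \<in> integer_units F" for k
    using U_power U_inverse by (simp add: power_int_def power_inverse)
  have gen: "\<exists>k::int. u = \<epsilon> powi k" if u: "u \<in> integer_units F" "0 < u" for u
  proof -
    define k where "k = \<lfloor>log \<epsilon> u\<rfloor>"
    have "of_int k \<le> log \<epsilon> u" "log \<epsilon> u < of_int k + 1" by (simp_all add: k_def)
    then have "\<epsilon> powr of_int k \<le> u" "u < \<epsilon> powr (of_int k + 1)"
      using gt u(2) by (simp_all add: le_log_iff log_less_iff)
    then have le: "\<epsilon> powi k \<le> u" "u < \<epsilon> powi k * \<epsilon>"
      using gt by (simp_all add: powr_real_of_int' powr_add)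
    define w where "w = u * \<epsilon> powi (- k)"
    have pos: "0 < \<epsilon> powi k" using gt by simp
    have w: "w = u / \<epsilon> powi k" by (simp add: w_def power_int_minus divide_inverse)
    have "w \<in> integer_units F" unfolding w_def using U_mult u(1) U_powi by blast
    moreover have "1 \<le> w" "w < \<epsilon>" using le pos by (simp_all add: w field_simps)
    ultimately have "w = 1" using min[of w] by linarith
    then show ?thesis using pos by (auto simp: w)
  qed
  show ?thesis unfolding fundamental_unit_def
  proof (rule the_equality)
    show "\<epsilon> \<in> integer_units F \<and> 1 < \<epsilon> \<and> (\<forall>u\<in>integer_units F. \<exists>k::int. u = \<epsilon> powi k \<or> u = - (\<epsilon> powi k))"
    proof (intro conjI ballI unit gt)
      fix u assume u: "u \<in> integer_units F"
      have "u \<noteq> 0" using u by (auto simp: integer_units_iff)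
      then consider "0 < u" | "0 < - u" by linarith
      then show "\<exists>k::int. u = \<epsilon> powi k \<or> u = - (\<epsilon> powi k)"
      proof cases
        case 1
        then show ?thesis using gen u by blast
      next
        case 2
        then obtain k where "- u = \<epsilon> powi k" using gen[OF U_minus[OF u]] by blast
        then have "u = - (\<epsilon> powi k)" by simp
        then show ?thesis by blast
      qed
    qed
  next
    fix \<delta> assume \<delta>: "\<delta> \<in> integer_units F \<and> 1 < \<delta> \<and> (\<forall>u\<in>integer_units F. \<exists>k::int. u = \<delta> powi k \<or> u = - (\<delta> powi k))"
    then have "\<epsilon> \<le> \<delta>" using min by blast
    obtain k :: int where k: "\<epsilon> = \<delta> powi k \<or> \<epsilon> = - (\<delta> powi k)" using \<delta> unit by blast
    have "0 < \<delta> powi k" using \<delta> by simp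
    then have ek: "\<epsilon> = \<delta> powi k" using k gt by linarith
    have "1 \<le> k"
    proof (rule ccontr)
      assume "\<not> 1 \<le> k"
      then have "\<delta> powi k \<le> \<delta> powi 0" using \<delta> by (intro power_int_increasing) simp_all
      then show False using ek gt by simp
    qed
    then have "\<delta> powi 1 \<le> \<delta> powi k" using \<delta> by (intro power_int_increasing) simp_all
    then show "\<delta> = \<epsilon>" using ek \<open>\<epsilon> \<le> \<delta>\<close> by simp
  qed
qed

text \<open>The conjugate is smaller than 1 in absolute value, so adding it to the unit and
  subtracting it from the unit both give something positive.\<close>

lemma quadratic_unit_pos:
  fixes a b s :: real
  assumes "1 < a + b * s" "\<bar>(a + b * s) * (a - b * s)\<bar> = 1" "0 < s"
  shows "0 < a" "0 < b"
proof -
  define u where "u = a + b * s"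
  define u' where "u' = a - b * s"
  have "\<bar>u'\<bar> < 1"
  proof (rule ccontr)
    assume "\<not> ?thesis"
    then have "1 * 1 < \<bar>u\<bar> * \<bar>u'\<bar>" using assms(1) by (intro mult_less_le_imp_less) (simp_all add: u_def)
    then show False using assms(2) by (simp add: u_def u'_def abs_mult)
  qed
  then have "0 < 2 * a" "0 < 2 * (b * s)" using assms(1) unfolding u_def u'_def by linarith+
  then show "0 < a" "0 < b" using assms(3) by (simp_all add: zero_less_mult_iff)
qed

context squarefree_biquadratic
begin

lemma emb_as_lin: "lin 1 1 a b c d = emb 1 1 x \<Longrightarrow> a \<in> \<rat> \<Longrightarrow> b \<in> \<rat> \<Longrightarrow> c \<in> \<rat> \<Longrightarrow> d \<in> \<rat> \<Longrightarrow>
  \<exists>a' b' c' d'. x = (a', b', c', d') \<and> a = a' + c' / 2 \<and> b = b' + d' / 2 \<and> c = c' / 2 \<and> d = d' / 2"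
proof -
  assume *: "lin 1 1 a b c d = emb 1 1 x" "a \<in> \<rat>" "b \<in> \<rat>" "c \<in> \<rat>" "d \<in> \<rat>"
  obtain a' b' c' d' where x: "x = (a', b', c', d')" by (metis prod_cases4)
  have "lin 1 1 (a - (a' + c' / 2)) (b - (b' + d' / 2)) (c - c' / 2) (d - d' / 2) = 0"
    using *(1) by (simp add: x lin_def algebra_simps)
  then have "a - (a' + c' / 2) = 0 \<and> b - (b' + d' / 2) = 0 \<and> c - c' / 2 = 0 \<and> d - d' / 2 = 0"
    using *(2-) by (intro lin_eq_0) simp_all
  then show ?thesis using x by (intro exI[of _ a'] exI[of _ b'] exI[of _ c'] exI[of _ d']) simp
qed

lemma ring_of_integers_sub:
  assumes "x \<in> ring_of_integers F" "F \<subseteq> KK"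
  obtains y where "x = emb 1 1 y"
proof -
  have "x \<in> ring_of_integers KK" using assms by (auto simp: ring_of_integers_def)
  then show ?thesis using that unfolding ring_of_integers_KK by blast
qed

lemma sqrt_sq: "sqrt p * sqrt p = of_int p" "sqrt q * sqrt q = of_int q" "sqrt r * sqrt r = of_int r"
  using n_ge by (simp_all add: p_def q_def r_def)

lemma Q_p: "adjoin_rat {sqrt p} = {a + b * sqrt p |a b. a \<in> \<rat> \<and> b \<in> \<rat>}"
  and Q_q: "adjoin_rat {sqrt q} = {a + b * sqrt q |a b. a \<in> \<rat> \<and> b \<in> \<rat>}"
  and Q_r: "adjoin_rat {sqrt r} = {a + b * sqrt r |a b. a \<in> \<rat> \<and> b \<in> \<rat>}"
  by (rule adjoin_sqrt_eq sqrt_sq sqrt_p_irrational sqrt_q_irrational sqrt_r_irrational)+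

lemma sqrt_lower: "2 * n - 1 < sqrt p" "2 * n - 1 < sqrt q" "2 * n + 1 < sqrt r"
proof -
  have "(2 * n - 1) ^ 2 < p" "(2 * n - 1) ^ 2 < q" "(2 * n + 1) ^ 2 < r"
    using n_ge by (simp_all add: p_def q_def r_def power2_eq_square algebra_simps)
  then show "2 * n - 1 < sqrt p" "2 * n - 1 < sqrt q" "2 * n + 1 < sqrt r"
    by (metis of_int_less_iff of_int_power real_less_rsqrt)+
qed

lemma lin_sqrt: "a + b * sqrt p = lin 1 1 a b 0 0" "a + b * sqrt q = lin 1 1 a 0 b 0" "a + b * sqrt r = lin 1 1 a 0 0 b"
  by (simp_all add: lin_def sqrt_p sqrt_q sqrt_r)

lemma ring_of_integers_p: "ring_of_integers (adjoin_rat {sqrt p}) = {emb 1 1 (a, b, 0, 0) |a b. True}"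
proof
  show "{emb 1 1 (a, b, 0, 0) |a b. True} \<subseteq> ring_of_integers (adjoin_rat {sqrt p})"
  proof clarify
    fix a b :: int
    have "emb 1 1 (a, b, 0, 0) = of_int a + of_int b * sqrt p" by (simp add: lin_sqrt)
    then have "emb 1 1 (a, b, 0, 0) \<in> adjoin_rat {sqrt p}" unfolding Q_p
      by (metis (mono_tags, lifting) mem_Collect_eq Rats_of_int)
    then show "emb 1 1 (a, b, 0, 0) \<in> ring_of_integers (adjoin_rat {sqrt p})"
      unfolding ring_of_integers_def using algebraic_int_emb by blast
  qed
  show "ring_of_integers (adjoin_rat {sqrt p}) \<subseteq> {emb 1 1 (a, b, 0, 0) |a b. True}"
  proof
    fix x assume x: "x \<in> ring_of_integers (adjoin_rat {sqrt p})"
    then have "x \<in> adjoin_rat {sqrt p}" by (simp add: ring_of_integers_def)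
    then obtain a b where ab: "x = lin 1 1 a b 0 0" "a \<in> \<rat>" "b \<in> \<rat>" unfolding Q_p lin_sqrt by blast
    have "adjoin_rat {sqrt p} \<subseteq> KK" unfolding Q_p lin_sqrt using KK_I by auto
    then obtain y where y: "x = emb 1 1 y" using ring_of_integers_sub[OF x] by blast
    then have "lin 1 1 a b 0 0 = emb 1 1 y" using ab by simp
    from emb_as_lin[OF this ab(2,3)] obtain a' b' where "y = (a', b', 0, 0)" by auto
    then show "x \<in> {emb 1 1 (a, b, 0, 0) |a b. True}" using y by blast
  qed
qed

lemma ring_of_integers_q: "ring_of_integers (adjoin_rat {sqrt q}) = {emb 1 1 (a, 0, c, 0) |a c. True}"
proof
  show "{emb 1 1 (a, 0, c, 0) |a c. True} \<subseteq> ring_of_integers (adjoin_rat {sqrt q})"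
  proof clarify
    fix a c :: int
    have "emb 1 1 (a, 0, c, 0) = (of_int a + of_int c / 2) + of_int c / 2 * sqrt q" by (simp add: lin_def sqrt_q)
    moreover have "of_int a + of_int c / 2 \<in> \<rat>" "of_int c / 2 \<in> \<rat>" by simp_all
    ultimately have "emb 1 1 (a, 0, c, 0) \<in> adjoin_rat {sqrt q}" unfolding Q_q by blast
    then show "emb 1 1 (a, 0, c, 0) \<in> ring_of_integers (adjoin_rat {sqrt q})"
      unfolding ring_of_integers_def using algebraic_int_emb by blast
  qed
  show "ring_of_integers (adjoin_rat {sqrt q}) \<subseteq> {emb 1 1 (a, 0, c, 0) |a c. True}"
  proof
    fix x assume x: "x \<in> ring_of_integers (adjoin_rat {sqrt q})"
    then have "x \<in> adjoin_rat {sqrt q}" by (simp add: ring_of_integers_def)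
    then obtain a b where ab: "x = lin 1 1 a 0 b 0" "a \<in> \<rat>" "b \<in> \<rat>" unfolding Q_q lin_sqrt by blast
    have "adjoin_rat {sqrt q} \<subseteq> KK" unfolding Q_q lin_sqrt using KK_I by auto
    then obtain y where y: "x = emb 1 1 y" using ring_of_integers_sub[OF x] by blast
    then have "lin 1 1 a 0 b 0 = emb 1 1 y" using ab by simp
    from emb_as_lin[OF this ab(2) _ ab(3)] obtain a' c' where "y = (a', 0, c', 0)" by auto
    then show "x \<in> {emb 1 1 (a, 0, c, 0) |a c. True}" using y by blast
  qed
qed

lemma ring_of_integers_r: "ring_of_integers (adjoin_rat {sqrt r}) = {emb 1 1 (a, -b, 0, 2 * b) |a b. True}"
proof
  show "{emb 1 1 (a, -b, 0, 2 * b) |a b. True} \<subseteq> ring_of_integers (adjoin_rat {sqrt r})"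
  proof clarify
    fix a b :: int
    have "emb 1 1 (a, -b, 0, 2 * b) = of_int a + of_int b * sqrt r" by (simp add: lin_sqrt)
    then have "emb 1 1 (a, -b, 0, 2 * b) \<in> adjoin_rat {sqrt r}" unfolding Q_r
      by (metis (mono_tags, lifting) mem_Collect_eq Rats_of_int)
    then show "emb 1 1 (a, -b, 0, 2 * b) \<in> ring_of_integers (adjoin_rat {sqrt r})"
      unfolding ring_of_integers_def using algebraic_int_emb by blast
  qed
  show "ring_of_integers (adjoin_rat {sqrt r}) \<subseteq> {emb 1 1 (a, -b, 0, 2 * b) |a b. True}"
  proof
    fix x assume x: "x \<in> ring_of_integers (adjoin_rat {sqrt r})"
    then have "x \<in> adjoin_rat {sqrt r}" by (simp add: ring_of_integers_def)
    then obtain a b where ab: "x = lin 1 1 a 0 0 b" "a \<in> \<rat>" "b \<in> \<rat>" unfolding Q_r lin_sqrt by blast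
    have "adjoin_rat {sqrt r} \<subseteq> KK" unfolding Q_r lin_sqrt using KK_I by auto
    then obtain y where y: "x = emb 1 1 y" using ring_of_integers_sub[OF x] by blast
    then have "lin 1 1 a 0 0 b = emb 1 1 y" using ab by simp
    from emb_as_lin[OF this ab(2) _ _ ab(3)] obtain a' b' d' :: int where y': "y = (a', b', 0, d')" "b' + d' / 2 = 0" by auto
    then have "d' = 2 * (- b')" by linarith
    then have "y = (a', - (- b'), 0, 2 * (- b'))" using y' by simp
    then show "x \<in> {emb 1 1 (a, -b, 0, 2 * b) |a b. True}" using y by blast
  qed
qed

text \<open>\<open>cx\<close> and \<open>cy\<close> play the role of conjugates, k and l that of
  norms; then k l = 1 in the integers.\<close>

lemma norm_unit:
  assumes "x \<bullet> y = one" "x \<bullet> cx = (k, 0, 0, 0)" "y \<bullet> cy = (l, 0, 0, 0)" "cx \<bullet> cy = one"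
  shows "\<bar>k\<bar> = 1"
proof -
  have "(k, 0, 0, 0) \<bullet> (l, 0, 0, 0) = (x \<bullet> cx) \<bullet> (y \<bullet> cy)" using assms by simp
  also have "\<dots> = (x \<bullet> y) \<bullet> (cx \<bullet> cy)" by (metis qmult_assoc qmult_comm)
  finally have "k * l = 1" using assms by (simp add: one_def)
  then show ?thesis by (metis abs_mult abs_one zmult_eq_1_iff abs_minus_cancel)
qed

lemma emb_eq_one: "emb 1 1 x * emb 1 1 y = 1 \<longleftrightarrow> x \<bullet> y = one"
  by (simp add: emb_mult flip: emb_inj)

text \<open>A unit a + b sqrt p > 1 has a, b >= 1 and a^2 >= p b^2 - 1 >= p - 1 > (2n - 1)^2, so a
  >= 2n: both coefficients dominate those of \<open>EP\<close>. The proof for r has the same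
  shape.\<close>

lemma fundamental_unit_p: "fundamental_unit (adjoin_rat {sqrt p}) = emb 1 1 EP"
proof (rule fundamental_unit_eqI)
  have s: "0 < sqrt p" "2 * n - 1 < sqrt p"
    using n_ge sqrt_lower(1) by linarith+
  show "emb 1 1 EP \<in> integer_units (adjoin_rat {sqrt p})"
    unfolding integer_units_iff ring_of_integers_p using EP_inverse emb_eq_one[of EP EP'] unfolding EP_def EP'_def by blast
  have EP: "emb 1 1 EP = 2 * n + sqrt p" by (simp add: EP_def lin_def sqrt_p)
  then show "1 < emb 1 1 EP" using s n_ge by simp
  show "x * y \<in> ring_of_integers (adjoin_rat {sqrt p})"
    if "x \<in> ring_of_integers (adjoin_rat {sqrt p})" "y \<in> ring_of_integers (adjoin_rat {sqrt p})" for x y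
  proof -
    obtain a b a' b' where "x = emb 1 1 (a, b, 0, 0)" "y = emb 1 1 (a', b', 0, 0)" using \<open>x \<in> _\<close> \<open>y \<in> _\<close> unfolding ring_of_integers_p by blast
    then have "x * y = emb 1 1 ((a, b, 0, 0) \<bullet> (a', b', 0, 0))" by (simp only: emb_mult mult_1)
    then show ?thesis unfolding ring_of_integers_p qmult.simps by (auto simp del: emb.simps)
  qed
  show "- x \<in> ring_of_integers (adjoin_rat {sqrt p})" if x: "x \<in> ring_of_integers (adjoin_rat {sqrt p})" for x
  proof -
    obtain a b where "x = emb 1 1 (a, b, 0, 0)" using x unfolding ring_of_integers_p by blast
    then have "- x = emb 1 1 (-a, -b, 0, 0)" by (simp add: lin_def)
    then show ?thesis unfolding ring_of_integers_p by blast
  qed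
  show "emb 1 1 EP \<le> u" if unit: "u \<in> integer_units (adjoin_rat {sqrt p})" and gt: "1 < u" for u
  proof -
    obtain a b a' b' where u: "u = emb 1 1 (a, b, 0, 0)" and "emb 1 1 (a, b, 0, 0) * emb 1 1 (a', b', 0, 0) = 1"
      using unit unfolding integer_units_iff ring_of_integers_p by blast
    then have 1: "(a, b, 0, 0) \<bullet> (a', b', 0, 0) = one" by (simp add: emb_eq_one del: qmult.simps emb.simps)
    have "\<bar>a * a - p * (b * b)\<bar> = 1"
      by (rule norm_unit[OF 1, where cx = "(a, -b, 0, 0)" and l = "a' * a' - p * (b' * b')" and cy = "(a', -b', 0, 0)"])
         (use 1 in \<open>simp_all add: p_def one_def\<close>)
    moreover have u': "u = a + b * sqrt p" using u by (simp add: lin_def sqrt_p)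
    moreover have prod: "(a + b * sqrt p) * (a - b * sqrt p) = real_of_int (a * a - p * (b * b))"
      unfolding of_int_mult of_int_diff using sqrt_sq(1) by (simp add: algebra_simps)
    ultimately have "\<bar>(a + b * sqrt p) * (a - b * sqrt p)\<bar> = 1" by (metis of_int_1 of_int_abs)
    then have pos: "0 < a" "0 < b" using quadratic_unit_pos[of a b "sqrt p"] gt s unfolding u' by simp_all
    have "1 * 1 \<le> b * b" using pos by (intro mult_mono) simp_all
    then have "p * 1 \<le> p * (b * b)" using n_ge by (intro mult_left_mono) (simp_all add: p_def)
    then have "p - 1 \<le> a * a" using \<open>\<bar>a * a - p * (b * b)\<bar> = 1\<close> by linarith
    moreover have "(2 * n - 1) ^ 2 < p - 1" using n_ge by (simp add: p_def power2_eq_square algebra_simps)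
    ultimately have "(2 * n - 1) ^ 2 < a ^ 2" by (simp add: power2_eq_square)
    then have "2 * n - 1 < a" using pos by (auto dest: power_less_imp_less_base)
    then have "real_of_int (2 * n) \<le> a" "1 * sqrt p \<le> b * sqrt p" using pos s by (auto intro: mult_right_mono)
    then show ?thesis unfolding EP u' by linarith
  qed
qed

lemma fundamental_unit_r: "fundamental_unit (adjoin_rat {sqrt r}) = emb 1 1 ER"
proof (rule fundamental_unit_eqI)
  have s: "0 < sqrt r" "2 * n + 1 < sqrt r"
    using n_ge sqrt_lower(3) by linarith+
  have E: "ER = (2 * n + 2, - 1, 0, 2 * 1)" "ER' = (2 * n + 2, - (- 1), 0, 2 * (- 1))" by (simp_all add: ER_def ER'_def)
  show "emb 1 1 ER \<in> integer_units (adjoin_rat {sqrt r})"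
  proof -
    have "emb 1 1 ER \<in> {emb 1 1 (a, -b, 0, 2 * b) |a b. True}" unfolding E(1) by blast
    moreover have "emb 1 1 ER' \<in> {emb 1 1 (a, -b, 0, 2 * b) |a b. True}" unfolding E(2) by blast
    ultimately show ?thesis
      unfolding integer_units_iff ring_of_integers_r using ER_inverse emb_eq_one[of ER ER'] by blast
  qed
  have ER: "emb 1 1 ER = 2 * n + 2 + sqrt r" by (simp add: ER_def lin_def sqrt_r)
  then show "1 < emb 1 1 ER" using s n_ge by simp
  show "x * y \<in> ring_of_integers (adjoin_rat {sqrt r})"
    if "x \<in> ring_of_integers (adjoin_rat {sqrt r})" "y \<in> ring_of_integers (adjoin_rat {sqrt r})" for x y
  proof -
    obtain a b a' b' where "x = emb 1 1 (a, -b, 0, 2 * b)" "y = emb 1 1 (a', -b', 0, 2 * b')"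
      using \<open>x \<in> _\<close> \<open>y \<in> _\<close> unfolding ring_of_integers_r by blast
    then have "x * y = emb 1 1 ((a, -b, 0, 2 * b) \<bullet> (a', -b', 0, 2 * b'))" by (simp only: emb_mult mult_1)
    also have "(a, -b, 0, 2 * b) \<bullet> (a', -b', 0, 2 * b') = (a * a' + r * (b * b'), - (a * b' + b * a'), 0, 2 * (a * b' + b * a'))"
      by (simp add: r_def algebra_simps)
    finally show ?thesis unfolding ring_of_integers_r by blast
  qed
  show "- x \<in> ring_of_integers (adjoin_rat {sqrt r})" if x: "x \<in> ring_of_integers (adjoin_rat {sqrt r})" for x
  proof -
    obtain a b where "x = emb 1 1 (a, -b, 0, 2 * b)" using x unfolding ring_of_integers_r by blast
    then have "- x = emb 1 1 (-a, -(-b), 0, 2 * (-b))" by (simp add: lin_def)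
    then show ?thesis unfolding ring_of_integers_r by blast
  qed
  show "emb 1 1 ER \<le> u" if unit: "u \<in> integer_units (adjoin_rat {sqrt r})" and gt: "1 < u" for u
  proof -
    obtain a b a' b' where u: "u = emb 1 1 (a, -b, 0, 2 * b)" and "emb 1 1 (a, -b, 0, 2 * b) * emb 1 1 (a', -b', 0, 2 * b') = 1"
      using unit unfolding integer_units_iff ring_of_integers_r by blast
    then have 1: "(a, -b, 0, 2 * b) \<bullet> (a', -b', 0, 2 * b') = one" by (simp add: emb_eq_one del: qmult.simps emb.simps)
    have "\<bar>a * a - r * (b * b)\<bar> = 1"
      by (rule norm_unit[OF 1, where cx = "(a, b, 0, - 2 * b)" and l = "a' * a' - r * (b' * b')" and cy = "(a', b', 0, - 2 * b')"])
         (use 1 in \<open>simp_all add: r_def one_def algebra_simps\<close>)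
    moreover have u': "u = a + b * sqrt r" using u by (simp add: lin_def sqrt_r)
    moreover have prod: "(a + b * sqrt r) * (a - b * sqrt r) = real_of_int (a * a - r * (b * b))"
      unfolding of_int_mult of_int_diff using sqrt_sq(3) by (simp add: algebra_simps)
    ultimately have "\<bar>(a + b * sqrt r) * (a - b * sqrt r)\<bar> = 1" by (metis of_int_1 of_int_abs)
    then have pos: "0 < a" "0 < b" using quadratic_unit_pos[of a b "sqrt r"] gt s unfolding u' by simp_all
    have "1 * 1 \<le> b * b" using pos by (intro mult_mono) simp_all
    then have "r * 1 \<le> r * (b * b)" using n_ge by (intro mult_left_mono) (simp_all add: r_def)
    then have "r - 1 \<le> a * a" using \<open>\<bar>a * a - r * (b * b)\<bar> = 1\<close> by linarith
    moreover have "(2 * n + 1) ^ 2 < r - 1" using n_ge by (simp add: r_def power2_eq_square algebra_simps)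
    ultimately have "(2 * n + 1) ^ 2 < a ^ 2" by (simp add: power2_eq_square)
    then have "2 * n + 1 < a" using pos by (auto dest: power_less_imp_less_base)
    then have "real_of_int (2 * n + 2) \<le> a" "1 * sqrt r \<le> b * sqrt r" using pos s by (auto intro: mult_right_mono)
    then show ?thesis unfolding ER u' by linarith
  qed
qed

text \<open>Here halves occur: with A = 2a + b the norm equation reads A^2 - q b^2 = 4 or -4, and q
  - 4 > (2n)^2 gives A >= 2n + 1.\<close>

lemma fundamental_unit_q: "fundamental_unit (adjoin_rat {sqrt q}) = emb 1 1 EQ"
proof (rule fundamental_unit_eqI)
  have s: "0 < sqrt q" "2 * n - 1 < sqrt q"
    using n_ge sqrt_lower(2) by linarith+
  show "emb 1 1 EQ \<in> integer_units (adjoin_rat {sqrt q})"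
    unfolding integer_units_iff ring_of_integers_q using EQ_inverse emb_eq_one[of EQ EQ'] unfolding EQ_def EQ'_def by blast
  have EQ: "emb 1 1 EQ = (2 * n + 1) / 2 + sqrt q / 2" by (simp add: EQ_def lin_def sqrt_q)
  then show "1 < emb 1 1 EQ" using s n_ge by simp
  show "x * y \<in> ring_of_integers (adjoin_rat {sqrt q})"
    if "x \<in> ring_of_integers (adjoin_rat {sqrt q})" "y \<in> ring_of_integers (adjoin_rat {sqrt q})" for x y
  proof -
    obtain a b a' b' where "x = emb 1 1 (a, 0, b, 0)" "y = emb 1 1 (a', 0, b', 0)" using \<open>x \<in> _\<close> \<open>y \<in> _\<close> unfolding ring_of_integers_q by blast
    then have "x * y = emb 1 1 ((a, 0, b, 0) \<bullet> (a', 0, b', 0))" by (simp only: emb_mult mult_1)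
    then show ?thesis unfolding ring_of_integers_q qmult.simps by (auto simp del: emb.simps)
  qed
  show "- x \<in> ring_of_integers (adjoin_rat {sqrt q})" if x: "x \<in> ring_of_integers (adjoin_rat {sqrt q})" for x
  proof -
    obtain a b where "x = emb 1 1 (a, 0, b, 0)" using x unfolding ring_of_integers_q by blast
    then have "- x = emb 1 1 (-a, 0, -b, 0)" by (simp add: lin_def)
    then show ?thesis unfolding ring_of_integers_q by blast
  qed
  show "emb 1 1 EQ \<le> u" if unit: "u \<in> integer_units (adjoin_rat {sqrt q})" and gt: "1 < u" for u
  proof -
    obtain a b a' b' where u: "u = emb 1 1 (a, 0, b, 0)" and "emb 1 1 (a, 0, b, 0) * emb 1 1 (a', 0, b', 0) = 1"
      using unit unfolding integer_units_iff ring_of_integers_q by blast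
    then have 1: "(a, 0, b, 0) \<bullet> (a', 0, b', 0) = one" by (simp add: emb_eq_one del: qmult.simps emb.simps)
    have N: "\<bar>a * a + a * b - (n * n + n - 1) * (b * b)\<bar> = 1"
      by (rule norm_unit[OF 1, where cx = "(a + b, 0, -b, 0)" and l = "a' * a' + a' * b' - (n * n + n - 1) * (b' * b')" and cy = "(a' + b', 0, -b', 0)"])
         (use 1 in \<open>simp_all add: one_def algebra_simps\<close>)
    define A where "A = 2 * a + b"
    have A: "\<bar>A * A - q * (b * b)\<bar> = 4"
    proof -
      have "A * A - q * (b * b) = 4 * (a * a + a * b - (n * n + n - 1) * (b * b))"
        by (simp add: A_def q_def algebra_simps)
      then show ?thesis using N by (simp add: abs_mult)
    qed
    have u': "u = (A / 2) + (b / 2) * sqrt q" using u by (simp add: lin_def sqrt_q A_def add_divide_distrib)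
    have "(A / 2 + (b / 2) * sqrt q) * (A / 2 - (b / 2) * sqrt q) = (A * A - b * b * (sqrt q * sqrt q)) / 4"
      by (simp add: algebra_simps add_divide_distrib diff_divide_distrib)
    also have "\<dots> = real_of_int (A * A - q * (b * b)) / 4" unfolding sqrt_sq(2) by simp
    finally have prod: "(A / 2 + (b / 2) * sqrt q) * (A / 2 - (b / 2) * sqrt q) = real_of_int (A * A - q * (b * b)) / 4" .
    have "\<bar>real_of_int (A * A - q * (b * b)) / 4\<bar> = real_of_int \<bar>A * A - q * (b * b)\<bar> / 4" by simp
    also have "\<dots> = 1" unfolding A by simp
    finally have "\<bar>(A / 2 + (b / 2) * sqrt q) * (A / 2 - (b / 2) * sqrt q)\<bar> = 1" unfolding prod .
    then have pos: "0 < A" "0 < b" using quadratic_unit_pos[of "A / 2" "b / 2" "sqrt q"] gt s u' by simp_all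
    have "1 * 1 \<le> b * b" using pos by (intro mult_mono) simp_all
    then have "q * 1 \<le> q * (b * b)" using n_ge by (intro mult_left_mono) (simp_all add: q_def)
    then have "q - 4 \<le> A * A" using A by linarith
    moreover have "(2 * n) ^ 2 < q - 4" using n_ge by (simp add: q_def power2_eq_square algebra_simps)
    ultimately have "(2 * n) ^ 2 < A ^ 2" by (simp add: power2_eq_square)
    from power_less_imp_less_base[OF this] have "2 * n < A" using pos by simp
    then have "real_of_int (2 * n + 1) \<le> A" "1 * sqrt q \<le> b * sqrt q" using pos s by (auto intro: mult_right_mono)
    then show ?thesis unfolding EQ u' by simp
  qed
qed

section \<open>Relative norms and the fundamental box of the unit action\<close>

fun cjp :: "quad \<Rightarrow> quad" where "cjp (a, b, c, d) = (a + c, b + d, - c, - d)"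
fun cjq :: "quad \<Rightarrow> quad" where "cjq (a, b, c, d) = (a, - b, c, - d)"
fun cjr :: "quad \<Rightarrow> quad" where "cjr (a, b, c, d) = (a + c, - b - d, - c, d)"

lemma lin_minus_signs: "lin e (- f) a b c d = lin e f a b (- c) (- d)" "lin (- e) f a b c d = lin e f a (- b) c (- d)"
  by (simp_all add: lin_def)

text \<open>The three maps are the nontrivial automorphisms of the field, each named after the
  square root that it fixes.\<close>

lemma emb_cjp: "emb e f (cjp x) = emb e (- f) x"
  by (cases x) (simp add: lin_minus_signs add.commute)

lemma emb_cjq: "emb e f (cjq x) = emb (- e) f x"
  by (cases x) (simp add: lin_minus_signs add.commute)

lemma emb_cjr: "emb e f (cjr x) = emb (- e) (- f) x"
  by (cases x) (simp add: lin_minus_signs add.commute)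

text \<open>The relative norms are \<open>Pu + Pv\<surd>p\<close>, \<open>(Qu + Qv\<surd>q) / 2\<close> and \<open>Ru + Rv\<surd>r\<close>.\<close>

definition Pu :: "quad \<Rightarrow> int" where "Pu x = fst (x \<bullet> cjp x)"
definition Pv :: "quad \<Rightarrow> int" where "Pv x = fst (snd (x \<bullet> cjp x))"
definition Qu :: "quad \<Rightarrow> int" where "Qu x = 2 * fst (x \<bullet> cjq x) + fst (snd (snd (x \<bullet> cjq x)))"
definition Qv :: "quad \<Rightarrow> int" where "Qv x = fst (snd (snd (x \<bullet> cjq x)))"
definition Ru :: "quad \<Rightarrow> int" where "Ru x = fst (x \<bullet> cjr x)"
definition Rv :: "quad \<Rightarrow> int" where "Rv x = - fst (snd (x \<bullet> cjr x))"
lemmas UV_defs = Pu_def Pv_def Qu_def Qv_def Ru_def Rv_def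

lemma norm_form_p: "x \<bullet> cjp x = (Pu x, Pv x, 0, 0)"
  by (cases x) (simp add: UV_defs algebra_simps)

lemma norm_form_q: "x \<bullet> cjq x = (fst (x \<bullet> cjq x), 0, Qv x, 0)"
  by (cases x) (simp add: UV_defs algebra_simps)

lemma norm_form_r: "x \<bullet> cjr x = (Ru x, - Rv x, 0, 2 * Rv x)"
  by (cases x) (simp add: UV_defs algebra_simps)

lemma norm_p: "e * e = 1 \<Longrightarrow> f * f = 1 \<Longrightarrow> emb e f x * emb e (- f) x = Pu x + Pv x * (e * sqrt p)"
  using emb_mult[of e f x "cjp x"] unfolding emb_cjp norm_form_p by (simp add: lin_def sqrt_p)

lemma norm_q: "e * e = 1 \<Longrightarrow> f * f = 1 \<Longrightarrow> emb e f x * emb (- e) f x = Qu x / 2 + Qv x / 2 * (f * sqrt q)"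
proof -
  assume "e * e = 1" "f * f = 1"
  then have "emb e f x * emb (- e) f x = emb e f (fst (x \<bullet> cjq x), 0, Qv x, 0)"
    using emb_mult[of e f x "cjq x"] unfolding emb_cjq norm_form_q[symmetric] by simp
  also have "\<dots> = Qu x / 2 + Qv x / 2 * (f * sqrt q)"
    by (simp add: lin_def sqrt_q Qu_def Qv_def add_divide_distrib)
  finally show ?thesis .
qed

lemma norm_r: "e * e = 1 \<Longrightarrow> f * f = 1 \<Longrightarrow> emb e f x * emb (- e) (- f) x = Ru x + Rv x * (e * f * sqrt r)"
  using emb_mult[of e f x "cjr x"] unfolding emb_cjr norm_form_r by (simp add: lin_def sqrt_r)

text \<open>The four progressions of \<open>extra\<close>, shifted so that t is the parameter of the
  theorem: 2n + 1 comes from eps_p = \<open>mk 0 1 (- (2 * n + 1)) 1\<close>, and 1 from the inverse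
  of eps_q, which is \<open>mk 0 1 (-1) 0\<close>.\<close>

definition SA :: "int \<Rightarrow> quad" where "SA t = mk 1 1 (t - (2 * n + 1)) 0"
definition SB :: "int \<Rightarrow> quad" where "SB t = mk 1 1 (t - (2 * n + 1)) 1"
definition SC :: "int \<Rightarrow> quad" where "SC t = mk 1 1 (t - 1) (-1)"
definition SD :: "int \<Rightarrow> quad" where "SD t = mk 1 1 (t - 1) 0"

text \<open>This and the following tables give the relative norms as polynomials in n and t, the
  input of all box inequalities. The element \<open>mk 1 0 0 0\<close> stands in for
  \<open>HQ\<close>, being its multiple by \<open>EP\<close>.\<close>

lemma UV_one:
  "Pu (one) = 1"
  "Pv (one) = 0"
  "Qu (one) = 2"
  "Qv (one) = 0"
  "Ru (one) = 1"
  "Rv (one) = 0"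
  by (simp_all add: UV_defs one_def MU_def mk_def SA_def SB_def SC_def SD_def ES_def algebra_simps)

lemma UV_H1:
  "Pu (mk 1 0 0 0) = 4 * n * n + 2 * n"
  "Pv (mk 1 0 0 0) = 2 * n + 1"
  "Qu (mk 1 0 0 0) = 4 * n * n + 4 * n + 1"
  "Qv (mk 1 0 0 0) = 2 * n + 1"
  "Ru (mk 1 0 0 0) = 4 * n * n + 6 * n + 2"
  "Rv (mk 1 0 0 0) = 2 * n + 1"
  by (simp_all add: UV_defs one_def MU_def mk_def SA_def SB_def SC_def SD_def ES_def algebra_simps)

lemma UV_MU:
  "Pu (MU) = 2"
  "Pv (MU) = 0"
  "Qu (MU) = 4 * n + 2"
  "Qv (MU) = 2"
  "Ru (MU) = 4 * n + 4"
  "Rv (MU) = 2"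
  by (simp_all add: UV_defs one_def MU_def mk_def SA_def SB_def SC_def SD_def ES_def algebra_simps)

lemma UV_A:
  "Pu (SA t) = 8 * n * n * t + 8 * n * n - 2 * n * t * t + 4 * n * t + 4 * n"
  "Pv (SA t) = 4 * n * t + 4 * n - t * t + 2 * t + 2"
  "Qu (SA t) = 8 * n * t + 8 * n - 2 * t * t + 4 * t + 4"
  "Qv (SA t) = 0"
  "Ru (SA t) = 2 * n * t * t + 4 * n * t + 4 * n + 2 * t * t + 2 * t + 2"
  "Rv (SA t) = t * t + 2 * t"
  by (simp_all add: UV_defs one_def MU_def mk_def SA_def SB_def SC_def SD_def ES_def algebra_simps)

lemma UV_B:
  "Pu (SB t) = 16 * n * n * n + 4 * n * n * t + 28 * n * n - 2 * n * t * t + 2 * n * t + 2 * n - 3"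
  "Pv (SB t) = 8 * n * n + 2 * n * t + 14 * n - t * t + t + 2"
  "Qu (SB t) = 4 * n * n + 4 * n * t + 12 * n - 2 * t * t + 2 * t + 7"
  "Qv (SB t) = 2 * n - 2 * t + 1"
  "Ru (SB t) = 4 * n * n * t + 4 * n * n + 2 * n * t * t + 10 * n * t + 10 * n + 2 * t * t + 4 * t + 5"
  "Rv (SB t) = 2 * n * t + 2 * n + t * t + 3 * t + 2"
  by (simp_all add: UV_defs one_def MU_def mk_def SA_def SB_def SC_def SD_def ES_def algebra_simps)

lemma UV_C:
  "Pu (SC t) = 4 * n * n * t - 2 * n * t * t + 6 * n * t + 2 * n + 3"
  "Pv (SC t) = 2 * n * t - t * t + 3 * t"
  "Qu (SC t) = 4 * n * n + 4 * n * t + 8 * n - 2 * t * t + 6 * t + 3"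
  "Qv (SC t) = - 2 * n + 2 * t - 3"
  "Ru (SC t) = 4 * n * n * t + 2 * n * t * t + 6 * n * t + 2 * n + 2 * t * t + 3"
  "Rv (SC t) = 2 * n * t + t * t + t"
  by (simp_all add: UV_defs one_def MU_def mk_def SA_def SB_def SC_def SD_def ES_def algebra_simps)

lemma UV_D:
  "Pu (SD t) = 8 * n * n * n + 16 * n * n - 2 * n * t * t + 4 * n * t + 4 * n"
  "Pv (SD t) = 4 * n * n + 8 * n - t * t + 2 * t + 2"
  "Qu (SD t) = 8 * n * n + 16 * n - 2 * t * t + 4 * t + 4"
  "Qv (SD t) = 0"
  "Ru (SD t) = 8 * n * n * n + 8 * n * n * t + 16 * n * n + 2 * n * t * t + 12 * n * t + 8 * n + 2 * t * t + 2 * t + 2"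
  "Rv (SD t) = 4 * n * n + 4 * n * t + 4 * n + t * t + 2 * t"
  by (simp_all add: UV_defs one_def MU_def mk_def SA_def SB_def SC_def SD_def ES_def algebra_simps)

lemma UV_E:
  "Pu (ES t) = 8 * n * n * t + 4 * n * n - 4 * n * t * t + 4 * n * t + 2 * n"
  "Pv (ES t) = 4 * n * t + 2 * n - 2 * t * t + 2 * t + 1"
  "Qu (ES t) = 8 * n * n * t + 4 * n * n - 4 * n * t * t + 8 * n * t + 4 * n - 2 * t * t + 2 * t + 1"
  "Qv (ES t) = 4 * n * t + 2 * n - 2 * t * t + 2 * t + 1"
  "Ru (ES t) = 4 * n * n - 4 * n * t + 6 * n + 2 * t * t - 2 * t + 2"
  "Rv (ES t) = - 2 * n + 2 * t - 1"
  by (simp_all add: UV_defs one_def MU_def mk_def SA_def SB_def SC_def SD_def ES_def algebra_simps)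

text \<open>First logarithmic coordinate in [0, 1): since eps_p^2 = 8n^2 - 1 + 4n sqrt p, the strict
  inequality is the upper bound eps_p^4 for the ratio of the relative norm to its conjugate (see
  \<open>ratio_less\<close>).\<close>

lemma in_box_p:
  "s \<in> {one, mk 1 0 0 0, MU} \<Longrightarrow> 0 \<le> Pv s \<and> Pv s * (8 * n * n - 1) < Pu s * (4 * n)"
  "0 \<le> t \<Longrightarrow> t \<le> 2 * n - 1 \<Longrightarrow> s \<in> {SA t, SB t, SC t, SD t, ES t} \<Longrightarrow> 0 \<le> Pv s \<and> Pv s * (8 * n * n - 1) < Pu s * (4 * n)"
proof -
  show "0 \<le> Pv s \<and> Pv s * (8 * n * n - 1) < Pu s * (4 * n)" if "s \<in> {one, mk 1 0 0 0, MU}"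
    using that n_ge by (auto simp: UV_one UV_H1 UV_MU algebra_simps)
  assume t: "0 \<le> t" "t \<le> 2 * n - 1" and s: "s \<in> {SA t, SB t, SC t, SD t, ES t}"
  have "0 \<le> t * (2 * n - 1 - t)" "0 \<le> t * (n - 6)" "0 \<le> (n - 6) * (n - 6)"
    "0 \<le> (2 * n - 1 - t) * (n - 6)" "0 \<le> t * t" "0 \<le> (2 * n - 1 - t) * (2 * n - 1 - t)"
    using t n_ge by (intro mult_nonneg_nonneg; simp)+
  note f = this[unfolded ring_distribs]
  show "0 \<le> Pv s \<and> Pv s * (8 * n * n - 1) < Pu s * (4 * n)"
    using s t n_ge f by (auto simp: UV_A UV_B UV_C UV_D UV_E algebra_simps)
qed

text \<open>
  On \<open>G1\<close> the second logarithmic coordinate is exactly \<open>1/2\<close>, on \<open>G2\<close> it is less than \<open>1/2\<close> in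
  absolute value.
\<close>

definition G1 :: "quad set" where "G1 = {mk 1 0 0 0, MU} \<union> {ES t |t. 1 \<le> t \<and> t \<le> 2 * n - 1}"
definition G2 :: "quad set" where
  "G2 = insert one (\<Union>t\<in>{1..2 * n - 1}. {SA t, SB t, SC t, SD t})"

text \<open>Products of the linear constraints on t and n. Added to the context, they make the
  polynomial box inequalities linear in the monomials.\<close>

lemma products_nonneg:
  assumes "1 \<le> t" "t \<le> 2 * n - 1"
  shows "0 \<le> t * (2 * n - 1 - t)" "0 \<le> t * (n - 6)" "0 \<le> (n - 6) * (n - 6)"
    "0 \<le> (2 * n - 1 - t) * (n - 6)" "0 \<le> t * t" "0 \<le> (2 * n - 1 - t) * (2 * n - 1 - t)" "0 \<le> (t - 1) * (n - 6)"
    "0 \<le> (t - 1) * (2 * n - 1 - t)"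
  using assms n_ge by (intro mult_nonneg_nonneg; simp)+

text \<open>The equation says that the relative norm to Q(sqrt q) is the integer \<open>Qv s\<close>
  times eps_q. The bound on this integer will show that no element of \<open>G1\<close> is a
  unit.\<close>

lemma box_q1: assumes "s \<in> G1" shows "(2 * n + 1) * Qv s = Qu s \<and> 1 < Qv s"
proof -
  from assms consider "s \<in> {mk 1 0 0 0, MU}" | t where "s = ES t" "1 \<le> t" "t \<le> 2 * n - 1" unfolding G1_def by blast
  then show ?thesis
  proof cases
    case 1
    then show ?thesis using n_ge by (auto simp: UV_H1 UV_MU algebra_simps)
  next
    case 2
    note f = products_nonneg[OF 2(2,3), unfolded ring_distribs]
    show ?thesis using 2 n_ge f by (simp add: UV_E algebra_simps)
  qed
qed

lemma G2_cases:
  assumes "s \<in> G2"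
  obtains "s = one" | t where "1 \<le> t" "t \<le> 2 * n - 1" "s = SA t" | t where "1 \<le> t" "t \<le> 2 * n - 1" "s = SB t"
    | t where "1 \<le> t" "t \<le> 2 * n - 1" "s = SC t" | t where "1 \<le> t" "t \<le> 2 * n - 1" "s = SD t"
  using assms unfolding G2_def by fastforce

lemma box_p: assumes "s \<in> G1 \<union> G2" shows "0 \<le> Pv s \<and> Pv s * (8 * n * n - 1) < Pu s * (4 * n)"
proof (cases "s \<in> G1")
  case True
  then consider "s \<in> {mk 1 0 0 0, MU}" | t where "s = ES t" "1 \<le> t" "t \<le> 2 * n - 1" unfolding G1_def by blast
  then show ?thesis
  proof cases
    case 1
    then show ?thesis by (intro in_box_p(1)) simp
  next
    case 2
    then show ?thesis by (intro in_box_p(2)[of t]) simp_all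
  qed
next
  case False
  then have "s \<in> G2" using assms by simp
  then show ?thesis
  proof (cases rule: G2_cases)
    case 1
    then show ?thesis by (intro in_box_p(1)) simp
  next
    case (2 t)
    then show ?thesis by (intro in_box_p(2)[of t]) simp_all
  next
    case (3 t)
    then show ?thesis by (intro in_box_p(2)[of t]) simp_all
  next
    case (4 t)
    then show ?thesis by (intro in_box_p(2)[of t]) simp_all
  next
    case (5 t)
    then show ?thesis by (intro in_box_p(2)[of t]) simp_all
  qed
qed

text \<open>The two strict bounds place the second coordinate inside (-1/2, 1/2);
  \<open>2 < Qu s\<close> will exclude units other than 1.\<close>

lemma box_q2: assumes "s \<in> G2" shows "- Qu s < (2 * n + 1) * Qv s \<and> (2 * n + 1) * Qv s < Qu s \<and> (s = one \<or> 2 < Qu s)"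
  using assms
proof (cases rule: G2_cases)
  case 1
  then show ?thesis by (simp add: UV_one)
next
  case (2 t)
  note f = products_nonneg[OF 2(1,2), unfolded ring_distribs]
  show ?thesis using 2 n_ge f by (simp add: UV_A algebra_simps)
next
  case (3 t)
  note f = products_nonneg[OF 3(1,2), unfolded ring_distribs]
  show ?thesis using 3 n_ge f by (simp add: UV_B algebra_simps)
next
  case (4 t)
  note f = products_nonneg[OF 4(1,2), unfolded ring_distribs]
  show ?thesis using 4 n_ge f by (simp add: UV_C algebra_simps)
next
  case (5 t)
  note f = products_nonneg[OF 5(1,2), unfolded ring_distribs]
  show ?thesis using 5 n_ge f by (simp add: UV_D algebra_simps)
qed

text \<open>The third coordinate lies in (-1/2, 1/2] on \<open>G1\<close>, but in [0, 1) on
  \<open>G2\<close> by \<open>box_r2\<close>. Different windows are harmless because the second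
  coordinate separates the two groups.\<close>

lemma box_r1: assumes "s \<in> G1" shows "(2 * n + 2) * Rv s \<le> Ru s \<and> - Ru s < (2 * n + 2) * Rv s"
proof -
  from assms consider "s \<in> {mk 1 0 0 0, MU}" | t where "s = ES t" "1 \<le> t" "t \<le> 2 * n - 1" unfolding G1_def by blast
  then show ?thesis
  proof cases
    case 1
    then show ?thesis using n_ge by (auto simp: UV_H1 UV_MU algebra_simps intro!: add_pos_nonneg)
  next
    case 2
    note f = products_nonneg[OF 2(2,3), unfolded ring_distribs]
    show ?thesis using 2 n_ge f by (auto simp: UV_E algebra_simps intro!: add_pos_nonneg)
  qed
qed

lemma box_r2: assumes "s \<in> G2" shows "0 \<le> Rv s \<and> Rv s * (8 * (n + 1) * (n + 1) - 1) < Ru s * (4 * (n + 1))"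
  using assms
proof (cases rule: G2_cases)
  case 1
  then show ?thesis using n_ge by (simp add: UV_one)
next
  case (2 t)
  note f = products_nonneg[OF 2(1,2), unfolded ring_distribs]
  show ?thesis using 2 n_ge f by (simp add: UV_A algebra_simps)
next
  case (3 t)
  note f = products_nonneg[OF 3(1,2), unfolded ring_distribs]
  show ?thesis using 3 n_ge f by (simp add: UV_B algebra_simps)
next
  case (4 t)
  note f = products_nonneg[OF 4(1,2), unfolded ring_distribs]
  show ?thesis using 4 n_ge f by (simp add: UV_C algebra_simps)
next
  case (5 t)
  note f = products_nonneg[OF 5(1,2), unfolded ring_distribs]
  show ?thesis using 5 n_ge f by (simp add: UV_D algebra_simps)
qed

end

text \<open>After division by the unit W + Y w, whose inverse is W - Y w, the claim becomes (U + V
  w) (W - Y w) < (U - V w) (W + Y w), which is V W < U Y.\<close>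

lemma ratio_less:
  fixes U V W Y w :: real
  assumes "(W + Y * w) * (W - Y * w) = 1" "0 < W + Y * w" "0 < w" "V * W < U * Y"
  shows "U + V * w < (W + Y * w)\<^sup>2 * (U - V * w)"
proof -
  have "w * (V * W) < w * (U * Y)" using assms by simp
  then have "(U + V * w) * (W - Y * w) < (U - V * w) * (W + Y * w)" by (simp add: algebra_simps)
  then have "(U + V * w) * (W - Y * w) * (W + Y * w) < (U - V * w) * (W + Y * w) * (W + Y * w)"
    using assms(2) by simp
  moreover have "(U + V * w) * (W - Y * w) * (W + Y * w) = (U + V * w) * ((W + Y * w) * (W - Y * w))"
    by (simp only: mult_ac)
  ultimately have "U + V * w < (U - V * w) * (W + Y * w) * (W + Y * w)" unfolding assms(1) by simp
  also have "\<dots> = (W + Y * w)\<^sup>2 * (U - V * w)" by (simp only: power2_eq_square mult_ac)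
  finally show ?thesis .
qed

lemma ratio_le:
  fixes U V W Y w :: real
  assumes "(W + Y * w) * (W - Y * w) = 1" "0 < W + Y * w" "0 < w" "V * W \<le> U * Y"
  shows "U + V * w \<le> (W + Y * w)\<^sup>2 * (U - V * w)"
proof -
  have "w * (V * W) \<le> w * (U * Y)" using assms by simp
  then have "(U + V * w) * (W - Y * w) \<le> (U - V * w) * (W + Y * w)" by (simp add: algebra_simps)
  then have "(U + V * w) * (W - Y * w) * (W + Y * w) \<le> (U - V * w) * (W + Y * w) * (W + Y * w)"
    using assms(2) by simp
  moreover have "(U + V * w) * (W - Y * w) * (W + Y * w) = (U + V * w) * ((W + Y * w) * (W - Y * w))"
    by (simp only: mult_ac)
  ultimately have "U + V * w \<le> (U - V * w) * (W + Y * w) * (W + Y * w)" unfolding assms(1) by simp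
  also have "\<dots> = (W + Y * w)\<^sup>2 * (U - V * w)" by (simp only: power2_eq_square mult_ac)
  finally show ?thesis .
qed

text \<open>Both x / y and its translate a^4 x / y lie in [1, E^4), so their quotient a^4 lies
  strictly between E^(-4) and E^4. The next lemma does the same for the window (E^(-2),
  E^2].\<close>

lemma window_closed_open:
  fixes x y a E :: real
  assumes "0 < x" "0 < y" "0 < a" "1 < E" "y \<le> x" "x < E ^ 4 * y" "y / a\<^sup>2 \<le> a\<^sup>2 * x" "a\<^sup>2 * x < E ^ 4 * (y / a\<^sup>2)"
  shows "inverse E < a" "a < E"
proof -
  have a4: "a ^ 4 = a\<^sup>2 * a\<^sup>2" by (simp add: power4_eq_xxxx power2_eq_square)
  have "a ^ 4 * x < E ^ 4 * y" using assms(3,8) by (simp add: a4 field_simps power2_eq_square)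
  also have "\<dots> \<le> E ^ 4 * x" using assms by (intro mult_left_mono) simp_all
  finally have "a ^ 4 < E ^ 4" using assms(1) by simp
  from power_less_imp_less_base[OF this] show "a < E" using assms(4) by simp
  have "y \<le> a ^ 4 * x" using assms(3,7) by (simp add: a4 field_simps power2_eq_square)
  also have "\<dots> < a ^ 4 * (E ^ 4 * y)" using assms by (intro mult_strict_left_mono) simp_all
  finally have "1 ^ 4 < (a * E) ^ 4" using assms(2) by (simp add: power_mult_distrib mult.assoc[symmetric])
  from power_less_imp_less_base[OF this] have "1 < a * E" using assms(3,4) by simp
  then show "inverse E < a" using assms(4) by (simp add: field_simps)
qed

lemma window_open_closed:
  fixes x y a E :: real
  assumes "0 < x" "0 < y" "0 < a" "1 < E" "x \<le> E\<^sup>2 * y" "y < E\<^sup>2 * x" "a\<^sup>2 * x \<le> E\<^sup>2 * (y / a\<^sup>2)" "y / a\<^sup>2 < E\<^sup>2 * (a\<^sup>2 * x)"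
  shows "inverse E < a" "a < E"
proof -
  have a4: "b ^ 4 = b\<^sup>2 * b\<^sup>2" for b :: real by (simp add: power4_eq_xxxx power2_eq_square)
  have a2: "a\<^sup>2 > 0" using assms(3) by simp
  have "a\<^sup>2 * (a\<^sup>2 * x) \<le> a\<^sup>2 * (E\<^sup>2 * (y / a\<^sup>2))" using assms(7) a2 by (intro mult_left_mono) simp_all
  also have "\<dots> = E\<^sup>2 * y" using a2 by simp
  also have "\<dots> < E\<^sup>2 * (E\<^sup>2 * x)" using assms by (intro mult_strict_left_mono) simp_all
  finally have "a ^ 4 * x < E ^ 4 * x" unfolding a4 by (simp only: mult.assoc)
  then have "a ^ 4 < E ^ 4" using assms(1) by simp
  from power_less_imp_less_base[OF this] show "a < E" using assms(4) by simp
  have "y = a\<^sup>2 * (y / a\<^sup>2)" using a2 by simp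
  also have "\<dots> < a\<^sup>2 * (E\<^sup>2 * (a\<^sup>2 * x))" using assms(8) a2 by (intro mult_strict_left_mono)
  also have "\<dots> \<le> a\<^sup>2 * (E\<^sup>2 * (a\<^sup>2 * (E\<^sup>2 * y)))" using assms by (intro mult_left_mono) simp_all
  also have "\<dots> = (a * E) ^ 4 * y" unfolding a4 power_mult_distrib by (simp only: mult_ac)
  finally have "1 ^ 4 < (a * E) ^ 4" using assms(2) by simp
  from power_less_imp_less_base[OF this] have "1 < a * E" using assms(3,4) by simp
  then show "inverse E < a" using assms(4) by (simp add: field_simps)
qed

lemma powi_window:
  fixes E :: real
  assumes "1 < E" "inverse E < E powi i" "E powi i < E"
  shows "i = 0"
proof (rule ccontr)
  assume "i \<noteq> 0"
  then consider "1 \<le> i" | "i \<le> -1" by linarith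
  then show False
  proof cases
    case 1
    then have "E powi 1 \<le> E powi i" using assms(1) by (intro power_int_increasing) simp_all
    then show False using assms by simp
  next
    case 2
    then have "E powi i \<le> E powi (-1)" using assms(1) by (intro power_int_increasing) simp_all
    then show False using assms by (simp add: power_int_minus)
  qed
qed

section \<open>The action of \<open>V\<close> on the logarithmic coordinates\<close>

context squarefree_biquadratic
begin

lemma emb_E:
  "emb 1 (-1) EP = emb 1 1 EP" "emb (-1) 1 EP = inverse (emb 1 1 EP)" "emb (-1) (-1) EP = inverse (emb 1 1 EP)"
  "emb 1 (-1) EQ = inverse (emb 1 1 EQ)" "emb (-1) 1 EQ = emb 1 1 EQ" "emb (-1) (-1) EQ = inverse (emb 1 1 EQ)"
  "emb 1 (-1) ER = inverse (emb 1 1 ER)" "emb (-1) 1 ER = inverse (emb 1 1 ER)" "emb (-1) (-1) ER = emb 1 1 ER"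
  and inverse_E: "inverse (emb 1 1 EP) = emb 1 1 EP'" "inverse (emb 1 1 EQ) = emb 1 1 EQ'" "inverse (emb 1 1 ER) = emb 1 1 ER'"
proof -
  show inv: "inverse (emb 1 1 EP) = emb 1 1 EP'" "inverse (emb 1 1 EQ) = emb 1 1 EQ'" "inverse (emb 1 1 ER) = emb 1 1 ER'"
    using EP_inverse EQ_inverse ER_inverse unfolding emb_eq_one[symmetric] by (intro inverse_unique; simp)+
  show "emb 1 (-1) EP = emb 1 1 EP" "emb (-1) 1 EP = inverse (emb 1 1 EP)" "emb (-1) (-1) EP = inverse (emb 1 1 EP)"
    "emb 1 (-1) EQ = inverse (emb 1 1 EQ)" "emb (-1) 1 EQ = emb 1 1 EQ" "emb (-1) (-1) EQ = inverse (emb 1 1 EQ)"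
    "emb 1 (-1) ER = inverse (emb 1 1 ER)" "emb (-1) 1 ER = inverse (emb 1 1 ER)" "emb (-1) (-1) ER = emb 1 1 ER"
    unfolding inv by (simp_all add: E_defs lin_def)
qed

lemma emb_E_gt_1: "1 < emb 1 1 EP" "1 < emb 1 1 EQ" "1 < emb 1 1 ER"
proof -
  have e: "emb 1 1 EP = 2 * n + sqrt p" "emb 1 1 EQ = (2 * n + 1) / 2 + sqrt q / 2" "emb 1 1 ER = 2 * n + 2 + sqrt r"
    by (simp_all add: E_defs lin_def sqrt_p sqrt_q sqrt_r)
  have s: "0 < sqrt p" "0 < sqrt q" "0 < sqrt r" using sqrt_lower n_ge by linarith+
  have m: "12 \<le> real_of_int (2 * n)" "13 \<le> real_of_int (2 * n + 1)" "14 \<le> real_of_int (2 * n + 2)" using n_ge by simp_all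
  show "1 < emb 1 1 EP" unfolding e using s(1) m by linarith
  have "1 < x / 2 + y / 2" if "13 \<le> x" "0 < y" for x y :: real using that by linarith
  from this[OF m(2) s(2)] show "1 < emb 1 1 EQ" unfolding e .
  show "1 < emb 1 1 ER" unfolding e using s(3) m by linarith
qed

text \<open>Exponents together with all four conjugates: each of the three units is fixed by one
  nontrivial automorphism and inverted by the other two.\<close>

definition unit_form :: "quad \<Rightarrow> int \<Rightarrow> int \<Rightarrow> int \<Rightarrow> bool" where
  "unit_form v i j k \<longleftrightarrow> (let a = emb 1 1 EP powi i; b = emb 1 1 EQ powi j; c = emb 1 1 ER powi k in
     emb 1 1 v = a * b * c \<and> emb 1 (-1) v = a * inverse b * inverse c \<and>
     emb (-1) 1 v = inverse a * b * inverse c \<and> emb (-1) (-1) v = inverse a * inverse b * c)"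

lemma unit_form_mult:
  assumes "unit_form u i j k" "unit_form v i' j' k'"
  shows "unit_form (u \<bullet> v) (i + i') (j + j') (k + k')"
proof -
  have "emb 1 1 EP \<noteq> 0" "emb 1 1 EQ \<noteq> 0" "emb 1 1 ER \<noteq> 0" using emb_E_gt_1 by linarith+
  then show ?thesis
    using assms by (simp add: unit_form_def Let_def emb_mult power_int_add inverse_mult_distrib mult_ac del: emb.simps)
qed

lemma unit_form_E: "unit_form EP 1 0 0" "unit_form EP' (-1) 0 0" "unit_form EQ 0 1 0" "unit_form EQ' 0 (-1) 0"
  "unit_form ER 0 0 1" "unit_form ER' 0 0 (-1)" "unit_form one 0 0 0"
proof -
  show "unit_form EP 1 0 0" "unit_form EQ 0 1 0" "unit_form ER 0 0 1" "unit_form one 0 0 0"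
    by (simp_all add: unit_form_def emb_E del: emb.simps)
  have inv: "emb e f y = inverse (emb e f x)" if "x \<bullet> y = one" "e * e = 1" "f * f = 1" for x y e f
  proof -
    have "emb e f x * emb e f y = 1" using emb_mult[OF that(2,3), of x y] unfolding that(1) by simp
    then show ?thesis by (metis inverse_unique)
  qed
  show "unit_form EP' (-1) 0 0" "unit_form EQ' 0 (-1) 0" "unit_form ER' 0 0 (-1)"
    by (simp_all add: unit_form_def emb_E inv[OF EP_inverse] inv[OF EQ_inverse] inv[OF ER_inverse] power_int_minus del: emb.simps)
qed

lemma V_unit_form: "v \<in> V \<Longrightarrow> \<exists>i j k. unit_form v i j k"
proof (induction rule: V.induct)
  case V_one
  then show ?case using unit_form_E by blast
next
  case (V_mult u v)
  then obtain i j k where "unit_form v i j k" by blast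
  moreover have "\<exists>i j k. unit_form u i j k" using V_mult(1) unit_form_E by blast
  ultimately show ?case using unit_form_mult by blast
qed

lemma tp_norms_pos:
  assumes "tp s"
  shows "0 < Pu s + Pv s * sqrt p" "0 < Pu s - Pv s * sqrt p"
    "0 < Qu s / 2 + Qv s / 2 * sqrt q" "0 < Qu s / 2 - Qv s / 2 * sqrt q"
    "0 < Ru s + Rv s * sqrt r" "0 < Ru s - Rv s * sqrt r"
proof -
  have pos: "0 < emb 1 1 s" "0 < emb 1 (-1) s" "0 < emb (-1) 1 s" "0 < emb (-1) (-1) s" using assms unfolding tp_def by blast+
  show "0 < Pu s + Pv s * sqrt p" using norm_p[of 1 1 s] mult_pos_pos[OF pos(1,2)] by simp
  show "0 < Pu s - Pv s * sqrt p" using norm_p[of "-1" 1 s] mult_pos_pos[OF pos(3,4)] by simp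
  show "0 < Qu s / 2 + Qv s / 2 * sqrt q" using norm_q[of 1 1 s] mult_pos_pos[OF pos(1,3)] by simp
  show "0 < Qu s / 2 - Qv s / 2 * sqrt q" using norm_q[of 1 "-1" s] mult_pos_pos[OF pos(2,4)] by simp
  show "0 < Ru s + Rv s * sqrt r" using norm_r[of 1 1 s] mult_pos_pos[OF pos(1,4)] by simp
  show "0 < Ru s - Rv s * sqrt r" using norm_r[of 1 "-1" s] mult_pos_pos[OF pos(2,3)] by simp
qed

text \<open>In the norm to one quadratic subfield the powers of the two other units cancel and the
  third appears squared. The ratio of norm and conjugate is thus multiplied by a fourth power, so v
  translates the coordinate by its exponent.\<close>

lemma unit_form_norms:
  assumes "unit_form v i j k" "s' = v \<bullet> s"
  defines "a \<equiv> emb 1 1 EP powi i" and "b \<equiv> emb 1 1 EQ powi j" and "c \<equiv> emb 1 1 ER powi k"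
  shows "Pu s' + Pv s' * sqrt p = a\<^sup>2 * (Pu s + Pv s * sqrt p)" "Pu s' - Pv s' * sqrt p = (Pu s - Pv s * sqrt p) / a\<^sup>2"
    "Qu s' / 2 + Qv s' / 2 * sqrt q = b\<^sup>2 * (Qu s / 2 + Qv s / 2 * sqrt q)" "Qu s' / 2 - Qv s' / 2 * sqrt q = (Qu s / 2 - Qv s / 2 * sqrt q) / b\<^sup>2"
    "Ru s' + Rv s' * sqrt r = c\<^sup>2 * (Ru s + Rv s * sqrt r)" "Ru s' - Rv s' * sqrt r = (Ru s - Rv s * sqrt r) / c\<^sup>2"
proof -
  have abc: "a > 0" "b > 0" "c > 0" using emb_E_gt_1 by (simp_all add: a_def b_def c_def del: emb.simps)
  have v: "emb 1 1 v = a * b * c" "emb 1 (-1) v = a * inverse b * inverse c"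
     "emb (-1) 1 v = inverse a * b * inverse c" "emb (-1) (-1) v = inverse a * inverse b * c"
    using assms(1) unfolding unit_form_def Let_def a_def b_def c_def by blast+
  have s': "emb 1 1 s' = a * b * c * emb 1 1 s" "emb 1 (-1) s' = a * inverse b * inverse c * emb 1 (-1) s"
     "emb (-1) 1 s' = inverse a * b * inverse c * emb (-1) 1 s" "emb (-1) (-1) s' = inverse a * inverse b * c * emb (-1) (-1) s"
    unfolding assms(2) v[symmetric] by (rule emb_mult; simp)+
  note n1 = norm_p[of 1 1] norm_p[of "-1" 1] norm_q[of 1 1] norm_q[of 1 "-1"] norm_r[of 1 1] norm_r[of 1 "-1"]
  have P: "emb 1 1 x * emb 1 (-1) x = Pu x + Pv x * sqrt p" "emb (-1) 1 x * emb (-1) (-1) x = Pu x - Pv x * sqrt p" for x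
    using n1(1,2)[of x] by simp_all
  have Q: "emb 1 1 x * emb (-1) 1 x = Qu x / 2 + Qv x / 2 * sqrt q" "emb 1 (-1) x * emb (-1) (-1) x = Qu x / 2 - Qv x / 2 * sqrt q" for x
    using n1(3,4)[of x] by simp_all
  have R: "emb 1 1 x * emb (-1) (-1) x = Ru x + Rv x * sqrt r" "emb 1 (-1) x * emb (-1) 1 x = Ru x - Rv x * sqrt r" for x
    using n1(5,6)[of x] by simp_all
  show "Pu s' + Pv s' * sqrt p = a\<^sup>2 * (Pu s + Pv s * sqrt p)" "Pu s' - Pv s' * sqrt p = (Pu s - Pv s * sqrt p) / a\<^sup>2"
    unfolding P[symmetric] s' using abc by (simp_all add: power2_eq_square field_simps del: emb.simps)
  show "Qu s' / 2 + Qv s' / 2 * sqrt q = b\<^sup>2 * (Qu s / 2 + Qv s / 2 * sqrt q)" "Qu s' / 2 - Qv s' / 2 * sqrt q = (Qu s / 2 - Qv s / 2 * sqrt q) / b\<^sup>2"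
    unfolding Q[symmetric] s' using abc by (simp_all add: power2_eq_square field_simps del: emb.simps)
  show "Ru s' + Rv s' * sqrt r = c\<^sup>2 * (Ru s + Rv s * sqrt r)" "Ru s' - Rv s' * sqrt r = (Ru s - Rv s * sqrt r) / c\<^sup>2"
    unfolding R[symmetric] s' using abc by (simp_all add: power2_eq_square field_simps del: emb.simps)
qed

lemma E_forms:
  "emb 1 1 EP ^ 2 = (8 * n * n - 1) + 4 * n * sqrt p" "((8 * n * n - 1) + 4 * n * sqrt p) * ((8 * n * n - 1) - 4 * n * sqrt p) = 1"
  "emb 1 1 EQ = (2 * n + 1) / 2 + 1 / 2 * sqrt q" "((2 * n + 1) / 2 + 1 / 2 * sqrt q) * ((2 * n + 1) / 2 - 1 / 2 * sqrt q) = 1"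
  "emb 1 1 ER = (2 * n + 2) + 1 * sqrt r" "((2 * n + 2) + 1 * sqrt r) * ((2 * n + 2) - 1 * sqrt r) = 1"
  "emb 1 1 ER ^ 2 = (8 * (n + 1) * (n + 1) - 1) + 4 * (n + 1) * sqrt r"
  "((8 * (n + 1) * (n + 1) - 1) + 4 * (n + 1) * sqrt r) * ((8 * (n + 1) * (n + 1) - 1) - 4 * (n + 1) * sqrt r) = 1"
proof -
  have diff: "(W + Y * w) * (W - Y * w) = W * W - Y * Y * (w * w)" for W Y w :: real by (simp add: algebra_simps)
  show "emb 1 1 EQ = (2 * n + 1) / 2 + 1 / 2 * sqrt q" "emb 1 1 ER = (2 * n + 2) + 1 * sqrt r"
    by (simp_all add: E_defs lin_def sqrt_q sqrt_r)
  have "emb 1 1 EP ^ 2 = emb 1 1 (EP \<bullet> EP)" by (simp only: emb_mult[of 1 1, OF mult_1 mult_1] power2_eq_square)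
  also have "EP \<bullet> EP = (8 * n * n - 1, 4 * n, 0, 0)" by (simp add: EP_def algebra_simps)
  finally show "emb 1 1 EP ^ 2 = (8 * n * n - 1) + 4 * n * sqrt p" by (simp add: lin_def sqrt_p)
  have "emb 1 1 ER ^ 2 = emb 1 1 (ER \<bullet> ER)" by (simp only: emb_mult[of 1 1, OF mult_1 mult_1] power2_eq_square)
  also have "ER \<bullet> ER = (8 * (n + 1) * (n + 1) - 1, - (4 * (n + 1)), 0, 2 * (4 * (n + 1)))" by (simp add: ER_def algebra_simps)
  also have "emb 1 1 (u, - w, 0, 2 * w) = u + w * sqrt r" for u w by (simp add: lin_def sqrt_r)
  finally show "emb 1 1 ER ^ 2 = (8 * (n + 1) * (n + 1) - 1) + 4 * (n + 1) * sqrt r" by simp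
  show "((8 * n * n - 1) + 4 * n * sqrt p) * ((8 * n * n - 1) - 4 * n * sqrt p) = 1"
    unfolding diff sqrt_sq by (simp add: p_def algebra_simps)
  show "((2 * n + 1) / 2 + 1 / 2 * sqrt q) * ((2 * n + 1) / 2 - 1 / 2 * sqrt q) = 1"
  proof -
    have q: "real_of_int q = real_of_int (2 * n + 1) * real_of_int (2 * n + 1) - 4"
      by (simp add: q_def algebra_simps)
    have "x / 2 * (x / 2) - 1 / 2 * (1 / 2) * (x * x - 4) = 1" for x :: real by (simp add: algebra_simps)
    then show ?thesis unfolding diff sqrt_sq unfolding q .
  qed
  show "((2 * n + 2) + 1 * sqrt r) * ((2 * n + 2) - 1 * sqrt r) = 1"
    unfolding diff sqrt_sq by (simp add: r_def algebra_simps)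
  show "((8 * (n + 1) * (n + 1) - 1) + 4 * (n + 1) * sqrt r) * ((8 * (n + 1) * (n + 1) - 1) - 4 * (n + 1) * sqrt r) = 1"
    unfolding diff sqrt_sq by (simp add: r_def algebra_simps)
qed

lemma sqrt_pos: "0 < sqrt p" "0 < sqrt q" "0 < sqrt r"
  using sqrt_lower n_ge by linarith+

lemma ratio_p:
  assumes "s \<in> G1 \<union> G2"
  shows "Pu s - Pv s * sqrt p \<le> Pu s + Pv s * sqrt p" "Pu s + Pv s * sqrt p < emb 1 1 EP ^ 4 * (Pu s - Pv s * sqrt p)"
proof -
  have b: "0 \<le> Pv s" "Pv s * (8 * n * n - 1) < Pu s * (4 * n)" using box_p[OF assms] by simp_all
  then have "0 \<le> Pv s * sqrt p" using sqrt_pos by simp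
  then show "Pu s - Pv s * sqrt p \<le> Pu s + Pv s * sqrt p" by linarith
  have b': "real_of_int (Pv s) * real_of_int (8 * n * n - 1) < real_of_int (Pu s) * real_of_int (4 * n)"
    using b(2) by (metis of_int_less_iff of_int_mult)
  have "0 < emb 1 1 EP ^ 2" using emb_E_gt_1(1) by simp
  then have "Pu s + Pv s * sqrt p < (real_of_int (8 * n * n - 1) + 4 * n * sqrt p)\<^sup>2 * (Pu s - Pv s * sqrt p)"
    using b' E_forms(1,2) sqrt_pos by (intro ratio_less) simp_all
  also have "real_of_int (8 * n * n - 1) + 4 * n * sqrt p = emb 1 1 EP ^ 2" using E_forms(1) by simp
  also have "(emb 1 1 EP ^ 2)\<^sup>2 = emb 1 1 EP ^ 4" by (simp flip: power_mult)
  finally show "Pu s + Pv s * sqrt p < emb 1 1 EP ^ 4 * (Pu s - Pv s * sqrt p)" .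
qed

lemma ratio_q:
  assumes "s \<in> G1 \<union> G2"
  shows "Qu s / 2 + Qv s / 2 * sqrt q \<le> (emb 1 1 EQ)\<^sup>2 * (Qu s / 2 - Qv s / 2 * sqrt q)"
    "Qu s / 2 - Qv s / 2 * sqrt q < (emb 1 1 EQ)\<^sup>2 * (Qu s / 2 + Qv s / 2 * sqrt q)"
proof -
  have b: "(2 * n + 1) * Qv s \<le> Qu s" "- Qu s < (2 * n + 1) * Qv s"
  proof -
    have "0 < (2 * n + 1) * Qv s" if "s \<in> G1" using box_q1[OF that] n_ge by (intro mult_pos_pos) simp_all
    then have "(2 * n + 1) * Qv s \<le> Qu s \<and> - Qu s < (2 * n + 1) * Qv s"
      using assms box_q1[of s] box_q2[of s] by (cases "s \<in> G1") auto
    then show "(2 * n + 1) * Qv s \<le> Qu s" "- Qu s < (2 * n + 1) * Qv s" by simp_all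
  qed
  have b': "real_of_int (2 * n + 1) * Qv s \<le> real_of_int (Qu s)" "- real_of_int (Qu s) < real_of_int (2 * n + 1) * Qv s"
    using b by (metis of_int_le_iff of_int_mult, metis of_int_less_iff of_int_mult of_int_minus)
  have c: "y * x \<le> z \<Longrightarrow> x / 2 * (y / 2) \<le> z / 2 * (1 / 2)" "- z < y * x \<Longrightarrow> - x / 2 * (y / 2) < z / 2 * (1 / 2)" for x y z :: real
    by (simp_all add: mult.commute)
  have pos: "0 < (2 * n + 1) / 2 + 1 / 2 * sqrt q" using emb_E_gt_1(2) unfolding E_forms(3) by linarith
  show "Qu s / 2 + Qv s / 2 * sqrt q \<le> (emb 1 1 EQ)\<^sup>2 * (Qu s / 2 - Qv s / 2 * sqrt q)"
    unfolding E_forms(3) by (rule ratio_le[OF E_forms(4) pos sqrt_pos(2) c(1)[OF b'(1)]])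
  have "Qu s / 2 + (- real_of_int (Qv s) / 2) * sqrt q < (emb 1 1 EQ)\<^sup>2 * (Qu s / 2 - (- real_of_int (Qv s) / 2) * sqrt q)"
    unfolding E_forms(3) by (rule ratio_less[OF E_forms(4) pos sqrt_pos(2) c(2)[OF b'(2)]])
  then show "Qu s / 2 - Qv s / 2 * sqrt q < (emb 1 1 EQ)\<^sup>2 * (Qu s / 2 + Qv s / 2 * sqrt q)" by simp
qed

lemma ratio_r1:
  assumes "s \<in> G1"
  shows "Ru s + Rv s * sqrt r \<le> (emb 1 1 ER)\<^sup>2 * (Ru s - Rv s * sqrt r)"
    "Ru s - Rv s * sqrt r < (emb 1 1 ER)\<^sup>2 * (Ru s + Rv s * sqrt r)"
proof -
  have b: "(2 * n + 2) * Rv s \<le> Ru s" "- Ru s < (2 * n + 2) * Rv s" using box_r1[OF assms] by simp_all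
  have b': "real_of_int (2 * n + 2) * Rv s \<le> real_of_int (Ru s)" "- real_of_int (Ru s) < real_of_int (2 * n + 2) * Rv s"
    using b by (metis of_int_le_iff of_int_mult, metis of_int_less_iff of_int_mult of_int_minus)
  have c: "y * x \<le> z \<Longrightarrow> x * y \<le> z * 1" "- z < y * x \<Longrightarrow> - x * y < z * 1" for x y z :: real
    by (simp_all add: mult.commute)
  have pos: "0 < (2 * n + 2) + 1 * sqrt r" using emb_E_gt_1(3) unfolding E_forms(5) by linarith
  show "Ru s + Rv s * sqrt r \<le> (emb 1 1 ER)\<^sup>2 * (Ru s - Rv s * sqrt r)"
    unfolding E_forms(5) by (rule ratio_le[OF E_forms(6) pos sqrt_pos(3) c(1)[OF b'(1)]])
  have "Ru s + (- real_of_int (Rv s)) * sqrt r < (emb 1 1 ER)\<^sup>2 * (Ru s - (- real_of_int (Rv s)) * sqrt r)"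
    unfolding E_forms(5) by (rule ratio_less[OF E_forms(6) pos sqrt_pos(3) c(2)[OF b'(2)]])
  then show "Ru s - Rv s * sqrt r < (emb 1 1 ER)\<^sup>2 * (Ru s + Rv s * sqrt r)" by simp
qed

lemma ratio_r2:
  assumes "s \<in> G2"
  shows "Ru s - Rv s * sqrt r \<le> Ru s + Rv s * sqrt r" "Ru s + Rv s * sqrt r < emb 1 1 ER ^ 4 * (Ru s - Rv s * sqrt r)"
proof -
  have b: "0 \<le> Rv s" "Rv s * (8 * (n + 1) * (n + 1) - 1) < Ru s * (4 * (n + 1))" using box_r2[OF assms] by simp_all
  then have "0 \<le> Rv s * sqrt r" using sqrt_pos by simp
  then show "Ru s - Rv s * sqrt r \<le> Ru s + Rv s * sqrt r" by linarith
  have b': "real_of_int (Rv s) * real_of_int (8 * (n + 1) * (n + 1) - 1) < real_of_int (Ru s) * real_of_int (4 * (n + 1))"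
    using b(2) by (metis of_int_less_iff of_int_mult)
  have pos: "0 < real_of_int (8 * (n + 1) * (n + 1) - 1) + real_of_int (4 * (n + 1)) * sqrt r"
  proof -
    have "0 < emb 1 1 ER ^ 2" using emb_E_gt_1(3) by simp
    then show ?thesis using E_forms(7) by simp
  qed
  have "Ru s + Rv s * sqrt r < (real_of_int (8 * (n + 1) * (n + 1) - 1) + real_of_int (4 * (n + 1)) * sqrt r)\<^sup>2 * (Ru s - Rv s * sqrt r)"
    using E_forms(8) by (intro ratio_less[OF _ pos sqrt_pos(3) b']) simp
  also have "real_of_int (8 * (n + 1) * (n + 1) - 1) + real_of_int (4 * (n + 1)) * sqrt r = emb 1 1 ER ^ 2" using E_forms(7) by simp
  also have "(emb 1 1 ER ^ 2)\<^sup>2 = emb 1 1 ER ^ 4" by (simp flip: power_mult)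
  finally show "Ru s + Rv s * sqrt r < emb 1 1 ER ^ 4 * (Ru s - Rv s * sqrt r)" .
qed

text \<open>The first two coordinates give i = j = 0. With j = 0 the norms to Q(sqrt q) of s and s'
  coincide, so both lie in \<open>G1\<close> or both in \<open>G2\<close>; only then is there a
  common window for the third coordinate, which gives k = 0.\<close>

lemma V_multiple_trivial:
  assumes v: "v \<in> V" and s: "s \<in> G1 \<union> G2" "s' \<in> G1 \<union> G2" and tp: "tp s" and s': "s' = v \<bullet> s"
  shows "v = one"
proof -
  obtain i j k where uf: "unit_form v i j k" using V_unit_form[OF v] by blast
  define a where "a = emb 1 1 EP powi i"
  define b where "b = emb 1 1 EQ powi j"
  define c where "c = emb 1 1 ER powi k"
  have pos: "0 < a" "0 < b" "0 < c" using emb_E_gt_1 by (simp_all add: a_def b_def c_def del: emb.simps)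
  note nf = unit_form_norms[OF uf s', folded a_def b_def c_def]
  note np = tp_norms_pos[OF tp]
  have "inverse (emb 1 1 EP) < a" "a < emb 1 1 EP"
    using window_closed_open[OF np(1,2) pos(1) emb_E_gt_1(1) ratio_p[OF s(1)]] ratio_p[OF s(2), unfolded nf] by blast+
  then have i: "i = 0" using powi_window[OF emb_E_gt_1(1)] unfolding a_def by blast
  have "inverse (emb 1 1 EQ) < b" "b < emb 1 1 EQ"
    using window_open_closed[OF np(3,4) pos(2) emb_E_gt_1(2) ratio_q[OF s(1)]] ratio_q[OF s(2), unfolded nf] by blast+
  then have j: "j = 0" using powi_window[OF emb_E_gt_1(2)] unfolding b_def by blast
  then have "b = 1" by (simp add: b_def)
  have Q: "Qu s' = Qu s" "Qv s' = Qv s"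
  proof -
    have 1: "Qu s' / 2 + Qv s' / 2 * sqrt q = Qu s / 2 + Qv s / 2 * sqrt q" "Qu s' / 2 - Qv s' / 2 * sqrt q = Qu s / 2 - Qv s / 2 * sqrt q"
      using nf(3,4) \<open>b = 1\<close> by simp_all
    then have "real_of_int (Qu s') = Qu s" by linarith
    moreover have "Qv s' / 2 * sqrt q = Qv s / 2 * sqrt q" using 1 by linarith
    ultimately show "Qu s' = Qu s" "Qv s' = Qv s" using sqrt_pos(2) by simp_all
  qed
  have "s \<in> G1 \<and> s' \<in> G1 \<or> s \<in> G2 \<and> s' \<in> G2"
    using s box_q1[of s] box_q1[of s'] box_q2[of s] box_q2[of s'] unfolding Q by fastforce
  then have "inverse (emb 1 1 ER) < c \<and> c < emb 1 1 ER"
  proof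
    assume g: "s \<in> G1 \<and> s' \<in> G1"
    then show ?thesis
      using window_open_closed[OF np(5,6) pos(3) emb_E_gt_1(3) ratio_r1[of s]] ratio_r1[of s', unfolded nf] by blast
  next
    assume g: "s \<in> G2 \<and> s' \<in> G2"
    then show ?thesis
      using window_closed_open[OF np(5,6) pos(3) emb_E_gt_1(3) ratio_r2[of s]] ratio_r2[of s', unfolded nf] by blast
  qed
  then have k: "k = 0" using powi_window[OF emb_E_gt_1(3)] unfolding c_def by blast
  have "emb 1 1 v = 1" using uf unfolding unit_form_def Let_def i j k by simp
  then have "emb 1 1 v = emb 1 1 one" by simp
  then show ?thesis unfolding emb_inj .
qed

text \<open>For a unit, Qu^2 - q Qv^2 is 4 or -4. On \<open>G1\<close> it equals 4 Qv^2 with Qv > 1.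
  On \<open>G2\<close>, where |Qv| (2n + 1) < Qu, the identity q = (2n + 1)^2 - 4 makes it exceed 4
  unless s is 1.\<close>

lemma unit_in_groups:
  assumes s: "s \<in> G1 \<union> G2" and tp: "tp s" and unit: "s \<bullet> y = one"
  shows "s = one"
proof -
  have cj: "cjq s \<bullet> cjq y = one"
  proof -
    have "emb 1 1 (cjq s \<bullet> cjq y) = emb (-1) 1 (s \<bullet> y)" by (simp add: emb_mult emb_cjq del: emb.simps cjq.simps qmult.simps)
    then have "emb 1 1 (cjq s \<bullet> cjq y) = emb 1 1 one" unfolding unit by simp
    then show ?thesis unfolding emb_inj .
  qed
  define k where "k x = fst (x \<bullet> cjq x) * fst (x \<bullet> cjq x) + fst (x \<bullet> cjq x) * Qv x - (n * n + n - 1) * (Qv x * Qv x)" for x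
  define cc where "cc x = (fst (x \<bullet> cjq x) + Qv x, 0 :: int, - Qv x, 0 :: int)" for x
  have kk: "(x \<bullet> cjq x) \<bullet> cc x = (k x, 0, 0, 0)" for x
  proof -
    have "(w, 0, z, 0) \<bullet> (w + z, 0, - z, 0) = (w * w + w * z - (n * n + n - 1) * (z * z), 0, 0, 0)" for w z
      by (simp add: algebra_simps)
    then show ?thesis unfolding cc_def k_def by (subst norm_form_q) simp
  qed
  have ycc: "(s \<bullet> cjq s) \<bullet> (y \<bullet> cjq y) = one"
  proof -
    have "(s \<bullet> cjq s) \<bullet> (y \<bullet> cjq y) = (s \<bullet> y) \<bullet> (cjq s \<bullet> cjq y)" by (metis qmult_assoc qmult_comm)
    then show ?thesis by (simp add: unit cj del: qmult.simps cjq.simps)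
  qed
  have ccc: "cc s \<bullet> cc y = one"
  proof -
    have cce: "emb 1 1 (cc x) = emb 1 (-1) (x \<bullet> cjq x)" for x
      unfolding cc_def by (subst (2) norm_form_q) (simp add: lin_def algebra_simps)
    have "emb 1 1 (cc s \<bullet> cc y) = emb 1 (-1) ((s \<bullet> cjq s) \<bullet> (y \<bullet> cjq y))"
      by (simp add: emb_mult cce del: emb.simps qmult.simps cjq.simps)
    then have "emb 1 1 (cc s \<bullet> cc y) = emb 1 1 one" unfolding ycc by simp
    then show ?thesis unfolding emb_inj .
  qed
  have N: "\<bar>k s\<bar> = 1" by (rule norm_unit[OF ycc kk kk ccc])
  have k4: "Qu s * Qu s - q * (Qv s * Qv s) = 4 * k s"
    by (simp add: k_def Qu_def Qv_def q_def algebra_simps)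
  show ?thesis
  proof (rule ccontr)
    assume ne: "s \<noteq> one"
    show False
    proof (cases "s \<in> G1")
      case True
      then have b: "(2 * n + 1) * Qv s = Qu s" "1 < Qv s" using box_q1 by blast+
      have "4 * k s = 4 * (Qv s * Qv s)" unfolding k4[symmetric] b(1)[symmetric] by (simp add: q_def algebra_simps)
      then have "\<bar>Qv s * Qv s\<bar> = 1" using N by simp
      then show False using b(2) by (simp add: abs_mult) (metis abs_of_pos less_1_mult less_irrefl order.strict_trans zero_less_one)
    next
      case False
      then have b: "- Qu s < (2 * n + 1) * Qv s" "(2 * n + 1) * Qv s < Qu s" "2 < Qu s" using box_q2[of s] s ne by blast+
      define z where "z = \<bar>Qv s\<bar>"
      have z: "(2 * n + 1) * z + 1 \<le> Qu s" using b unfolding z_def by (auto simp: abs_if)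
      have zz: "Qv s * Qv s = z * z" by (simp add: z_def)
      have z0: "0 \<le> z" by (simp add: z_def)
      have le: "4 * k s \<le> 4" using N by linarith
      show False
      proof (cases "z = 0")
        case True
        then have "Qu s * Qu s \<le> 4" using k4 zz le by simp
        moreover have "3 * 3 \<le> Qu s * Qu s" using b(3) by (intro mult_mono) simp_all
        ultimately show False by simp
      next
        case False
        then have z1: "1 \<le> z" using z0 by simp
        have "((2 * n + 1) * z + 1) * ((2 * n + 1) * z + 1) \<le> Qu s * Qu s"
        proof -
          have "0 \<le> (2 * n + 1) * z" using z0 n_ge by simp
          with z show ?thesis by (intro mult_mono) linarith+
        qed
        then have "((2 * n + 1) * z + 1) * ((2 * n + 1) * z + 1) - q * (z * z) \<le> 4" using k4 zz le by simp
        moreover have "((2 * n + 1) * z + 1) * ((2 * n + 1) * z + 1) - q * (z * z) = 4 * (z * z) + 2 * ((2 * n + 1) * z) + 1"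
          by (simp add: q_def algebra_simps)
        moreover have "1 * 1 \<le> z * z" using z1 by (intro mult_mono) simp_all
        moreover have "0 \<le> (2 * n + 1) * z" using z0 n_ge by simp
        ultimately show False by linarith
      qed
    qed
  qed
qed

end

section \<open>The complete set of representatives\<close>

lemma iota_eq_card:
  assumes rel: "refl_on (indecomposables F) (indecomposable_rel F)" "sym (indecomposable_rel F)" "trans (indecomposable_rel F)"
    and complete: "complete_set_of_indecomposables F S"
  shows "iota F = card S"
proof -
  let ?R = "indecomposable_rel F" and ?I = "indecomposables F"
  have equiv: "equiv ?I ?R" using rel by (auto simp: equiv_def indecomposable_rel_def)
  have S: "S \<subseteq> ?I" "\<And>\<alpha>. \<alpha> \<in> ?I \<Longrightarrow> \<exists>!\<beta>. \<beta> \<in> S \<and> (\<alpha>, \<beta>) \<in> ?R"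
    using complete unfolding complete_set_of_indecomposables_def by blast+
  have "inj_on (\<lambda>s. ?R `` {s}) S"
  proof (rule inj_onI)
    fix s s' assume s: "s \<in> S" "s' \<in> S" "?R `` {s} = ?R `` {s'}"
    have "(s, s') \<in> ?R" using s S(1) by (intro eq_equiv_class[OF s(3) equiv]) auto
    moreover have "(s, s) \<in> ?R" using s S(1) rel(1) by (auto dest: refl_onD)
    ultimately show "s = s'" using S(2)[of s] s S(1) by blast
  qed
  moreover have "(\<lambda>s. ?R `` {s}) ` S = ?I // ?R"
  proof
    show "(\<lambda>s. ?R `` {s}) ` S \<subseteq> ?I // ?R" using S(1) by (auto intro: quotientI)
    show "?I // ?R \<subseteq> (\<lambda>s. ?R `` {s}) ` S"
    proof
      fix C assume "C \<in> ?I // ?R"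
      then obtain \<alpha> where \<alpha>: "\<alpha> \<in> ?I" "C = ?R `` {\<alpha>}" by (rule quotientE)
      then obtain \<beta> where "\<beta> \<in> S" "(\<alpha>, \<beta>) \<in> ?R" using S(2) by blast
      then show "C \<in> (\<lambda>s. ?R `` {s}) ` S" using equiv_class_eq[OF equiv] \<alpha> by blast
    qed
  qed
  ultimately show ?thesis unfolding iota_def by (metis card_image)
qed

context squarefree_biquadratic
begin

lemma reps_param: "reps = {one, HQ, MU} \<union> SA ` {3..2 * n - 2} \<union> SB ` {3..2 * n - 2} \<union> SC ` {4..2 * n - 1}
  \<union> SD ` {4..2 * n - 1} \<union> ES ` {2..2 * n - 1}"
proof -
  have "{mk 1 1 t j |t j. (t, j) \<in> extra (2 * n)} =
    SA ` {3..2 * n - 2} \<union> SB ` {3..2 * n - 2} \<union> SC ` {4..2 * n - 1} \<union> SD ` {4..2 * n - 1}" (is "?L = ?R")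
  proof
    show "?L \<subseteq> ?R"
    proof
      fix x assume "x \<in> ?L"
      then obtain t j where x: "x = mk 1 1 t j" "(t, j) \<in> extra (2 * n)" by blast
      from x(2) consider "j = 0" "3 \<le> t" "t \<le> 2 * n - 2" | "j = 0" "3 \<le> - t" "- t \<le> 2 * n - 2"
        | "j = -1" "3 \<le> t" "t \<le> 2 * n - 2" | "j = 1" "3 \<le> - t" "- t \<le> 2 * n - 2"
        by (auto simp: extra_def abs_if split: if_splits)
      then show "x \<in> ?R"
      proof cases
        case 1
        then have "x = SD (t + 1)" "t + 1 \<in> {4..2 * n - 1}" by (simp_all add: x SD_def)
        then show ?thesis by blast
      next
        case 2
        then have "x = SA (t + (2 * n + 1))" "t + (2 * n + 1) \<in> {3..2 * n - 2}" by (simp_all add: x SA_def)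
        then show ?thesis by blast
      next
        case 3
        then have "x = SC (t + 1)" "t + 1 \<in> {4..2 * n - 1}" by (simp_all add: x SC_def)
        then show ?thesis by blast
      next
        case 4
        then have "x = SB (t + (2 * n + 1))" "t + (2 * n + 1) \<in> {3..2 * n - 2}" by (simp_all add: x SB_def)
        then show ?thesis by blast
      qed
    qed
    have "(t - (2 * n + 1), 0) \<in> extra (2 * n)" "(t - (2 * n + 1), 1) \<in> extra (2 * n)" if "t \<in> {3..2 * n - 2}" for t
      using that by (auto simp: extra_def abs_if)
    moreover have "(t - 1, 0) \<in> extra (2 * n)" "(t - 1, -1) \<in> extra (2 * n)" if "t \<in> {4..2 * n - 1}" for t
      using that by (auto simp: extra_def abs_if)
    ultimately show "?R \<subseteq> ?L" unfolding SA_def SB_def SC_def SD_def by blast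
  qed
  moreover have "{ES t |t. 2 \<le> t \<and> t \<le> 2 * n - 1} = ES ` {2..2 * n - 1}" by auto
  ultimately show ?thesis unfolding reps_def by (simp only: Un_assoc)
qed

lemma reps_coords:
  "kc (SA t) = 1" "kc (SB t) = 1" "kc (SC t) = 1" "kc (SD t) = 1" "kc (ES t) = 0" "kc one = 0" "kc HQ = 0" "kc MU = 0"
  "jc (SA t) = 0" "jc (SB t) = 1" "jc (SC t) = -1" "jc (SD t) = 0" "jc (ES t) = t - (2 * n + 1)" "jc one = -1"
  "jc HQ = - (2 * n + 1)" "jc MU = -1"
  "tc (SA t) = t - (2 * n + 1)" "tc (SB t) = t - (2 * n + 1)" "tc (SC t) = t - 1" "tc (SD t) = t - 1"
  "tc (ES t) = t - (2 * n + 1)" "tc one = 0" "tc HQ = 2 * n + 1" "tc MU = 1"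
  by (simp_all add: SA_def SB_def SC_def SD_def ES_def one_def HQ_def MU_def algebra_simps)

text \<open>Three single elements, four families of 2n - 4 and one of 2n - 2. The lattice
  coordinates separate them: \<open>kc\<close> and \<open>jc\<close>, and the sign of
  \<open>tc\<close> where these two do not suffice.\<close>

lemma card_reps: "int (card reps) = 10 * n - 15"
proof -
  have inj: "inj_on SA A" "inj_on SB A" "inj_on ES A" for A
    by (rule inj_on_inverseI[where g = "\<lambda>x. tc x + (2 * n + 1)"]; simp add: reps_coords del: tc.simps)+
  have inj': "inj_on SC A" "inj_on SD A" for A
    by (rule inj_on_inverseI[where g = "\<lambda>x. tc x + 1"]; simp add: reps_coords del: tc.simps)+
  have card: "card (SA ` {3..2 * n - 2}) = nat (2 * n - 4)" "card (SB ` {3..2 * n - 2}) = nat (2 * n - 4)"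
    "card (SC ` {4..2 * n - 1}) = nat (2 * n - 4)" "card (SD ` {4..2 * n - 1}) = nat (2 * n - 4)"
    "card (ES ` {2..2 * n - 1}) = nat (2 * n - 2)"
    by (simp_all add: card_image inj inj')
  have three: "card {one, HQ, MU} = 3"
  proof -
    have "one \<noteq> HQ" "one \<noteq> MU" "HQ \<noteq> MU" using n_ge by (simp_all add: one_def HQ_def MU_def)
    then show ?thesis by simp
  qed
  have disjoint: "A \<inter> B = {}" if "\<forall>x\<in>A. \<not> P x" "\<forall>x\<in>B. P x" for A B :: "quad set" and P
    using that by blast
  have d1: "{one, HQ, MU} \<inter> SA ` {3..2 * n - 2} = {}"
    by (rule disjoint[of _ "\<lambda>x. kc x = 1"]) (use n_ge in \<open>simp_all add: ball_Un reps_coords del: kc.simps jc.simps tc.simps\<close>)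
  have d2: "({one, HQ, MU} \<union> SA ` {3..2 * n - 2}) \<inter> SB ` {3..2 * n - 2} = {}"
    by (rule disjoint[of _ "\<lambda>x. kc x = 1 \<and> jc x = 1"]) (use n_ge in \<open>simp_all add: ball_Un reps_coords del: kc.simps jc.simps tc.simps\<close>)
  have d3: "({one, HQ, MU} \<union> SA ` {3..2 * n - 2} \<union> SB ` {3..2 * n - 2}) \<inter> SC ` {4..2 * n - 1} = {}"
    by (rule disjoint[of _ "\<lambda>x. kc x = 1 \<and> jc x = -1"]) (use n_ge in \<open>simp_all add: ball_Un reps_coords del: kc.simps jc.simps tc.simps\<close>)
  have d4: "({one, HQ, MU} \<union> SA ` {3..2 * n - 2} \<union> SB ` {3..2 * n - 2} \<union> SC ` {4..2 * n - 1}) \<inter> SD ` {4..2 * n - 1} = {}"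
    by (rule disjoint[of _ "\<lambda>x. kc x = 1 \<and> jc x = 0 \<and> 0 < tc x"]) (use n_ge in \<open>simp_all add: ball_Un reps_coords del: kc.simps jc.simps tc.simps\<close>)
  have d5: "({one, HQ, MU} \<union> SA ` {3..2 * n - 2} \<union> SB ` {3..2 * n - 2} \<union> SC ` {4..2 * n - 1} \<union> SD ` {4..2 * n - 1}) \<inter> ES ` {2..2 * n - 1} = {}"
    by (rule disjoint[of _ "\<lambda>x. kc x = 0 \<and> tc x < 0"]) (use n_ge in \<open>simp_all add: ball_Un reps_coords del: kc.simps jc.simps tc.simps\<close>)
  have "card reps = 3 + nat (2 * n - 4) + nat (2 * n - 4) + nat (2 * n - 4) + nat (2 * n - 4) + nat (2 * n - 2)"
    unfolding reps_param using card three d1 d2 d3 d4 d5 by (simp only: card_Un_disjoint finite_Un finite_imageI finite_atLeastAtMost_int finite.intros)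
  then show ?thesis using n_ge by simp
qed

lemma totally_positive_units_KK:
  "\<eta> \<in> totally_positive_units KK \<longleftrightarrow> (\<exists>x y. \<eta> = emb 1 1 x \<and> tp x \<and> x \<bullet> y = one)"
proof
  assume "\<eta> \<in> totally_positive_units KK"
  then have "\<eta> \<in> integer_units KK" "\<eta> \<in> emb 1 1 ` {x. tp x}"
    by (simp_all add: totally_positive_units_def totally_positive_integers_KK)
  then obtain x y where xy: "\<eta> = emb 1 1 x" "tp x" "\<eta> * emb 1 1 y = 1"
    unfolding integer_units_iff ring_of_integers_KK by blast
  then have "x \<bullet> y = one" using emb_eq_one by blast
  then show "\<exists>x y. \<eta> = emb 1 1 x \<and> tp x \<and> x \<bullet> y = one" using xy by blast
next
  assume "\<exists>x y. \<eta> = emb 1 1 x \<and> tp x \<and> x \<bullet> y = one"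
  then obtain x y where xy: "\<eta> = emb 1 1 x" "tp x" "x \<bullet> y = one" by blast
  then have "\<eta> * emb 1 1 y = 1" using emb_eq_one by blast
  then have "\<eta> \<in> integer_units KK" unfolding integer_units_iff ring_of_integers_KK using xy(1) by blast
  moreover have "\<eta> \<in> totally_positive_integers KK" unfolding totally_positive_integers_KK using xy by blast
  ultimately show "\<eta> \<in> totally_positive_units KK" unfolding totally_positive_units_def by simp
qed

lemma indecomposables_KK: "indecomposables KK = emb 1 1 ` {x. indec x}"
proof -
  have aux: "{y \<in> g ` {x. T x}. \<not> Q y} = g ` {x. T x \<and> \<not> D x}" if "\<And>x. D x \<longleftrightarrow> Q (g x)"
    for g :: "quad \<Rightarrow> real" and T D Q using that by blast
  have dec: "decomposable x \<longleftrightarrow> (\<exists>\<beta>\<in>emb 1 1 ` {x. tp x}. \<exists>\<gamma>\<in>emb 1 1 ` {x. tp x}. emb 1 1 x = \<beta> + \<gamma>)" for x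
  proof
    assume "decomposable x"
    then obtain y z where "tp y" "tp z" "x = y + z" unfolding decomposable_def by blast
    then show "\<exists>\<beta>\<in>emb 1 1 ` {x. tp x}. \<exists>\<gamma>\<in>emb 1 1 ` {x. tp x}. emb 1 1 x = \<beta> + \<gamma>"
      using emb_add[of 1 1 y z] by blast
  next
    assume "\<exists>\<beta>\<in>emb 1 1 ` {x. tp x}. \<exists>\<gamma>\<in>emb 1 1 ` {x. tp x}. emb 1 1 x = \<beta> + \<gamma>"
    then obtain y z where yz: "tp y" "tp z" "emb 1 1 x = emb 1 1 y + emb 1 1 z" by blast
    then have "x = y + z" unfolding emb_add[symmetric] emb_inj by simp
    then show "decomposable x" using decomposableI yz by blast
  qed
  show ?thesis unfolding indecomposables_def totally_positive_integers_KK indec_def by (rule aux) (rule dec)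
qed

lemma tp_inverse:
  assumes "tp x" "x \<bullet> y = one"
  shows "tp y"
  unfolding tp_def
proof (intro ballI)
  fix e f :: real assume ef: "e \<in> {1,-1}" "f \<in> {1,-1}"
  then have "emb e f x * emb e f y = 1" using emb_mult[of e f x y] assms(2) by auto
  moreover have "0 < emb e f x" using assms(1) ef by (auto simp: tp_def)
  ultimately show "0 < emb e f y" by (metis zero_less_mult_pos zero_less_one)
qed

lemma indec_unit:
  assumes "tp x" "x \<bullet> y = one"
  shows "indec x"
proof -
  have y: "tp y" using tp_inverse[OF assms] .
  have "indec one" by (intro level_one_indec tp_one) (simp add: one_def)
  moreover have "decomposable one" if dec: "decomposable x"
  proof -
    obtain u v where uv: "tp u" "tp v" "x = u + v" using dec unfolding decomposable_def by blast
    have "one = y \<bullet> u + y \<bullet> v" using assms(2) uv(3) qmult_comm[of x y] qmult_distrib[of y u v] by simp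
    then show ?thesis using decomposableI tp_mult y uv by metis
  qed
  ultimately show ?thesis using assms(1) unfolding indec_def by blast
qed

lemma indec_mult_unit:
  assumes "tp x" "x \<bullet> y = one" "indec s"
  shows "indec (x \<bullet> s)"
proof -
  have y: "tp y" using tp_inverse[OF assms(1,2)] .
  have "y \<bullet> (x \<bullet> s) = s" using assms(2) by (metis qmult_assoc qmult_comm qmult_one(1))
  moreover have "decomposable (y \<bullet> (x \<bullet> s))" if "decomposable (x \<bullet> s)"
  proof -
    obtain u v where "tp u" "tp v" "x \<bullet> s = u + v" using \<open>decomposable (x \<bullet> s)\<close> unfolding decomposable_def by blast
    then show ?thesis using decomposableI tp_mult y qmult_distrib by metis
  qed
  ultimately show ?thesis using assms tp_mult unfolding indec_def by metis
qed

text \<open>The representative \<open>HQ\<close> is moved into the fundamental box of the unit action by \<open>EP\<close>.\<close>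

lemma reps_box:
  assumes "s \<in> reps"
  obtains u where "u \<in> {one, EP}" "u \<bullet> s \<in> G1 \<union> G2" "u = EP \<longleftrightarrow> s = HQ"
proof (cases "s = HQ")
  case True
  then have "EP \<bullet> s \<in> G1 \<union> G2" unfolding G1_def gens_hexagon(1)[symmetric] True by blast
  then show ?thesis using that True by blast
next
  case False
  have "s \<in> G1 \<union> G2"
    using assms False n_ge unfolding reps_param G1_def G2_def by (auto simp: image_iff)
  moreover have "one \<noteq> EP" using n_ge by (simp add: E_defs)
  ultimately show ?thesis using that[of one] False by simp
qed

lemma unit_in_V:
  assumes "tp x" "x \<bullet> y = one"
  shows "x \<in> V"
proof -
  have "x \<in> orbit reps" using indec_orbit[OF indec_unit[OF assms]] .
  then obtain v s where vs: "v \<in> V" "s \<in> reps" "x = v \<bullet> s" unfolding orbit_def by blast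
  obtain u where u: "u \<in> {one, EP}" "u \<bullet> s \<in> G1 \<union> G2" using reps_box[OF vs(2)] by blast
  have uV: "u \<in> V" using u(1) V_one V_gen by blast
  obtain w where w: "w \<in> V" "w \<bullet> u = one" using V_inverse[OF uV] .
  have "s \<bullet> (v \<bullet> y) = one" using assms(2) vs(3) by (metis qmult_assoc qmult_comm)
  then have "(u \<bullet> s) \<bullet> (w \<bullet> (v \<bullet> y)) = one" using w(2) by (metis qmult_assoc qmult_comm qmult_one(1))
  moreover have "tp (u \<bullet> s)" using V_tp[OF uV] indec_reps[OF vs(2)] tp_mult unfolding indec_def by blast
  ultimately have "u \<bullet> s = one" using unit_in_groups u(2) by blast
  then have "s = w" using w(2) by (metis qmult_assoc qmult_comm qmult_one(1))
  then show ?thesis using vs V_qmult w by blast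
qed

lemma reps_unique:
  assumes s: "s \<in> reps" "s' \<in> reps" and x: "tp x" "x \<bullet> y = one" and s': "s' = x \<bullet> s"
  shows "s = s'"
proof -
  obtain u where u: "u \<in> {one, EP}" "u \<bullet> s \<in> G1 \<union> G2" "u = EP \<longleftrightarrow> s = HQ" using reps_box[OF s(1)] .
  obtain u' where u': "u' \<in> {one, EP}" "u' \<bullet> s' \<in> G1 \<union> G2" "u' = EP \<longleftrightarrow> s' = HQ" using reps_box[OF s(2)] .
  have uV: "u \<in> V" "u' \<in> V" using u(1) u'(1) V_one V_gen by blast+
  obtain w where w: "w \<in> V" "w \<bullet> u = one" using V_inverse[OF uV(1)] .
  \<comment> \<open>v carries the box point u s to the box point u' s'. It lies in \<open>V\<close>
    because x does, by \<open>unit_in_V\<close>.\<close>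
  define v where "v = u' \<bullet> x \<bullet> w"
  have v: "v \<in> V" unfolding v_def using V_qmult uV unit_in_V[OF x] w by blast
  have "v \<bullet> (u \<bullet> s) = u' \<bullet> x \<bullet> (w \<bullet> u) \<bullet> s" unfolding v_def by (simp only: qmult_assoc)
  then have "u' \<bullet> s' = v \<bullet> (u \<bullet> s)" unfolding s' w(2) by (simp add: qmult_assoc)
  moreover have "tp (u \<bullet> s)" using V_tp[OF uV(1)] indec_reps[OF s(1)] tp_mult unfolding indec_def by blast
  ultimately have "v = one" using V_multiple_trivial[OF v u(2) u'(2)] by blast
  then have eq: "u' \<bullet> s' = u \<bullet> s" using \<open>u' \<bullet> s' = v \<bullet> (u \<bullet> s)\<close> by simp
  \<comment> \<open>If exactly one of s, s' were \<open>HQ\<close>, the other would have to be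
    \<open>EP \<bullet> HQ\<close>, whose coordinates \<open>kc\<close>, \<open>tc\<close>,
    \<open>jc\<close> all vanish; no representative has this property.\<close>
  have ne: "z \<noteq> EP \<bullet> HQ" if "z \<in> reps" for z
  proof
    assume "z = EP \<bullet> HQ"
    then have c: "kc z = 0" "tc z = 0" "jc z = 0" unfolding gens_hexagon(1)[symmetric] by (simp_all only: mk_coords)
    have "z = one \<or> z = HQ \<or> z = MU \<or> kc z = 1 \<or> tc z < 0"
      using that unfolding reps_param by (auto simp: reps_coords simp del: kc.simps tc.simps)
    then show False using c n_ge by (auto simp: reps_coords simp del: kc.simps tc.simps jc.simps)
  qed
  consider "u = u'" | "u = EP" "u' = one" | "u = one" "u' = EP" using u(1) u'(1) by blast
  then show ?thesis
  proof cases
    case 1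
    then have "s' = s" using eq w(2) by (metis qmult_assoc qmult_one(1))
    then show ?thesis by simp
  next
    case 2
    then have "s' = EP \<bullet> HQ" using eq u(3) by simp
    then show ?thesis using ne s(2) by blast
  next
    case 3
    then have "s = EP \<bullet> HQ" using eq u'(3) by simp
    then show ?thesis using ne s(1) by blast
  qed
qed

lemma indecomposable_rel_KK:
  "(\<zeta>, \<xi>) \<in> indecomposable_rel KK \<longleftrightarrow>
     (\<exists>s x y. \<zeta> = emb 1 1 s \<and> \<xi> = emb 1 1 (x \<bullet> s) \<and> indec s \<and> tp x \<and> x \<bullet> y = one)"
proof
  assume "(\<zeta>, \<xi>) \<in> indecomposable_rel KK"
  then obtain s x y where "\<zeta> = emb 1 1 s" "indec s" "tp x" "x \<bullet> y = one" "\<xi> = emb 1 1 x * \<zeta>"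
    unfolding indecomposable_rel_def indecomposables_KK by (auto simp: totally_positive_units_KK simp del: emb.simps)
  then show "\<exists>s x y. \<zeta> = emb 1 1 s \<and> \<xi> = emb 1 1 (x \<bullet> s) \<and> indec s \<and> tp x \<and> x \<bullet> y = one"
    using emb_mult[of 1 1 x s] by (metis mult_1)
next
  assume "\<exists>s x y. \<zeta> = emb 1 1 s \<and> \<xi> = emb 1 1 (x \<bullet> s) \<and> indec s \<and> tp x \<and> x \<bullet> y = one"
  then obtain s x y where h: "\<zeta> = emb 1 1 s" "\<xi> = emb 1 1 (x \<bullet> s)" "indec s" "tp x" "x \<bullet> y = one" by blast
  have "\<xi> = emb 1 1 x * \<zeta>" using h emb_mult[of 1 1 x s] by simp
  moreover have "emb 1 1 x \<in> totally_positive_units KK" unfolding totally_positive_units_KK using h by blast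
  moreover have "\<zeta> \<in> indecomposables KK" "\<xi> \<in> indecomposables KK"
    unfolding indecomposables_KK using h indec_mult_unit by blast+
  ultimately show "(\<zeta>, \<xi>) \<in> indecomposable_rel KK" unfolding indecomposable_rel_def by blast
qed

lemma equiv_indecomposable_rel:
  "refl_on (indecomposables KK) (indecomposable_rel KK)" "sym (indecomposable_rel KK)" "trans (indecomposable_rel KK)"
proof -
  have refl: "(emb 1 1 s, emb 1 1 s) \<in> indecomposable_rel KK" if "indec s" for s
    unfolding indecomposable_rel_KK using that tp_one
    by (intro exI[of _ s] exI[of _ one] conjI) simp_all
  show "refl_on (indecomposables KK) (indecomposable_rel KK)"
    using refl by (auto simp: refl_on_def indecomposables_KK simp del: emb.simps)
  show "sym (indecomposable_rel KK)"
  proof (rule symI)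
    fix \<alpha> \<beta> assume "(\<alpha>, \<beta>) \<in> indecomposable_rel KK"
    then obtain s x y where h: "\<alpha> = emb 1 1 s" "\<beta> = emb 1 1 (x \<bullet> s)" "indec s" "tp x" "x \<bullet> y = one"
      unfolding indecomposable_rel_KK by blast
    have "y \<bullet> (x \<bullet> s) = s" "y \<bullet> x = one" using h(5) by (metis qmult_assoc qmult_comm qmult_one(1))+
    then show "(\<beta>, \<alpha>) \<in> indecomposable_rel KK"
      unfolding indecomposable_rel_KK using h tp_inverse[OF h(4,5)] indec_mult_unit[OF h(4,5,3)]
      by (intro exI[of _ "x \<bullet> s"] exI[of _ y] exI[of _ x] conjI) simp_all
  qed
  show "trans (indecomposable_rel KK)"
  proof (rule transI)
    fix \<alpha> \<beta> \<gamma> assume "(\<alpha>, \<beta>) \<in> indecomposable_rel KK" "(\<beta>, \<gamma>) \<in> indecomposable_rel KK"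
    then obtain s x y s' x' y' where h: "\<alpha> = emb 1 1 s" "\<beta> = emb 1 1 (x \<bullet> s)" "indec s" "tp x" "x \<bullet> y = one"
      "\<beta> = emb 1 1 s'" "\<gamma> = emb 1 1 (x' \<bullet> s')" "tp x'" "x' \<bullet> y' = one"
      unfolding indecomposable_rel_KK by blast
    have "s' = x \<bullet> s" using h(2,6) emb_inj by metis
    then have "\<gamma> = emb 1 1 (x' \<bullet> x \<bullet> s)" using h by (simp only: qmult_assoc)
    moreover have "(x' \<bullet> x) \<bullet> (y' \<bullet> y) = (x' \<bullet> y') \<bullet> (x \<bullet> y)" by (metis qmult_assoc qmult_comm)
    then have "(x' \<bullet> x) \<bullet> (y' \<bullet> y) = one" using h by simp
    ultimately show "(\<alpha>, \<gamma>) \<in> indecomposable_rel KK"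
      unfolding indecomposable_rel_KK using h tp_mult[OF h(8,4)]
      by (intro exI[of _ s] exI[of _ "x' \<bullet> x"] exI[of _ "y' \<bullet> y"] conjI) simp_all
  qed
qed

lemma complete_reps: "complete_set_of_indecomposables KK (emb 1 1 ` reps)"
  unfolding complete_set_of_indecomposables_def
proof (intro conjI ballI)
  show "emb 1 1 ` reps \<subseteq> indecomposables KK" unfolding indecomposables_KK using indec_reps by blast
  fix \<alpha> assume "\<alpha> \<in> indecomposables KK"
  then obtain z where z: "\<alpha> = emb 1 1 z" "indec z" unfolding indecomposables_KK by blast
  then obtain v s where vs: "v \<in> V" "s \<in> reps" "z = v \<bullet> s" using indec_orbit[OF z(2)] unfolding orbit_def by blast
  obtain w where w: "w \<in> V" "w \<bullet> v = one" using V_inverse[OF vs(1)] .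
  have "w \<bullet> z = s" "w \<bullet> v = one" using vs(3) w(2) by (metis qmult_assoc qmult_one(1))+
  then have ex: "(\<alpha>, emb 1 1 s) \<in> indecomposable_rel KK"
    unfolding indecomposable_rel_KK using z V_tp[OF w(1)]
    by (intro exI[of _ z] exI[of _ w] exI[of _ v] conjI) simp_all
  show "\<exists>!\<beta>. \<beta> \<in> emb 1 1 ` reps \<and> (\<alpha>, \<beta>) \<in> indecomposable_rel KK"
  proof (rule ex1I[of _ "emb 1 1 s"])
    show "emb 1 1 s \<in> emb 1 1 ` reps \<and> (\<alpha>, emb 1 1 s) \<in> indecomposable_rel KK" using ex vs by blast
    fix \<beta> assume \<beta>: "\<beta> \<in> emb 1 1 ` reps \<and> (\<alpha>, \<beta>) \<in> indecomposable_rel KK"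
    then have "(emb 1 1 s, \<beta>) \<in> indecomposable_rel KK"
      using ex equiv_indecomposable_rel(2,3) by (meson symD transD)
    then obtain t x y where h: "emb 1 1 s = emb 1 1 t" "\<beta> = emb 1 1 (x \<bullet> t)" "tp x" "x \<bullet> y = one"
      unfolding indecomposable_rel_KK by blast
    obtain s' where s': "s' \<in> reps" "\<beta> = emb 1 1 s'" using \<beta> by blast
    have "t = s" "s' = x \<bullet> t" using h(1,2) s'(2) emb_inj by metis+
    then have "s = s'" using reps_unique[OF vs(2) s'(1) h(3,4)] by simp
    then show "\<beta> = emb 1 1 s" using s' by simp
  qed
qed

lemma iota_KK: "int (iota KK) = 10 * n - 15"
proof -
  have "iota KK = card (emb 1 1 ` reps)"
    by (rule iota_eq_card[OF equiv_indecomposable_rel complete_reps])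
  also have "\<dots> = card reps" by (intro card_image inj_onI) (simp add: emb_inj del: emb.simps)
  finally show ?thesis using card_reps by simp
qed

text \<open>The progressions of \<open>extra\<close> start at a sum of two known points and run in
  the direction \<mu> - 1, the image of \<open>mk 0 0 1 0\<close>; the last family runs in the
  direction \<mu> - 2. The halves in the formulas are handled by \<open>double\<close>, without
  division in the lattice.\<close>

lemma emb_reps:
  fixes \<epsilon>p \<epsilon>q \<epsilon>r \<mu> :: real
  assumes "\<epsilon>p = emb 1 1 EP" "\<epsilon>q = emb 1 1 EQ" "\<epsilon>r = emb 1 1 ER"
    and "\<mu> = (of_int n + 3 / 2) + 1 / 2 * sqrt p + 1 / 2 * sqrt q + 1 / 2 * sqrt r"
  shows "emb 1 1 HQ = (inverse \<epsilon>p + \<epsilon>r) / 2" "emb 1 1 MU = \<mu>"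
    "emb 1 1 (SA t) = 1 + \<epsilon>p + of_int t * (\<mu> - 1)"
    "emb 1 1 (SB t) = (1 + \<epsilon>p * \<epsilon>r) / 2 + \<epsilon>p + of_int t * (\<mu> - 1)"
    "emb 1 1 (SC t) = 1 + inverse \<epsilon>q + of_int t * (\<mu> - 1)"
    "emb 1 1 (SD t) = (1 + \<epsilon>r * \<epsilon>p) / 2 + inverse \<epsilon>q + of_int t * (\<mu> - 1)"
    "emb 1 1 (ES t) = (inverse \<epsilon>r + \<epsilon>p) / 2 + of_int t * (\<mu> - 2)"
proof -
  have W: "emb 1 1 (mk 0 0 1 0) = \<mu> - 1"
    unfolding assms(4) sqrt_p sqrt_q sqrt_r by (simp add: mk_def lin_def)
  have double: "emb 1 1 x = (emb 1 1 y + emb 1 1 z) / 2" if "x + x = y + z" for x y z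
  proof -
    have "2 * emb 1 1 x = emb 1 1 y + emb 1 1 z" using that emb_add[of 1 1 x x] emb_add[of 1 1 y z] by simp
    then show ?thesis by simp
  qed
  have inv: "inverse \<epsilon>p = emb 1 1 EP'" "inverse \<epsilon>q = emb 1 1 EQ'" "inverse \<epsilon>r = emb 1 1 ER'"
    unfolding assms by (rule inverse_E)+
  have prod: "\<epsilon>p * \<epsilon>r = emb 1 1 (EP \<bullet> ER)" "\<epsilon>r * \<epsilon>p = emb 1 1 (EP \<bullet> ER)"
    unfolding assms by (simp_all add: emb_mult mult.commute del: emb.simps)
  show "emb 1 1 HQ = (inverse \<epsilon>p + \<epsilon>r) / 2"
    unfolding inv assms(3) by (rule double) (simp add: HQ_def E_defs)
  show "emb 1 1 MU = \<mu>"
    unfolding assms(4) sqrt_p sqrt_q sqrt_r by (simp add: MU_def lin_def)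
  have h: "emb 1 1 (mk 1 0 0 0) = (1 + \<epsilon>p * \<epsilon>r) / 2"
  proof -
    have "emb 1 1 (mk 1 0 0 0) = (emb 1 1 one + emb 1 1 (EP \<bullet> ER)) / 2"
      by (rule double) (simp add: mk_def E_defs algebra_simps)
    then show ?thesis unfolding prod emb_one .
  qed
  have "emb 1 1 (mk a b (- (2 * n + 1)) c) = emb 1 1 (mk a (b - 1) 0 (c - 1)) + \<epsilon>p" for a b c
    unfolding assms(1) emb_add[symmetric] gens_thin(4)[symmetric] mk_add by simp
  note ep = this
  have "emb 1 1 (mk a b (- 1) c) = emb 1 1 (mk a (b - 1) 0 c) + inverse \<epsilon>q" for a b c
    unfolding inv emb_add[symmetric] gens_thin(3)[symmetric] mk_add by simp
  note eq = this
  have lin: "emb 1 1 (mk a b (t - u) c) = emb 1 1 (mk a b (- u) c) + of_int t * (\<mu> - 1)" for a b c u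
    using emb_mk[of 1 1 a b "t - u" c] emb_mk[of 1 1 a b "- u" c] unfolding W by (simp add: algebra_simps del: emb.simps)
  have one: "emb 1 1 (mk 1 0 0 (-1)) = 1" unfolding gens_hexagon(5) by simp
  show "emb 1 1 (SA t) = 1 + \<epsilon>p + of_int t * (\<mu> - 1)"
    unfolding SA_def using lin[of 1 1 "2 * n + 1" 0] ep[of 1 1 0] one by (simp del: emb.simps)
  show "emb 1 1 (SB t) = (1 + \<epsilon>p * \<epsilon>r) / 2 + \<epsilon>p + of_int t * (\<mu> - 1)"
    unfolding SB_def using lin[of 1 1 "2 * n + 1" 1] ep[of 1 1 1] h by (simp del: emb.simps)
  show "emb 1 1 (SC t) = 1 + inverse \<epsilon>q + of_int t * (\<mu> - 1)"
    unfolding SC_def using lin[of 1 1 1 "-1"] eq[of 1 1 "-1"] one by (simp del: emb.simps)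
  show "emb 1 1 (SD t) = (1 + \<epsilon>r * \<epsilon>p) / 2 + inverse \<epsilon>q + of_int t * (\<mu> - 1)"
    unfolding SD_def using lin[of 1 1 1 0] eq[of 1 1 0] h by (simp add: mult.commute del: emb.simps)
  have "ES t = ES 0 + (t, 0, 0, 0) \<bullet> (MU - one - one)"
    by (simp add: ES_def MU_def one_def algebra_simps)
  then have "emb 1 1 (ES t) = emb 1 1 (ES 0) + of_int t * (emb 1 1 MU - 1 - 1)"
    by (simp add: emb_add emb_mult emb_diff emb_int del: emb.simps)
  moreover have "emb 1 1 (ES 0) = (inverse \<epsilon>r + \<epsilon>p) / 2"
    unfolding inv assms(1) by (rule double) (simp add: ES_def E_defs)
  ultimately show "emb 1 1 (ES t) = (inverse \<epsilon>r + \<epsilon>p) / 2 + of_int t * (\<mu> - 2)"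
    using \<open>emb 1 1 MU = \<mu>\<close> by simp
qed

end

theorem theorem1p6:
  fixes n p q r :: int and K :: "real set" and \<epsilon>p \<epsilon>q \<epsilon>r \<mu> :: real
  assumes "n \<ge> 6"
    and "p = (2 * n - 1) * (2 * n + 1)"
    and "q = (2 * n - 1) * (2 * n + 3)"
    and "r = (2 * n + 1) * (2 * n + 3)"
    and "squarefree p" and "squarefree q" and "squarefree r"
    and "K = adjoin_rat {sqrt p, sqrt q}"
    and "\<epsilon>p = fundamental_unit (adjoin_rat {sqrt p})"
    and "\<epsilon>q = fundamental_unit (adjoin_rat {sqrt q})"
    and "\<epsilon>r = fundamental_unit (adjoin_rat {sqrt r})"
    and "\<mu> = (of_int n + 3 / 2) + 1 / 2 * sqrt p + 1 / 2 * sqrt q + 1 / 2 * sqrt r"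
  shows "complete_set_of_indecomposables K
           ({1, (inverse \<epsilon>p + \<epsilon>r) / 2, \<mu>}
            \<union> {1 + \<epsilon>p + of_int t * (\<mu> - 1) | t :: int. 3 \<le> t \<and> t \<le> 2 * n - 2}
            \<union> {(1 + \<epsilon>p * \<epsilon>r) / 2 + \<epsilon>p + of_int t * (\<mu> - 1) | t :: int. 3 \<le> t \<and> t \<le> 2 * n - 2}
            \<union> {1 + inverse \<epsilon>q + of_int t * (\<mu> - 1) | t :: int. 4 \<le> t \<and> t \<le> 2 * n - 1}
            \<union> {(1 + \<epsilon>r * \<epsilon>p) / 2 + inverse \<epsilon>q + of_int t * (\<mu> - 1) | t :: int. 4 \<le> t \<and> t \<le> 2 * n - 1}
            \<union> {(inverse \<epsilon>r + \<epsilon>p) / 2 + of_int t * (\<mu> - 2) | t :: int. 2 \<le> t \<and> t \<le> 2 * n - 1})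
         \<and> int (iota K) = 10 * n - 15"
proof -
  interpret biquadratic n by unfold_locales (rule assms(1))
  have pqr: "p = biquadratic.p n" "q = biquadratic.q n" "r = biquadratic.r n"
    using assms(2-4) by (simp_all add: p_def q_def r_def)
  interpret squarefree_biquadratic n
    using assms(5-7) unfolding pqr by unfold_locales
  have K: "K = KK" using assms(8) unfolding pqr adjoin_eq_KK .
  have \<epsilon>: "\<epsilon>p = emb 1 1 EP" "\<epsilon>q = emb 1 1 EQ" "\<epsilon>r = emb 1 1 ER"
    using assms(9-11) unfolding pqr fundamental_unit_p fundamental_unit_q fundamental_unit_r .
  note e = emb_reps[OF \<epsilon> assms(12)[unfolded pqr]]
  have img: "{g t |t. a \<le> t \<and> t \<le> b} = g ` {a..b}" for g :: "int \<Rightarrow> real" and a b by auto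
  have "emb 1 1 ` reps = {1, (inverse \<epsilon>p + \<epsilon>r) / 2, \<mu>}
            \<union> {1 + \<epsilon>p + of_int t * (\<mu> - 1) | t :: int. 3 \<le> t \<and> t \<le> 2 * n - 2}
            \<union> {(1 + \<epsilon>p * \<epsilon>r) / 2 + \<epsilon>p + of_int t * (\<mu> - 1) | t :: int. 3 \<le> t \<and> t \<le> 2 * n - 2}
            \<union> {1 + inverse \<epsilon>q + of_int t * (\<mu> - 1) | t :: int. 4 \<le> t \<and> t \<le> 2 * n - 1}
            \<union> {(1 + \<epsilon>r * \<epsilon>p) / 2 + inverse \<epsilon>q + of_int t * (\<mu> - 1) | t :: int. 4 \<le> t \<and> t \<le> 2 * n - 1}
            \<union> {(inverse \<epsilon>r + \<epsilon>p) / 2 + of_int t * (\<mu> - 2) | t :: int. 2 \<le> t \<and> t \<le> 2 * n - 1}"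
    unfolding reps_param image_Un image_insert image_empty image_image e emb_one img ..
  with complete_reps iota_KK show ?thesis unfolding K by simp
qed

end
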